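(* Let $k,l\ge1$ be integers, and let $H_{-i}$, $i=0,\ldots,l$, be the homology groups of the Koszul complex $\mathcal{C}$ of $P$ with respect to $y_1-y_1',\ldots,y_l-y_l'$. Then $$\sum_{i=0}^l(-1)^i t^{-i}\,\mathrm{qdim}\,H_{-i}=\mathrm{qdim}\,R'\,\prod_{i=1}^l\left(1-t^{-1}q^{2k+2i-1}\right).$$
   Context: Conventions: $\deg x_i=\deg x_i'=\deg y_i=\deg y_i'=2i$ (the $q$-grading); $x_0=y_0=x_0'=y_0'=1$, and $x_i=x_i'=0$ for $i<0$ or $i>k$, $y_i=y_i'=0$ for $i<0$ or $i>l$. For a graded module $N$, $N\{s\}$ denotes $N$ with its grading shifted upward by $s$ (an element of degree $d$ in $N$ has degree $d+s$ in $N\{s\}$). For a graded vector space $N=\bigoplus_d N_d$ with finite-dimensional graded pieces, $\mathrm{qdim}\,N=\sum_d(\dim_{\mathbb{C}} N_d)q^d$. Here $q$ and $t$ are formal variables. The ring $P$ is $$P=\mathbb{C}[x_1,\ldots,x_k,y_1,\ldots,y_l,x'_1,\ldots,x'_k,y'_1,\ldots,y'_l]/I,$$ where $I$ is the homogeneous ideal generated by $\sum_{j=0}^i x_jy_{i-j}-\sum_{j=0}^i x'_jy'_{i-j}$ for $i=1,\ldots,k+l$. (As a graded bimodule, $P$ is isomorphic to $R_{k,l}\otimes_{R_{k+l}}R_{k,l}$, where $R_{k,l}$ and $R_{k+l}$ are the rings of $S_k\times S_l$-invariant and $S_{k+l}$-invariant complex polynomials in $k+l$ variables.) $\mathcal{C}$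 is the tensor product over $P$, for $i=1,\ldots,l$, of the two-term complexes $$0\to P\{2i-1\}\xrightarrow{\;y_i-y_i'\;}P\to0,$$ with the right-most term $P$ of each placed in cohomological degree $0$ (and $P\{2i-1\}$ in degree $-1$). $H_{-i}$ denotes the homology of $\mathcal{C}$ in cohomological degree $-i$, with its induced $q$-grading. $R'=\mathbb{C}[x_1,\ldots,x_k,y_1,\ldots,y_l]$ with $\deg x_i=\deg y_i=2i$. *)

theory Defs
  imports
    "Jordan_Normal_Form.VS_Connect"
    "HOL-Library.Poly_Mapping"
    "HOL-Library.FuncSet"
    "HOL-Algebra.QuotRing"
    "HOL-Computational_Algebra.Formal_Laurent_Series"
begin

text \<open>
  The ground field is \<^term>\<open>class_ring :: complex ring\<close>.  A grading of a vector space is given by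
  its homogeneous subspaces, a function of type \<^typ>\<open>int \<Rightarrow> 'a set\<close>.  The graded dimension is a
  Laurent series in \<open>q\<close>.  It is meaningful if all homogeneous subspaces are finite-dimensional and
  those of sufficiently negative degree vanish.  Series in \<open>t\<close> with such coefficients have type
  \<^typ>\<open>int fls fls\<close>, where \<open>t\<close> is \<^const>\<open>fls_X\<close>, \<open>t\<^sup>-\<^sup>1\<close> is \<^const>\<open>fls_X_inv\<close>, and \<open>q\<close> is
  \<^term>\<open>fls_const fls_X\<close>.
\<close>

definition qdim :: "(complex, 'a) module \<Rightarrow> (int \<Rightarrow> 'a set) \<Rightarrow> int fls" where
  "qdim N G = Abs_fls (\<lambda>d. int (vectorspace.dim (class_ring :: complex ring) (N\<lparr>carrier := G d\<rparr>)))"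

definition shift_grading :: "int \<Rightarrow> (int \<Rightarrow> 'a set) \<Rightarrow> int \<Rightarrow> 'a set" where
  "shift_grading s G = (\<lambda>d. G (d - s))"

text \<open>
  The quotient of a module (or algebra) by a submodule (or ideal), with the scalar multiplication
  that maps \<open>c\<close> and the coset of \<open>a\<close> to the coset of \<open>c a\<close>.  The ring multiplication of the result
  is meaningful only when \<open>N\<close> is an ideal of an algebra.
\<close>

definition quot_module :: "(complex, 'a) module \<Rightarrow> 'a set \<Rightarrow> (complex, 'a set) module" where
  "quot_module M N =
     ring.extend (M Quot N) (module.fields (\<lambda>c A. \<Union>a\<in>A. N +>\<^bsub>M\<^esub> (c \<odot>\<^bsub>M\<^esub> a)))"

definition quot_grading ::
    "(complex, 'a) module \<Rightarrow> 'a set \<Rightarrow> (int \<Rightarrow> 'a set) \<Rightarrow> int \<Rightarrow> 'a set set" where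
  "quot_grading M N G = (\<lambda>d. (\<lambda>a. N +>\<^bsub>M\<^esub> a) ` G d)"

definition cocycles :: "(int \<Rightarrow> (complex, 'a) module) \<Rightarrow> (int \<Rightarrow> 'a \<Rightarrow> 'a) \<Rightarrow> int \<Rightarrow> 'a set" where
  "cocycles C \<delta> c = a_kernel (C c) (C (c + 1)) (\<delta> c)"

definition coboundaries :: "(int \<Rightarrow> (complex, 'a) module) \<Rightarrow> (int \<Rightarrow> 'a \<Rightarrow> 'a) \<Rightarrow> int \<Rightarrow> 'a set" where
  "coboundaries C \<delta> c = \<delta> (c - 1) ` carrier (C (c - 1))"

definition homology ::
    "(int \<Rightarrow> (complex, 'a) module) \<Rightarrow> (int \<Rightarrow> 'a \<Rightarrow> 'a) \<Rightarrow> int \<Rightarrow> (complex, 'a set) module" where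
  "homology C \<delta> c = quot_module ((C c)\<lparr>carrier := cocycles C \<delta> c\<rparr>) (coboundaries C \<delta> c)"

text \<open>The homogeneous part of degree \<open>d\<close> consists of the classes of homogeneous cocycles of degree \<open>d\<close>.\<close>

definition homology_grading ::
    "(int \<Rightarrow> (complex, 'a) module) \<Rightarrow> (int \<Rightarrow> 'a \<Rightarrow> 'a) \<Rightarrow> (int \<Rightarrow> int \<Rightarrow> 'a set)
      \<Rightarrow> int \<Rightarrow> int \<Rightarrow> 'a set set" where
  "homology_grading C \<delta> G c =
     quot_grading ((C c)\<lparr>carrier := cocycles C \<delta> c\<rparr>) (coboundaries C \<delta> c)
       (\<lambda>d. cocycles C \<delta> c \<inter> G c d)"

text \<open>
  The tensor product over \<open>A\<close> of the two-term complexes \<open>A{s\<^sub>i} \<rightarrow> A\<close>, multiplication by \<open>a\<^sub>i\<close>, for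
  \<open>i = 1, \<dots>, l\<close>.  Each factor in cohomological degree \<open>-1\<close> has the basis element \<open>e\<^sub>i\<close> of
  \<open>q\<close>-degree \<open>s\<^sub>i\<close>, so the tensor product in cohomological degree \<open>c\<close> is free over \<open>A\<close> with basis
  the ordered products \<open>e\<^sub>S\<close> over the subsets \<open>S\<close> of \<open>{1..l}\<close> with \<open>-c\<close> elements.  An element is
  represented by its coefficient function \<open>S \<mapsto> f S\<close>.  By the Leibniz rule, the sign of
  \<open>e\<^sub>T\<close> in the differential of \<open>e\<^sub>S\<close>, where \<open>S = T \<union> {i}\<close>, is \<open>(-1)\<close> to the number of \<open>j \<in> S\<close>
  with \<open>j < i\<close>.
\<close>

definition koszul_index :: "nat \<Rightarrow> int \<Rightarrow> nat set set" where
  "koszul_index l c = {S. S \<subseteq> {1..l} \<and> int (card S) = - c}"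

definition koszul_module ::
    "(complex, 'a) module \<Rightarrow> nat \<Rightarrow> int \<Rightarrow> (complex, nat set \<Rightarrow> 'a) module" where
  "koszul_module A l c =
     \<lparr>carrier = koszul_index l c \<rightarrow>\<^sub>E carrier A,
      monoid.mult = (\<lambda>f g. \<lambda>S\<in>koszul_index l c. \<zero>\<^bsub>A\<^esub>),
      one = (\<lambda>S\<in>koszul_index l c. \<zero>\<^bsub>A\<^esub>),
      zero = (\<lambda>S\<in>koszul_index l c. \<zero>\<^bsub>A\<^esub>),
      add = (\<lambda>f g. \<lambda>S\<in>koszul_index l c. f S \<oplus>\<^bsub>A\<^esub> g S),
      module.smult = (\<lambda>z f. \<lambda>S\<in>koszul_index l c. z \<odot>\<^bsub>A\<^esub> f S)\<rparr>"

definition koszul_diff ::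
    "(complex, 'a) module \<Rightarrow> nat \<Rightarrow> (nat \<Rightarrow> 'a) \<Rightarrow> int \<Rightarrow> (nat set \<Rightarrow> 'a) \<Rightarrow> (nat set \<Rightarrow> 'a)" where
  "koszul_diff A l a c f =
     (\<lambda>T\<in>koszul_index l (c + 1).
        \<Oplus>\<^bsub>A\<^esub>i\<in>{1..l} - T.
          (if even (card {j \<in> T. j < i}) then a i \<otimes>\<^bsub>A\<^esub> f (insert i T)
           else \<ominus>\<^bsub>A\<^esub> (a i \<otimes>\<^bsub>A\<^esub> f (insert i T))))"

definition koszul_grading ::
    "(int \<Rightarrow> 'a set) \<Rightarrow> nat \<Rightarrow> (nat \<Rightarrow> int) \<Rightarrow> int \<Rightarrow> int \<Rightarrow> (nat set \<Rightarrow> 'a) set" where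
  "koszul_grading G l s c d = (\<Pi>\<^sub>E S\<in>koszul_index l c. shift_grading (\<Sum>i\<in>S. s i) G d)"

datatype var = VX nat | VY nat | VX' nat | VY' nat

text \<open>Exponent vectors are finitely supported maps from variables to \<^typ>\<open>nat\<close>.\<close>

type_synonym mvpoly = "(var \<Rightarrow>\<^sub>0 nat) \<Rightarrow>\<^sub>0 complex"

fun var_deg :: "var \<Rightarrow> nat" where
  "var_deg (VX i) = 2 * i"
| "var_deg (VY i) = 2 * i"
| "var_deg (VX' i) = 2 * i"
| "var_deg (VY' i) = 2 * i"

definition monom_deg :: "(var \<Rightarrow>\<^sub>0 nat) \<Rightarrow> nat" where
  "monom_deg m = (\<Sum>v\<in>Poly_Mapping.keys m. Poly_Mapping.lookup m v * var_deg v)"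

definition mvpoly_ring :: "var set \<Rightarrow> (complex, mvpoly) module" where
  "mvpoly_ring V =
     \<lparr>carrier = {p. \<forall>m\<in>Poly_Mapping.keys p. Poly_Mapping.keys m \<subseteq> V},
      monoid.mult = (*), one = 1, zero = 0, add = (+),
      module.smult = (\<lambda>z p. Poly_Mapping.single 0 z * p)\<rparr>"

definition mvpoly_grading :: "var set \<Rightarrow> int \<Rightarrow> mvpoly set" where
  "mvpoly_grading V d =
     {p \<in> carrier (mvpoly_ring V). \<forall>m\<in>Poly_Mapping.keys p. int (monom_deg m) = d}"

text \<open>
  \<open>var_seq v n\<close> is the sequence \<open>v\<^sub>0, v\<^sub>1, v\<^sub>2, \<dots>\<close> with \<open>v\<^sub>0 = 1\<close> and \<open>v\<^sub>i = 0\<close> for \<open>i > n\<close>.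
\<close>

definition var_seq :: "(nat \<Rightarrow> var) \<Rightarrow> nat \<Rightarrow> nat \<Rightarrow> mvpoly" where
  "var_seq v n i =
     (if i = 0 then 1
      else if i \<le> n then Poly_Mapping.single (Poly_Mapping.single (v i) 1) 1
      else 0)"

definition R'_vars :: "nat \<Rightarrow> nat \<Rightarrow> var set" where
  "R'_vars k l = VX ` {1..k} \<union> VY ` {1..l}"

definition P_vars :: "nat \<Rightarrow> nat \<Rightarrow> var set" where
  "P_vars k l = VX ` {1..k} \<union> VY ` {1..l} \<union> VX' ` {1..k} \<union> VY' ` {1..l}"

definition P_rel :: "nat \<Rightarrow> nat \<Rightarrow> nat \<Rightarrow> mvpoly" where
  "P_rel k l i =
     (\<Sum>j=0..i. var_seq VX k j * var_seq VY l (i - j)) - (\<Sum>j=0..i. var_seq VX' k j * var_seq VY' l (i - j))"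

definition P_ideal :: "nat \<Rightarrow> nat \<Rightarrow> mvpoly set" where
  "P_ideal k l = Idl\<^bsub>mvpoly_ring (P_vars k l)\<^esub> (P_rel k l ` {1..k + l})"

definition P_alg :: "nat \<Rightarrow> nat \<Rightarrow> (complex, mvpoly set) module" where
  "P_alg k l = quot_module (mvpoly_ring (P_vars k l)) (P_ideal k l)"

definition P_grading :: "nat \<Rightarrow> nat \<Rightarrow> int \<Rightarrow> mvpoly set set" where
  "P_grading k l = quot_grading (mvpoly_ring (P_vars k l)) (P_ideal k l) (mvpoly_grading (P_vars k l))"

definition P_elt :: "nat \<Rightarrow> nat \<Rightarrow> nat \<Rightarrow> mvpoly set" where
  "P_elt k l i = P_ideal k l +>\<^bsub>mvpoly_ring (P_vars k l)\<^esub> (var_seq VY l i - var_seq VY' l i)"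

definition P_koszul :: "nat \<Rightarrow> nat \<Rightarrow> int \<Rightarrow> (complex, nat set \<Rightarrow> mvpoly set) module" where
  "P_koszul k l = koszul_module (P_alg k l) l"

definition P_diff :: "nat \<Rightarrow> nat \<Rightarrow> int \<Rightarrow> (nat set \<Rightarrow> mvpoly set) \<Rightarrow> (nat set \<Rightarrow> mvpoly set)" where
  "P_diff k l = koszul_diff (P_alg k l) l (P_elt k l)"

text \<open>
  With the shifts \<open>2i - 1\<close> the differential raises the \<open>q\<close>-degree by one, because
  \<open>y\<^sub>i - y'\<^sub>i\<close> has degree \<open>2i\<close>; its kernel and image are still homogeneous.
\<close>

definition P_koszul_grading :: "nat \<Rightarrow> nat \<Rightarrow> int \<Rightarrow> int \<Rightarrow> (nat set \<Rightarrow> mvpoly set) set" where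
  "P_koszul_grading k l = koszul_grading (P_grading k l) l (\<lambda>i. 2 * int i - 1)"

definition P_homology :: "nat \<Rightarrow> nat \<Rightarrow> int \<Rightarrow> (complex, (nat set \<Rightarrow> mvpoly set) set) module" where
  "P_homology k l = homology (P_koszul k l) (P_diff k l)"

definition P_homology_grading :: "nat \<Rightarrow> nat \<Rightarrow> int \<Rightarrow> int \<Rightarrow> (nat set \<Rightarrow> mvpoly set) set set" where
  "P_homology_grading k l = homology_grading (P_koszul k l) (P_diff k l) (P_koszul_grading k l)"

end

theory Submission
  imports Defs "HOL-Library.Function_Algebras"
begin

text \<open>
  Let \<open>S\<close> be the polynomial ring in all variables, \<open>r\<^sub>1, \<dots>, r\<^sub>k\<^sub>+\<^sub>l\<close> the relations of \<open>P\<close> and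
  \<open>u\<^sub>i = y\<^sub>i - y'\<^sub>i\<close>.  For a homogeneous ideal \<open>J\<close> of \<open>S\<close>, consider the Koszul complex of
  \<open>u\<^sub>1, \<dots>, u\<^sub>l\<close> over \<open>S/J\<close> and the series \<open>\<Sum>\<^sub>i (-1)\<^sup>i t\<^sup>-\<^sup>i qdim H\<^sub>-\<^sub>i\<close> of its homology.  The proof
  compares these series for different \<open>J\<close>.

  The comparison is this.  Suppose that \<open>f\<close> is homogeneous of degree \<open>e\<close>, a nonzerodivisor on
  \<open>S/J\<close>, and lies in \<open>J + (u\<^sub>1, \<dots>, u\<^sub>l)\<close>.  Multiplication by \<open>f\<close> is then null-homotopic on the
  Koszul complex, because multiplication by \<open>u\<^sub>i\<close> is the anticommutator of the differential and
  the exterior multiplication by \<open>e\<^sub>i\<close>.  So the long exact sequence of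
  \<open>0 \<rightarrow> S/J \<rightarrow> S/J \<rightarrow> S/(J + (f)) \<rightarrow> 0\<close> breaks into short exact sequences, and passing from \<open>J\<close> to
  \<open>J + (f)\<close> multiplies the series by \<open>1 - t\<^sup>-\<^sup>1 q\<^sup>e\<^sup>-\<^sup>1\<close> (\<open>homology_series_ideal_insert\<close>).  It can be used
  in both directions:

  \<^item> Over \<open>S/(r\<^sub>1, \<dots>, r\<^sub>k, u\<^sub>1, \<dots>, u\<^sub>l)\<close> the differential vanishes, and this ring has the graded
    dimension of \<open>R'\<close>.  The series is therefore \<open>qdim R'\<close> times the product of the factors
    \<open>1 - t\<^sup>-\<^sup>1 q\<^sup>2\<^sup>i\<^sup>-\<^sup>1\<close> for \<open>i = 1, \<dots>, l\<close>.
  \<^item> Removing \<open>u\<^sub>l, \<dots>, u\<^sub>1\<close> from the ideal divides by exactly these factors.  The series of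
    \<open>S/(r\<^sub>1, \<dots>, r\<^sub>k)\<close> is \<open>qdim R'\<close>.
  \<^item> Modulo \<open>u\<^sub>1, \<dots>, u\<^sub>l\<close> the relations become \<open>\<Sum>\<^sub>j (x\<^sub>j - x'\<^sub>j) y\<^sub>i\<^sub>-\<^sub>j\<close>, so \<open>r\<^sub>1, \<dots>, r\<^sub>k\<close> already
    generate all \<open>x\<^sub>j - x'\<^sub>j\<close>, and \<open>r\<^sub>k\<^sub>+\<^sub>1, \<dots>, r\<^sub>k\<^sub>+\<^sub>l\<close> lie in \<open>(r\<^sub>1, \<dots>, r\<^sub>k, u\<^sub>1, \<dots>, u\<^sub>l)\<close>
    (\<open>r_in_ideal\<close>).  Adding them, of degrees \<open>2k + 2i\<close>, gives the factors of the claim.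

  What remains is that \<open>r\<^sub>1, \<dots>, r\<^sub>k\<^sub>+\<^sub>l\<close> and \<open>r\<^sub>1, \<dots>, r\<^sub>k, u\<^sub>1, \<dots>, u\<^sub>l\<close> are regular sequences.
  Homogeneous regular sequences of positive degree can be permuted (\<open>regular_rotate\<close>), so the
  variables \<open>x'\<^sub>i\<close>, \<open>y'\<^sub>i\<close> may be put in front.  This reduces the first sequence to the elements
  \<open>c\<^sub>i = \<Sum>\<^sub>j x\<^sub>j y\<^sub>i\<^sub>-\<^sub>j\<close>, and there the last element is a product, \<open>c\<^sub>k\<^sub>+\<^sub>l = x\<^sub>k y\<^sub>l\<close>.  A product is a
  nonzerodivisor if both factors are; after another permutation, dividing by \<open>x\<^sub>k\<close> or by \<open>y\<^sub>l\<close>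
  leads to the same statement with \<open>k\<close> or \<open>l\<close> lowered by one (\<open>regular_rels_killed\<close>).

  All of this is done one degree at a time.  A homogeneous ideal is the family of its
  homogeneous parts, and the homology of degree \<open>d\<close> over \<open>S/J\<close> is the quotient of two subspaces of
  a finite-dimensional space of chains with coefficients in \<open>S\<close>: the chains whose differential
  has coefficients in \<open>J\<close>, modulo the boundaries and the chains with coefficients in \<open>J\<close>.
  The last part identifies these quotients, for the ideal of all relations, with the homology
  modules of the complex over \<open>P\<close>.
\<close>

section \<open>Dimensions of quotients of subspaces\<close>

text \<open>A copy of \<open>vector_space\<close>.  Notions added to \<open>vector_space\<close> itself would also be instantiated for
  real vector spaces, under the same unqualified names.\<close>

locale quotient_space = vector_space scale
  for scale :: "'a::field \<Rightarrow> 'b::ab_group_add \<Rightarrow> 'b"  (infixr \<open>*s\<close> 75)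
begin

definition finitely_spanned :: "'b set \<Rightarrow> bool" where
  "finitely_spanned X \<longleftrightarrow> (\<exists>B. finite B \<and> X \<subseteq> span B)"

text \<open>For \<open>W \<subseteq> U\<close> in a finite-dimensional space this is the dimension of \<open>U/W\<close>.  Quotients of subspaces are
  treated as pairs, so that the arguments about homology need no cosets.\<close>

definition codim :: "'b set \<Rightarrow> 'b set \<Rightarrow> nat" where
  "codim U W = dim U - dim W"

text \<open>Representatives in \<open>U\<close> of a basis of \<open>U/W\<close>.\<close>

definition basis_mod :: "'b set \<Rightarrow> 'b set \<Rightarrow> 'b set \<Rightarrow> bool" where
  "basis_mod U W C \<longleftrightarrow> finite C \<and> C \<subseteq> U \<and> (\<forall>u\<in>U. \<exists>a. u - (\<Sum>c\<in>C. a c *s c) \<in> W)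
     \<and> (\<forall>a. (\<Sum>c\<in>C. a c *s c) \<in> W \<longrightarrow> (\<forall>c\<in>C. a c = 0))"

lemma finitely_spanned_subset: "finitely_spanned X \<Longrightarrow> Y \<subseteq> X \<Longrightarrow> finitely_spanned Y"
  unfolding finitely_spanned_def by blast

lemma finitely_spanned_basis:
  assumes "finitely_spanned X" and "independent B" and "B \<subseteq> X"
  shows "finite B"
  using assms independent_span_bound unfolding finitely_spanned_def by (meson subset_trans)

lemma dim_mono_finitely_spanned:
  assumes "finitely_spanned U" and "W \<subseteq> U"
  shows "dim W \<le> dim U"
proof -
  obtain B where B: "B \<subseteq> U" "independent B" "U \<subseteq> span B" "card B = dim U"
    using basis_exists by blast
  have "finite B" using finitely_spanned_basis[OF assms(1) B(2,1)] .
  then show ?thesis using dim_le_card[of W B] assms(2) B by auto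
qed

lemma codim_self [simp]: "codim U U = 0"
  by (simp add: codim_def)

lemma codim_trans:
  assumes "finitely_spanned U" and "W \<subseteq> X" and "X \<subseteq> U"
  shows "codim U W = codim U X + codim X W"
  using dim_mono_finitely_spanned[OF assms(1,3)]
    dim_mono_finitely_spanned[OF finitely_spanned_subset[OF assms(1,3)] assms(2)]
  unfolding codim_def by simp

text \<open>Together with a basis of \<open>W\<close>, the representatives form a basis of \<open>U\<close>.\<close>

lemma basis_mod_card:
  assumes "finitely_spanned U" and "subspace U" and "subspace W" and "W \<subseteq> U" and "basis_mod U W C"
  shows "card C = codim U W"
proof -
  obtain B where B: "B \<subseteq> W" "independent B" "W \<subseteq> span B" "card B = dim W"
    using basis_exists by blast
  have C: "finite C" "C \<subseteq> U" "\<And>u. u \<in> U \<Longrightarrow> \<exists>a. u - (\<Sum>c\<in>C. a c *s c) \<in> W"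
    "\<And>a. (\<Sum>c\<in>C. a c *s c) \<in> W \<Longrightarrow> (\<forall>c\<in>C. a c = 0)"
    using assms(5) unfolding basis_mod_def by blast+
  have finB: "finite B"
    using finitely_spanned_basis[OF assms(1) B(2) subset_trans[OF B(1) assms(4)]] .
  have spB: "span B = W"
    using B(1,3) assms(3) by (metis span_minimal subset_antisym)
  have disj: "B \<inter> C = {}"
  proof (rule ccontr)
    assume "B \<inter> C \<noteq> {}"
    then obtain c where c: "c \<in> B" "c \<in> C" by blast
    have "(\<Sum>x\<in>C. (if x = c then 1 else 0) *s x) = (\<Sum>x\<in>{c}. x)"
      using c C(1) by (intro sum.mono_neutral_cong_right) auto
    then have "(\<Sum>x\<in>C. (if x = c then 1 else 0) *s x) \<in> W" using c B by auto
    from C(4)[OF this] c show False by auto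
  qed
  have "independent (B \<union> C)"
  proof (rule independent_if_scalars_zero)
    show "finite (B \<union> C)" using finB C(1) by simp
    fix f x assume 0: "(\<Sum>x\<in>B \<union> C. f x *s x) = 0" and x: "x \<in> B \<union> C"
    have s: "(\<Sum>x\<in>B. f x *s x) + (\<Sum>x\<in>C. f x *s x) = 0"
      using 0 finB C(1) disj by (simp add: sum.union_disjoint)
    have "(\<Sum>x\<in>B. f x *s x) \<in> W"
      using B(1) assms(3) by (intro subspace_sum subspace_scale) auto
    then have "(\<Sum>x\<in>C. f x *s x) \<in> W"
      using s assms(3) by (metis minus_unique subspace_neg)
    then have fC: "\<forall>c\<in>C. f c = 0" by (rule C(4))
    then have "(\<Sum>x\<in>B. f x *s x) = 0" using s by simp
    then have "\<forall>b\<in>B. f b = 0"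
      using local.independentD[OF B(2) finB subset_refl] by blast
    with fC x show "f x = 0" by blast
  qed
  moreover have "U \<subseteq> span (B \<union> C)"
  proof
    fix u assume "u \<in> U"
    then obtain a where a: "u - (\<Sum>c\<in>C. a c *s c) \<in> W" using C(3) by blast
    then have "u - (\<Sum>c\<in>C. a c *s c) \<in> span (B \<union> C)"
      using spB span_mono[of B "B \<union> C"] by auto
    moreover have "(\<Sum>c\<in>C. a c *s c) \<in> span (B \<union> C)"
      by (intro span_sum span_scale span_base) auto
    ultimately show "u \<in> span (B \<union> C)" by (metis diff_add_cancel span_add)
  qed
  ultimately have "card (B \<union> C) = dim U"
    using B(1) C(2) assms(4) by (intro basis_card_eq_dim) auto
  then show ?thesis using finB C(1) disj B(4) by (simp add: card_Un_disjoint codim_def)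
qed

lemma basis_mod_exists:
  assumes "finitely_spanned U" and "subspace U" and "subspace W" and "W \<subseteq> U"
  obtains C where "basis_mod U W C"
proof -
  obtain B where B: "B \<subseteq> W" "independent B" "W \<subseteq> span B" "card B = dim W"
    using basis_exists by blast
  then obtain B' where B': "B \<subseteq> B'" "B' \<subseteq> U" "independent B'" "U \<subseteq> span B'"
    using maximal_independent_subset_extend[OF subset_trans[OF B(1) assms(4)] B(2)] by blast
  have fin: "finite B'" using finitely_spanned_basis[OF assms(1) B'(3,2)] .
  have finB: "finite B" using fin B'(1) finite_subset by blast
  have spB: "span B = W"
    using B(1,3) assms(3) by (metis span_minimal subset_antisym)
  have split: "(\<Sum>c\<in>B'. a c *s c) = (\<Sum>c\<in>B. a c *s c) + (\<Sum>c\<in>B'-B. a c *s c)" for a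
    using sum.subset_diff[OF B'(1) fin, of "\<lambda>c. a c *s c"] by (simp add: add.commute)
  have "basis_mod U W (B' - B)"
    unfolding basis_mod_def
  proof (intro conjI ballI allI impI)
    show "finite (B' - B)" "B' - B \<subseteq> U" using fin B' by auto
    fix u assume "u \<in> U"
    then obtain a where "u = (\<Sum>c\<in>B'. a c *s c)"
      using B'(4) span_finite[OF fin] by auto
    then have "u - (\<Sum>c\<in>B'-B. a c *s c) = (\<Sum>c\<in>B. a c *s c)" using split by simp
    also have "\<dots> \<in> W" using B(1) assms(3) by (intro subspace_sum subspace_scale) auto
    finally show "\<exists>a. u - (\<Sum>c\<in>B'-B. a c *s c) \<in> W" by blast
  next
    fix a c assume s: "(\<Sum>c\<in>B'-B. a c *s c) \<in> W" and c: "c \<in> B' - B"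
    then obtain b where b: "(\<Sum>c\<in>B'-B. a c *s c) = (\<Sum>c\<in>B. b c *s c)"
      using spB span_finite[OF finB] by auto
    define f where "f x = (if x \<in> B then - b x else a x)" for x
    have "(\<Sum>x\<in>B. f x *s x) = - (\<Sum>c\<in>B. b c *s c)"
      by (simp add: f_def sum_negf)
    moreover have "(\<Sum>x\<in>B'-B. f x *s x) = (\<Sum>x\<in>B'-B. a x *s x)"
      by (intro sum.cong) (auto simp: f_def)
    ultimately have "(\<Sum>x\<in>B'. f x *s x) = 0" using b split by simp
    then have "f c = 0" using local.independentD[OF B'(3) fin subset_refl] c by blast
    then show "a c = 0" using c by (simp add: f_def)
  qed
  then show thesis by (rule that)
qed

end

locale quotient_space_pair = vs1: quotient_space s1 + vs2: quotient_space s2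
  for s1 :: "'a::field \<Rightarrow> 'b::ab_group_add \<Rightarrow> 'b" and s2 :: "'a \<Rightarrow> 'c::ab_group_add \<Rightarrow> 'c"
begin

text \<open>The three conditions on \<open>h\<close> say that it induces an isomorphism \<open>U1/W1 \<rightarrow> U2/W2\<close>.  It carries
  representatives of a basis to representatives of a basis.\<close>

lemma codim_eqI:
  assumes h: "Vector_Spaces.linear s1 s2 h"
    and U1: "vs1.finitely_spanned U1" "vs1.subspace U1" "vs1.subspace W1" "W1 \<subseteq> U1"
    and U2: "vs2.finitely_spanned U2" "vs2.subspace U2" "vs2.subspace W2" "W2 \<subseteq> U2"
    and into: "\<And>v. v \<in> U1 \<Longrightarrow> h v \<in> U2"
    and onto: "\<And>u. u \<in> U2 \<Longrightarrow> \<exists>v\<in>U1. u - h v \<in> W2"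
    and ker: "\<And>v. v \<in> U1 \<Longrightarrow> h v \<in> W2 \<longleftrightarrow> v \<in> W1"
  shows "vs2.codim U2 W2 = vs1.codim U1 W1"
proof -
  interpret h: Vector_Spaces.linear s1 s2 h by (rule h)
  obtain C where bm: "vs1.basis_mod U1 W1 C" using vs1.basis_mod_exists[OF U1] .
  then have C: "finite C" "C \<subseteq> U1" "\<And>u. u \<in> U1 \<Longrightarrow> \<exists>a. u - (\<Sum>c\<in>C. s1 (a c) c) \<in> W1"
    "\<And>a. (\<Sum>c\<in>C. s1 (a c) c) \<in> W1 \<Longrightarrow> (\<forall>c\<in>C. a c = 0)"
    unfolding vs1.basis_mod_def by blast+
  have sumU: "(\<Sum>c\<in>C. s1 (a c) c) \<in> U1" for a
    using U1(2) C(2) by (intro vs1.subspace_sum vs1.subspace_scale) auto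
  have hsum: "h (\<Sum>c\<in>C. s1 (a c) c) = (\<Sum>c\<in>C. s2 (a c) (h c))" for a
    by (simp add: h.sum h.scale)
  have inj: "inj_on h C"
  proof (rule inj_onI, rule ccontr)
    fix x y assume xy: "x \<in> C" "y \<in> C" "h x = h y" "x \<noteq> y"
    define a where "a c = (if c = x then 1 else if c = y then -1 else (0::'a))" for c
    have "(\<Sum>c\<in>C. s2 (a c) (h c)) = (\<Sum>c\<in>{x,y}. s2 (a c) (h c))"
      using xy C(1) by (intro sum.mono_neutral_right) (auto simp: a_def)
    also have "\<dots> = 0" using xy by (simp add: a_def)
    finally have "h (\<Sum>c\<in>C. s1 (a c) c) \<in> W2" using hsum U2(3) vs2.subspace_0 by metis
    then have "(\<Sum>c\<in>C. s1 (a c) c) \<in> W1" using ker[OF sumU] by simp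
    from C(4)[OF this] xy(1) show False by (auto simp: a_def)
  qed
  have re: "(\<Sum>c\<in>h ` C. s2 (b c) c) = h (\<Sum>c\<in>C. s1 (b (h c)) c)" for b
    by (simp add: hsum sum.reindex[OF inj])
  have "vs2.basis_mod U2 W2 (h ` C)"
    unfolding vs2.basis_mod_def
  proof (intro conjI ballI allI impI)
    show "finite (h ` C)" "h ` C \<subseteq> U2" using C into by auto
    fix u assume "u \<in> U2"
    then obtain v where v: "v \<in> U1" "u - h v \<in> W2" using onto by blast
    obtain a where a: "v - (\<Sum>c\<in>C. s1 (a c) c) \<in> W1" using C(3) v by blast
    have "h (v - (\<Sum>c\<in>C. s1 (a c) c)) \<in> W2"
      using ker a U1(4) by blast
    then have "h v - (\<Sum>c\<in>C. s2 (a c) (h c)) \<in> W2" by (simp add: h.diff hsum)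
    with v(2) have "(u - h v) + (h v - (\<Sum>c\<in>C. s2 (a c) (h c))) \<in> W2"
      using U2(3) vs2.subspace_add by blast
    moreover have "(\<Sum>c\<in>h ` C. s2 (a (the_inv_into C h c)) c) = (\<Sum>c\<in>C. s2 (a c) (h c))"
      unfolding sum.reindex[OF inj] by (intro sum.cong) (auto simp: the_inv_into_f_f[OF inj])
    ultimately show "\<exists>a. u - (\<Sum>c\<in>h ` C. s2 (a c) c) \<in> W2"
      by (intro exI[of _ "\<lambda>c. a (the_inv_into C h c)"]) simp
  next
    fix b c assume "(\<Sum>c\<in>h ` C. s2 (b c) c) \<in> W2" and c: "c \<in> h ` C"
    then have "(\<Sum>c\<in>C. s1 (b (h c)) c) \<in> W1"
      unfolding re using ker[OF sumU] by simp
    from C(4)[OF this] c show "b c = 0" by auto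
  qed
  from vs2.basis_mod_card[OF U2 this] vs1.basis_mod_card[OF U1 bm]
  show ?thesis by (simp add: card_image[OF inj])
qed

end

text \<open>The module axioms pass to any structure that is the image of a vector space under a map
  respecting the operations.  This spares verifying them for cosets and for functions into cosets.\<close>

lemma module_linear_image:
  fixes N :: "(complex, 'c) module" and scale :: "complex \<Rightarrow> 'b::ab_group_add \<Rightarrow> 'b"
  assumes "quotient_space scale" and U: "module.subspace scale U"
    and carrier: "carrier N = \<phi> ` U"
    and add: "\<And>u v. u \<in> U \<Longrightarrow> v \<in> U \<Longrightarrow> \<phi> (u + v) = \<phi> u \<oplus>\<^bsub>N\<^esub> \<phi> v"
    and smult: "\<And>c u. u \<in> U \<Longrightarrow> \<phi> (scale c u) = c \<odot>\<^bsub>N\<^esub> \<phi> u"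
    and zero: "\<phi> 0 = \<zero>\<^bsub>N\<^esub>"
  shows "Module.module (class_ring :: complex ring) N"
proof -
  interpret vs: quotient_space scale by fact
  have mem: "0 \<in> U" "\<And>u v. u \<in> U \<Longrightarrow> v \<in> U \<Longrightarrow> u + v \<in> U" "\<And>c u. u \<in> U \<Longrightarrow> scale c u \<in> U"
    "\<And>u. u \<in> U \<Longrightarrow> - u \<in> U"
    using U by (auto intro: vs.subspace_0 vs.subspace_add vs.subspace_scale vs.subspace_neg)
  have opp: "\<phi> (- u) \<oplus>\<^bsub>N\<^esub> \<phi> u = \<zero>\<^bsub>N\<^esub>" if "u \<in> U" for u
    using add[of "- u" u] that mem zero by simp
  have assoc: "\<phi> u \<oplus>\<^bsub>N\<^esub> \<phi> v \<oplus>\<^bsub>N\<^esub> \<phi> w = \<phi> u \<oplus>\<^bsub>N\<^esub> (\<phi> v \<oplus>\<^bsub>N\<^esub> \<phi> w)" if "u \<in> U" "v \<in> U" "w \<in> U" for u v w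
    using add[of u "v + w"] add[of v w] add[of "u + v" w] add[of u v] that mem(2) by (simp add: add.assoc)
  have comm: "\<phi> u \<oplus>\<^bsub>N\<^esub> \<phi> v = \<phi> v \<oplus>\<^bsub>N\<^esub> \<phi> u" if "u \<in> U" "v \<in> U" for u v
    using add[of u v] add[of v u] that by (simp add: add.commute)
  have "abelian_group N"
  proof (rule abelian_groupI)
    show "\<zero>\<^bsub>N\<^esub> \<in> carrier N" using mem(1) zero carrier by (metis imageI)
    fix x y assume xy: "x \<in> carrier N" "y \<in> carrier N"
    then obtain u v where uv: "u \<in> U" "x = \<phi> u" "v \<in> U" "y = \<phi> v" using carrier by auto
    show "x \<oplus>\<^bsub>N\<^esub> y \<in> carrier N" using uv add mem(2) carrier by (metis imageI)
    show "x \<oplus>\<^bsub>N\<^esub> y = y \<oplus>\<^bsub>N\<^esub> x" using uv comm by simp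
    show "\<zero>\<^bsub>N\<^esub> \<oplus>\<^bsub>N\<^esub> x = x" using add[OF mem(1) uv(1)] uv(2) zero by simp
    show "\<exists>y\<in>carrier N. y \<oplus>\<^bsub>N\<^esub> x = \<zero>\<^bsub>N\<^esub>"
      using opp uv mem(4) carrier by blast
    fix z assume "z \<in> carrier N"
    then obtain w where "w \<in> U" "z = \<phi> w" using carrier by auto
    then show "x \<oplus>\<^bsub>N\<^esub> y \<oplus>\<^bsub>N\<^esub> z = x \<oplus>\<^bsub>N\<^esub> (y \<oplus>\<^bsub>N\<^esub> z)" using uv assoc by simp
  qed
  then show "Module.module (class_ring :: complex ring) N"
  proof (intro moduleI class_cring.is_cring)
    fix a b :: complex and x y assume xy: "x \<in> carrier N" "y \<in> carrier N"
    then obtain u v where uv: "u \<in> U" "x = \<phi> u" "v \<in> U" "y = \<phi> v" using carrier by auto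
    show "a \<odot>\<^bsub>N\<^esub> x \<in> carrier N" using uv smult mem(3) carrier by (metis imageI)
    show "a \<odot>\<^bsub>N\<^esub> (x \<oplus>\<^bsub>N\<^esub> y) = (a \<odot>\<^bsub>N\<^esub> x) \<oplus>\<^bsub>N\<^esub> (a \<odot>\<^bsub>N\<^esub> y)"
      using add[of u v] smult[of "u + v" a] smult[of u a] smult[of v a] add[of "scale a u" "scale a v"] uv mem(2,3)
      by (simp add: vs.scale_right_distrib)
    show "(a \<oplus>\<^bsub>class_ring\<^esub> b) \<odot>\<^bsub>N\<^esub> x = (a \<odot>\<^bsub>N\<^esub> x) \<oplus>\<^bsub>N\<^esub> (b \<odot>\<^bsub>N\<^esub> x)"
      using smult[of u "a + b"] smult[of u a] smult[of u b] add[of "scale a u" "scale b u"] uv mem(3)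
      by (simp add: vs.scale_left_distrib)
    show "(a \<otimes>\<^bsub>class_ring\<^esub> b) \<odot>\<^bsub>N\<^esub> x = a \<odot>\<^bsub>N\<^esub> (b \<odot>\<^bsub>N\<^esub> x)"
      using smult[of u "a * b"] smult[of u b] smult[of "scale b u" a] uv mem(3) by simp
    show "\<one>\<^bsub>class_ring\<^esub> \<odot>\<^bsub>N\<^esub> x = x" using smult[of u 1] uv by simp
  qed
qed

text \<open>\<open>\<phi>\<close> identifies \<open>U/W\<close> with \<open>N\<close>.\<close>

lemma vectorspace_dim_eq_codim:
  fixes N :: "(complex, 'c) module" and scale :: "complex \<Rightarrow> 'b::ab_group_add \<Rightarrow> 'b"
  assumes "quotient_space scale"
    and U: "quotient_space.finitely_spanned scale U" "module.subspace scale U" "module.subspace scale W" "W \<subseteq> U"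
    and carrier: "carrier N = \<phi> ` U"
    and add: "\<And>u v. u \<in> U \<Longrightarrow> v \<in> U \<Longrightarrow> \<phi> (u + v) = \<phi> u \<oplus>\<^bsub>N\<^esub> \<phi> v"
    and smult: "\<And>c u. u \<in> U \<Longrightarrow> \<phi> (scale c u) = c \<odot>\<^bsub>N\<^esub> \<phi> u"
    and ker: "\<And>u. u \<in> U \<Longrightarrow> \<phi> u = \<zero>\<^bsub>N\<^esub> \<longleftrightarrow> u \<in> W"
  shows "vectorspace.dim (class_ring :: complex ring) N = quotient_space.codim scale U W"
proof -
  interpret vs: quotient_space scale by fact
  have mem: "0 \<in> U" "\<And>u v. u \<in> U \<Longrightarrow> v \<in> U \<Longrightarrow> u + v \<in> U" "\<And>c u. u \<in> U \<Longrightarrow> scale c u \<in> U"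
    "\<And>u. u \<in> U \<Longrightarrow> - u \<in> U"
    using U(2) by (auto intro: vs.subspace_0 vs.subspace_add vs.subspace_scale vs.subspace_neg)
  have zero: "\<phi> 0 = \<zero>\<^bsub>N\<^esub>" using ker[OF mem(1)] U(3) vs.subspace_0 by blast
  have "Module.module (class_ring :: complex ring) N"
    using assms(1) U(2) carrier add smult zero by (rule module_linear_image)
  then interpret N: vectorspace "class_ring :: complex ring" N
    by (intro vectorspace.intro class_field)
  have smultN: "c \<odot>\<^bsub>N\<^esub> \<phi> u \<in> carrier N" if "u \<in> U" for c u
    using that mem smult carrier by (metis imageI)
  have sumU: "(\<Sum>c\<in>C. scale (a c) c) \<in> U" if "C \<subseteq> U" for a C
    using U(2) that by (intro vs.subspace_sum vs.subspace_scale) auto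
  have lin: "\<phi> (\<Sum>c\<in>C. scale (a c) c) = (\<Oplus>\<^bsub>N\<^esub>c\<in>C. a c \<odot>\<^bsub>N\<^esub> \<phi> c)" if "finite C" "C \<subseteq> U" for a C
    using that
  proof (induction C rule: finite_induct)
    case empty
    then show ?case by (simp add: zero)
  next
    case (insert x C)
    then show ?case
      using smultN by (subst N.finsum_insert) (auto simp: add mem sumU smult)
  qed
  obtain C where bm: "vs.basis_mod U W C" using vs.basis_mod_exists[OF U] .
  then have C: "finite C" "C \<subseteq> U" "\<And>u. u \<in> U \<Longrightarrow> \<exists>a. u - (\<Sum>c\<in>C. scale (a c) c) \<in> W"
    "\<And>a. (\<Sum>c\<in>C. scale (a c) c) \<in> W \<Longrightarrow> (\<forall>c\<in>C. a c = 0)"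
    unfolding vs.basis_mod_def by blast+
  have eqW: "\<phi> u = \<phi> v" if "u \<in> U" "v \<in> U" "u - v \<in> W" for u v
  proof -
    have "\<phi> u = \<phi> ((u - v) + v)" by simp
    also have "\<dots> = \<phi> (u - v) \<oplus>\<^bsub>N\<^esub> \<phi> v" using that U(4) by (intro add) auto
    also have "\<phi> (u - v) = \<zero>\<^bsub>N\<^esub>" using ker that U(4) by blast
    finally show ?thesis using that carrier by simp
  qed
  have inj: "inj_on \<phi> C"
  proof (rule inj_onI, rule ccontr)
    fix x y assume xy: "x \<in> C" "y \<in> C" "\<phi> x = \<phi> y" "x \<noteq> y"
    define a where "a c = (if c = x then 1 else if c = y then -1 else (0::complex))" for c
    have xU: "x \<in> U" "y \<in> U" using xy C by auto
    have "(\<Sum>c\<in>C. scale (a c) c) = (\<Sum>c\<in>{x,y}. scale (a c) c)"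
      using xy C(1) by (intro sum.mono_neutral_right) (auto simp: a_def)
    also have "\<dots> = x + - y" using xy(4) by (simp add: a_def)
    finally have s: "(\<Sum>c\<in>C. scale (a c) c) = x + - y" .
    have "\<phi> (x + - y) = \<phi> (y + - y)" using xU mem xy(3) by (simp only: add)
    then have "\<phi> (x + - y) = \<zero>\<^bsub>N\<^esub>" by (simp add: zero)
    moreover have "x + - y \<in> U" using xU mem by blast
    ultimately have "(\<Sum>c\<in>C. scale (a c) c) \<in> W"
      unfolding s using ker by simp
    from C(4)[OF this] xy(1) show False by (auto simp: a_def)
  qed
  have re: "N.lincomb b (\<phi> ` C) = \<phi> (\<Sum>c\<in>C. scale (b (\<phi> c)) c)" for b
    unfolding N.lincomb_def lin[OF C(1,2)]
    by (subst N.finsum_reindex[OF _ inj]) (use smultN C(2) in auto)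
  have "N.basis (\<phi> ` C)"
    unfolding N.basis_def
  proof (intro conjI)
    show CN: "\<phi> ` C \<subseteq> carrier N" using C(2) carrier by auto
    show "N.lin_indpt (\<phi> ` C)"
    proof
      assume "N.lin_dep (\<phi> ` C)"
      then obtain a v where av: "N.lincomb a (\<phi> ` C) = \<zero>\<^bsub>N\<^esub>" "v \<in> \<phi> ` C" "a v \<noteq> 0"
        using N.finite_lin_dep[of "\<phi> ` C"] C(1) CN by auto
      have "(\<Sum>c\<in>C. scale (a (\<phi> c)) c) \<in> W"
        using av(1) unfolding re using ker[OF sumU[OF C(2)]] by simp
      from C(4)[OF this] av(2,3) show False by auto
    qed
    show "N.span (\<phi> ` C) = carrier N"
    proof
      show "N.span (\<phi> ` C) \<subseteq> carrier N" by (rule N.span_is_subset2[OF CN])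
      show "carrier N \<subseteq> N.span (\<phi> ` C)"
      proof
        fix x assume "x \<in> carrier N"
        then obtain u where u: "u \<in> U" "x = \<phi> u" using carrier by auto
        obtain a where a: "u - (\<Sum>c\<in>C. scale (a c) c) \<in> W" using C(3) u by blast
        have "x = \<phi> (\<Sum>c\<in>C. scale (a c) c)" unfolding u(2) using u(1) sumU[OF C(2)] a by (rule eqW)
        also have "\<dots> = N.lincomb (\<lambda>y. a (the_inv_into C \<phi> y)) (\<phi> ` C)"
          unfolding re by (simp add: the_inv_into_f_f[OF inj] cong: sum.cong)
        finally show "x \<in> N.span (\<phi> ` C)" unfolding N.span_def using C(1) by auto
      qed
    qed
  qed
  then have "N.dim = card (\<phi> ` C)" using C(1) by (intro N.dim_basis) auto
  then show ?thesis using vs.basis_mod_card[OF U bm] by (simp add: card_image[OF inj])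
qed

lemma quot_module_simps:
  "carrier (quot_module M N) = a_rcosets\<^bsub>M\<^esub> N"
  "monoid.mult (quot_module M N) = rcoset_mult M N"
  "ring.add (quot_module M N) = set_add M"
  "ring.zero (quot_module M N) = N"
  "module.smult (quot_module M N) = (\<lambda>c A. \<Union>a\<in>A. N +>\<^bsub>M\<^esub> (c \<odot>\<^bsub>M\<^esub> a))"
  by (simp_all add: quot_module_def ring.extend_def module.fields_def FactRing_def)

text \<open>The union over representatives in the scalar multiplication of a quotient module is the coset
  of any one multiple.\<close>

lemma smult_coset:
  fixes M :: "(complex, 'c) module"
  assumes "Module.module (class_ring :: complex ring) M" and "abelian_subgroup N M"
    and smult: "\<And>c a. a \<in> N \<Longrightarrow> c \<odot>\<^bsub>M\<^esub> a \<in> N" and x: "x \<in> carrier M"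
  shows "(\<Union>a\<in>N +>\<^bsub>M\<^esub> x. N +>\<^bsub>M\<^esub> (c \<odot>\<^bsub>M\<^esub> a)) = N +>\<^bsub>M\<^esub> (c \<odot>\<^bsub>M\<^esub> x)"
proof -
  interpret M: Module.module "class_ring :: complex ring" M by fact
  interpret N: abelian_subgroup N M by fact
  have cx: "c \<odot>\<^bsub>M\<^esub> x \<in> carrier M" using x by simp
  have "N +>\<^bsub>M\<^esub> (c \<odot>\<^bsub>M\<^esub> a) = N +>\<^bsub>M\<^esub> (c \<odot>\<^bsub>M\<^esub> x)" if a: "a \<in> N +>\<^bsub>M\<^esub> x" for a
  proof -
    obtain n where n: "n \<in> N" "a = n \<oplus>\<^bsub>M\<^esub> x" using a by (auto simp: a_r_coset_def')
    then have "c \<odot>\<^bsub>M\<^esub> a = c \<odot>\<^bsub>M\<^esub> n \<oplus>\<^bsub>M\<^esub> c \<odot>\<^bsub>M\<^esub> x"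
      using x N.a_Hcarr[OF n(1)] M.smult_r_distr[of c n x] by simp
    then have "c \<odot>\<^bsub>M\<^esub> a \<in> N +>\<^bsub>M\<^esub> (c \<odot>\<^bsub>M\<^esub> x)"
      using smult[OF n(1)] by (auto simp: a_r_coset_def')
    from N.a_repr_independence'[OF this cx] show ?thesis by simp
  qed
  moreover have "x \<in> N +>\<^bsub>M\<^esub> x" by (rule N.a_rcos_self[OF x])
  ultimately show ?thesis by blast
qed

text \<open>Here \<open>\<psi>\<close> presents \<open>M\<close> as the image of \<open>U\<close>, and \<open>\<psi> ` W\<close> is the submodule to divide by.  The
  subspace measured in the quotient, later a graded piece, is the image of \<open>U0\<close>.\<close>

lemma dim_quot_module:
  fixes M :: "(complex, 'c) module" and scale :: "complex \<Rightarrow> 'b::ab_group_add \<Rightarrow> 'b"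
  assumes vs: "quotient_space scale" and U: "module.subspace scale U"
    and carrier: "carrier M = \<psi> ` U"
    and add: "\<And>u v. u \<in> U \<Longrightarrow> v \<in> U \<Longrightarrow> \<psi> (u + v) = \<psi> u \<oplus>\<^bsub>M\<^esub> \<psi> v"
    and smult: "\<And>c u. u \<in> U \<Longrightarrow> \<psi> (scale c u) = c \<odot>\<^bsub>M\<^esub> \<psi> u"
    and zero: "\<psi> 0 = \<zero>\<^bsub>M\<^esub>"
    and W: "module.subspace scale W" "W \<subseteq> U"
    and U0: "module.subspace scale U0" "quotient_space.finitely_spanned scale U0" "U0 \<subseteq> U"
  shows "vectorspace.dim (class_ring :: complex ring)
      (quot_module M (\<psi> ` W)\<lparr>carrier := (\<lambda>a. \<psi> ` W +>\<^bsub>M\<^esub> a) ` \<psi> ` U0\<rparr>)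
    = quotient_space.codim scale U0 {u \<in> U0. \<psi> u \<in> \<psi> ` W}"
proof -
  interpret vs: quotient_space scale by fact
  let ?N = "\<psi> ` W"
  have module: "Module.module (class_ring :: complex ring) M"
    using vs U carrier add smult zero by (rule module_linear_image)
  then interpret M: Module.module "class_ring :: complex ring" M .
  have memN: "\<psi> u \<oplus>\<^bsub>M\<^esub> \<psi> v \<in> ?N" "c \<odot>\<^bsub>M\<^esub> \<psi> u \<in> ?N" if "u \<in> W" "v \<in> W" for u v c
    using that W(2) add[of u v] smult[of u c] vs.subspace_add[OF W(1)] vs.subspace_scale[OF W(1)]
    by (metis imageI subsetD)+
  have "subgroup ?N (add_monoid M)"
  proof (rule M.add.subgroupI)
    show "?N \<subseteq> carrier M" using W(2) carrier by auto
    show "?N \<noteq> {}" using vs.subspace_0[OF W(1)] by auto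
    fix a assume "a \<in> ?N"
    then obtain u where u: "u \<in> W" "a = \<psi> u" by auto
    show "\<ominus>\<^bsub>M\<^esub> a \<in> ?N"
    proof -
      have nu: "- u \<in> W" "- u \<in> U" "u \<in> U" using u W vs.subspace_neg by auto
      have "\<psi> (- u) \<oplus>\<^bsub>M\<^esub> \<psi> u = \<zero>\<^bsub>M\<^esub>" using add[OF nu(2,3)] zero by simp
      then have "\<ominus>\<^bsub>M\<^esub> \<psi> u = \<psi> (- u)" using nu carrier by (intro M.minus_equality) auto
      then show ?thesis using u nu by simp
    qed
    fix b assume "b \<in> ?N"
    then show "a \<oplus>\<^bsub>M\<^esub> b \<in> ?N" using u memN(1) by blast
  qed
  then have sub: "abelian_subgroup ?N M"
    by (intro abelian_subgroupI3 additive_subgroup.intro M.abelian_group_axioms)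
  then interpret N: abelian_subgroup ?N M .
  have carr: "\<psi> u \<in> carrier M" if "u \<in> U" for u using that carrier by auto
  let ?Q = "quot_module M ?N\<lparr>carrier := (\<lambda>a. ?N +>\<^bsub>M\<^esub> a) ` \<psi> ` U0\<rparr>"
  show ?thesis
  proof (rule vectorspace_dim_eq_codim[OF vs U0(2,1), of _ ?Q "\<lambda>u. ?N +>\<^bsub>M\<^esub> \<psi> u"])
    show "vs.subspace {u \<in> U0. \<psi> u \<in> ?N}"
    proof (rule vs.subspaceI)
      show "0 \<in> {u \<in> U0. \<psi> u \<in> ?N}" using vs.subspace_0[OF W(1)] vs.subspace_0[OF U0(1)] by auto
      fix x assume x: "x \<in> {u \<in> U0. \<psi> u \<in> ?N}"
      then obtain u where u: "u \<in> W" "\<psi> x = \<psi> u" "x \<in> U0" "x \<in> U" using U0(3) by auto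
      show "scale c x \<in> {u \<in> U0. \<psi> u \<in> ?N}" for c
        using u memN(2)[OF u(1,1), of c] smult[of x c] vs.subspace_scale[OF U0(1) u(3)] by simp
      fix y assume "y \<in> {u \<in> U0. \<psi> u \<in> ?N}"
      then obtain v where v: "v \<in> W" "\<psi> y = \<psi> v" "y \<in> U0" "y \<in> U" using U0(3) by auto
      show "x + y \<in> {u \<in> U0. \<psi> u \<in> ?N}"
        using u v memN(1)[OF u(1) v(1)] add[of x y] vs.subspace_add[OF U0(1) u(3) v(3)] by simp
    qed
    show "?N +>\<^bsub>M\<^esub> \<psi> (u + v) = (?N +>\<^bsub>M\<^esub> \<psi> u) \<oplus>\<^bsub>?Q\<^esub> (?N +>\<^bsub>M\<^esub> \<psi> v)" if "u \<in> U0" "v \<in> U0" for u v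
      using add[OF subsetD[OF U0(3) that(1)] subsetD[OF U0(3) that(2)]]
        N.a_rcos_sum[OF carr[OF subsetD[OF U0(3) that(1)]] carr[OF subsetD[OF U0(3) that(2)]]]
      by (simp add: quot_module_simps)
    show "?N +>\<^bsub>M\<^esub> \<psi> (scale c u) = c \<odot>\<^bsub>?Q\<^esub> (?N +>\<^bsub>M\<^esub> \<psi> u)" if "u \<in> U0" for c u
    proof -
      have "u \<in> U" using that U0(3) by blast
      moreover have "c \<odot>\<^bsub>M\<^esub> a \<in> ?N" if "a \<in> ?N" for c a using that memN(2) by auto
      ultimately show ?thesis
        using smult_coset[OF module sub _ carr, of u c] smult[of u c] by (simp add: quot_module_simps)
    qed
    show "?N +>\<^bsub>M\<^esub> \<psi> u = \<zero>\<^bsub>?Q\<^esub> \<longleftrightarrow> u \<in> {u \<in> U0. \<psi> u \<in> ?N}" if "u \<in> U0" for u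
      using that U0(3) N.a_rcos_const[of "\<psi> u"] N.a_rcos_self[OF carr, of u] by (auto simp: quot_module_simps)
  qed (auto simp: image_image)
qed

section \<open>Graded ideals and regular sequences in polynomial rings\<close>

abbreviation (input) keys :: "('a \<Rightarrow>\<^sub>0 'b::zero) \<Rightarrow> 'a set" where
  "keys \<equiv> Poly_Mapping.keys"

abbreviation (input) lookup :: "('a \<Rightarrow>\<^sub>0 'b::zero) \<Rightarrow> 'a \<Rightarrow> 'b" where
  "lookup \<equiv> Poly_Mapping.lookup"

abbreviation (input) single :: "'a \<Rightarrow> 'b \<Rightarrow> 'a \<Rightarrow>\<^sub>0 'b::zero" where
  "single \<equiv> Poly_Mapping.single"

abbreviation pscale :: "complex \<Rightarrow> mvpoly \<Rightarrow> mvpoly" where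
  "pscale c p \<equiv> single 0 c * p"

global_interpretation poly: quotient_space pscale
  by unfold_locales
    (simp_all add: distrib_left distrib_right single_add mult_single mult.assoc[symmetric])

definition pvar :: "var \<Rightarrow> mvpoly" where
  "pvar v = single (single v 1) 1"

lemma poly_eq_sum_monomials: "(p :: mvpoly) = (\<Sum>m\<in>keys p. single m (lookup p m))"
  by (rule poly_mapping_eqI)
    (auto simp: lookup_sum lookup_single when_def sum.delta in_keys_iff)

lemma keys_single_mult:
  fixes p :: mvpoly
  shows "keys (single a c * p) \<subseteq> (+) a ` keys p"
  using keys_mult[of "single a c" p] by (auto split: if_splits)

lemma keys_pscale: "keys (pscale c p) \<subseteq> keys p"
  using keys_single_mult[of 0 c p] by auto

lemma monomial_times_eq_sum:
  fixes p :: mvpoly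
  shows "single a 1 * p = (\<Sum>m\<in>keys p. single (a + m) (lookup p m))"
  by (subst poly_eq_sum_monomials[of p]) (simp add: sum_distrib_left mult_single)

lemma keys_monomial_times:
  fixes p :: mvpoly
  shows "keys (single a 1 * p) = (+) a ` keys p"
proof
  show "keys (single a 1 * p) \<subseteq> (+) a ` keys p"
    by (rule keys_single_mult)
  have "lookup (single a 1 * p) (a + m) = lookup p m" if "m \<in> keys p" for m
    using that unfolding monomial_times_eq_sum
    by (simp add: lookup_sum lookup_single when_def sum.delta)
  then show "(+) a ` keys p \<subseteq> keys (single a 1 * p)"
    by (auto simp: in_keys_iff)
qed

lemma keys_plus_nat: "keys (m + n) = keys m \<union> keys (n :: var \<Rightarrow>\<^sub>0 nat)"
  by (auto simp: in_keys_iff lookup_add)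

lemma monom_deg_eq_sum:
  assumes "finite A" and "keys m \<subseteq> A"
  shows "monom_deg m = (\<Sum>v\<in>A. lookup m v * var_deg v)"
  unfolding monom_deg_def using assms by (intro sum.mono_neutral_left) (auto simp: in_keys_iff)

lemma monom_deg_add [simp]: "monom_deg (m + n) = monom_deg m + monom_deg n"
  using monom_deg_eq_sum[of "keys m \<union> keys n" m]
    monom_deg_eq_sum[of "keys m \<union> keys n" n]
    monom_deg_eq_sum[of "keys m \<union> keys n" "m + n"]
  by (simp add: keys_plus_nat lookup_add algebra_simps sum.distrib)

lemma monom_deg_0 [simp]: "monom_deg 0 = 0"
  by (simp add: monom_deg_def)

lemma monom_deg_single [simp]: "monom_deg (single v n) = n * var_deg v"
  by (simp add: monom_deg_def)

locale graded_poly_ring =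
  fixes V :: "var set"
  assumes finite_V: "finite V" and var_deg_pos: "v \<in> V \<Longrightarrow> 0 < var_deg v"
begin

abbreviation hom :: "int \<Rightarrow> mvpoly set" where
  "hom \<equiv> mvpoly_grading V"

lemma hom_iff: "p \<in> hom d \<longleftrightarrow> (\<forall>m\<in>keys p. keys m \<subseteq> V \<and> int (monom_deg m) = d)"
  by (auto simp: mvpoly_grading_def mvpoly_ring_def)

lemma subspace_hom: "poly.subspace (hom d)"
proof (rule poly.subspaceI)
  show "0 \<in> hom d" by (simp add: hom_iff)
  show "p + q \<in> hom d" if "p \<in> hom d" "q \<in> hom d" for p q
    using that keys_add[of p q] by (auto simp: hom_iff)
  show "pscale c p \<in> hom d" if "p \<in> hom d" for c p
    using that keys_pscale[of c p] by (auto simp: hom_iff)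
qed

lemmas hom_0 [simp] = poly.subspace_0[OF subspace_hom]
  and hom_add = poly.subspace_add[OF subspace_hom]
  and hom_diff = poly.subspace_diff[OF subspace_hom]
  and hom_sum = poly.subspace_sum[OF subspace_hom]

lemma hom_mult: "p \<in> hom d \<Longrightarrow> q \<in> hom e \<Longrightarrow> p * q \<in> hom (d + e)"
  using keys_mult[of p q] by (fastforce simp: hom_iff keys_plus_nat)

lemma hom_1: "1 \<in> hom 0"
  by (simp add: hom_iff)

lemma hom_pvar: "v \<in> V \<Longrightarrow> pvar v \<in> hom (int (var_deg v))"
  by (simp add: hom_iff pvar_def)

lemma hom_negative: "p \<in> hom d \<Longrightarrow> d < 0 \<Longrightarrow> p = 0"
  unfolding hom_iff by (metis ex_in_conv keys_eq_empty of_nat_0_le_iff not_le)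

text \<open>Every variable has positive degree, so the degree of a monomial bounds all its exponents.\<close>

lemma finite_monomials: "finite {m. keys m \<subseteq> V \<and> int (monom_deg m) = d}"
proof -
  have "lookup ` {m. keys m \<subseteq> V \<and> int (monom_deg m) = d}
      \<subseteq> {f. \<forall>v. (v \<in> V \<longrightarrow> f v \<in> {0..nat d}) \<and> (v \<notin> V \<longrightarrow> f v = 0)}"
  proof clarsimp
    fix m :: "var \<Rightarrow>\<^sub>0 nat" and v assume m: "keys m \<subseteq> V"
    have "lookup m v \<le> monom_deg m" if "v \<in> V"
    proof -
      have "lookup m v * 1 \<le> lookup m v * var_deg v"
        using var_deg_pos[OF that] by (intro mult_le_mono) auto
      also have "\<dots> \<le> (\<Sum>v\<in>V. lookup m v * var_deg v)"
        using finite_V that by (intro member_le_sum) auto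
      finally show ?thesis using monom_deg_eq_sum[OF finite_V m] by simp
    qed
    moreover have "lookup m v = 0" if "v \<notin> V" using that m by (auto simp: in_keys_iff)
    ultimately show "(v \<in> V \<longrightarrow> lookup m v \<le> monom_deg m) \<and> (v \<notin> V \<longrightarrow> lookup m v = 0)" by blast
  qed
  moreover have "finite {f. \<forall>v. (v \<in> V \<longrightarrow> f v \<in> {0..nat d}) \<and> (v \<notin> V \<longrightarrow> f v = (0::nat))}"
    using finite_V by (intro finite_set_of_finite_funs) auto
  ultimately have "finite (lookup ` {m. keys m \<subseteq> V \<and> int (monom_deg m) = d})"
    by (rule finite_subset)
  then show ?thesis by (rule finite_imageD) (simp add: inj_on_def lookup_inject)
qed

lemma finitely_spanned_hom: "poly.finitely_spanned (hom d)"
  unfolding poly.finitely_spanned_def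
proof (intro exI conjI)
  let ?M = "{m. keys m \<subseteq> V \<and> int (monom_deg m) = d}"
  show "finite ((\<lambda>m. single m 1) ` ?M :: mvpoly set)" using finite_monomials by simp
  show "hom d \<subseteq> poly.span ((\<lambda>m. single m 1) ` ?M)"
  proof
    fix p assume p: "p \<in> hom d"
    have "p = (\<Sum>m\<in>keys p. pscale (lookup p m) (single m 1))"
      using poly_eq_sum_monomials[of p] by (simp add: mult_single)
    also have "\<dots> \<in> poly.span ((\<lambda>m. single m 1) ` ?M)"
      using p by (intro poly.span_sum poly.span_scale poly.span_base) (auto simp: hom_iff)
    finally show "p \<in> poly.span ((\<lambda>m. single m 1) ` ?M)" .
  qed
qed

text \<open>A homogeneous ideal, given by its homogeneous parts.  Membership is only ever asked for
  homogeneous elements, so the parts need not be assembled.\<close>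

definition graded_ideal :: "(int \<Rightarrow> mvpoly set) \<Rightarrow> bool" where
  "graded_ideal J \<longleftrightarrow> (\<forall>d. poly.subspace (J d) \<and> J d \<subseteq> hom d)
     \<and> (\<forall>d e p q. p \<in> hom e \<longrightarrow> q \<in> J d \<longrightarrow> p * q \<in> J (e + d))"

lemma
  assumes "graded_ideal J"
  shows subspace_ideal: "poly.subspace (J d)"
    and ideal_hom: "p \<in> J d \<Longrightarrow> p \<in> hom d"
    and ideal_mult: "p \<in> hom e \<Longrightarrow> q \<in> J d \<Longrightarrow> p * q \<in> J (e + d)"
  using assms unfolding graded_ideal_def by blast+

lemma ideal_mult':
  assumes "graded_ideal J" and "p \<in> hom e" and "q \<in> J d" and "e' = e + d"
  shows "p * q \<in> J e'"
  using ideal_mult assms by blast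

lemmas ideal_0 = poly.subspace_0[OF subspace_ideal]
  and ideal_add = poly.subspace_add[OF subspace_ideal]
  and ideal_diff = poly.subspace_diff[OF subspace_ideal]
  and ideal_neg = poly.subspace_neg[OF subspace_ideal]
  and ideal_sum = poly.subspace_sum[OF subspace_ideal]

text \<open>The ideal \<open>J + (f)\<close>, where \<open>f\<close> has degree \<open>e\<close>.\<close>

definition ideal_insert :: "(int \<Rightarrow> mvpoly set) \<Rightarrow> mvpoly \<Rightarrow> int \<Rightarrow> int \<Rightarrow> mvpoly set" where
  "ideal_insert J f e d = {j + f * b | j b. j \<in> J d \<and> b \<in> hom (d - e)}"

definition nonzerodivisor :: "(int \<Rightarrow> mvpoly set) \<Rightarrow> mvpoly \<Rightarrow> int \<Rightarrow> bool" where
  "nonzerodivisor J f e \<longleftrightarrow> (\<forall>d. \<forall>p\<in>hom d. f * p \<in> J (e + d) \<longrightarrow> p \<in> J d)"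

fun ideal_gen :: "(int \<Rightarrow> mvpoly set) \<Rightarrow> (mvpoly \<times> int) list \<Rightarrow> int \<Rightarrow> mvpoly set" where
  "ideal_gen J [] = J"
| "ideal_gen J ((f, e) # fs) = ideal_gen (ideal_insert J f e) fs"

text \<open>Regularity of a sequence of homogeneous elements, listed with their degrees, on \<open>S/J\<close>.\<close>

fun regular :: "(int \<Rightarrow> mvpoly set) \<Rightarrow> (mvpoly \<times> int) list \<Rightarrow> bool" where
  "regular J [] \<longleftrightarrow> True"
| "regular J ((f, e) # fs) \<longleftrightarrow> nonzerodivisor J f e \<and> regular (ideal_insert J f e) fs"

definition hom_seq :: "(mvpoly \<times> int) list \<Rightarrow> bool" where
  "hom_seq fs \<longleftrightarrow> (\<forall>(f, e)\<in>set fs. f \<in> hom e \<and> 0 < e)"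

lemma hom_seq_simps [simp]:
  "hom_seq []" "hom_seq ((f, e) # fs) \<longleftrightarrow> f \<in> hom e \<and> 0 < e \<and> hom_seq fs"
  "hom_seq (fs @ gs) \<longleftrightarrow> hom_seq fs \<and> hom_seq gs"
  by (auto simp: hom_seq_def)

lemma ideal_insertI: "j \<in> J d \<Longrightarrow> b \<in> hom (d - e) \<Longrightarrow> p = j + f * b \<Longrightarrow> p \<in> ideal_insert J f e d"
  unfolding ideal_insert_def by blast

lemma ideal_insertE:
  assumes "p \<in> ideal_insert J f e d"
  obtains j b where "j \<in> J d" "b \<in> hom (d - e)" "p = j + f * b"
  using assms unfolding ideal_insert_def by blast

lemma ideal_insert_superset: "p \<in> J d \<Longrightarrow> p \<in> ideal_insert J f e d"
  by (rule ideal_insertI[where b = 0]) auto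

lemma graded_ideal_insert:
  assumes J: "graded_ideal J" and f: "f \<in> hom e"
  shows "graded_ideal (ideal_insert J f e)"
  unfolding graded_ideal_def
proof (intro conjI allI impI poly.subspaceI subsetI)
  fix d
  show "0 \<in> ideal_insert J f e d" by (intro ideal_insert_superset ideal_0 J)
  fix p q assume p: "p \<in> ideal_insert J f e d"
  then obtain j b where p': "j \<in> J d" "b \<in> hom (d - e)" "p = j + f * b" by (rule ideal_insertE)
  then show "p \<in> hom d" using hom_add[OF ideal_hom[OF J p'(1)]] hom_mult[OF f p'(2)] by simp
  show "pscale c p \<in> ideal_insert J f e d" for c
    by (rule ideal_insertI[of "pscale c j" _ _ "pscale c b"])
      (use p' poly.subspace_scale[OF subspace_hom] poly.subspace_scale[OF subspace_ideal[OF J]]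
        in \<open>auto simp: algebra_simps\<close>)
  assume "q \<in> ideal_insert J f e d"
  then obtain j' b' where q': "j' \<in> J d" "b' \<in> hom (d - e)" "q = j' + f * b'" by (rule ideal_insertE)
  show "p + q \<in> ideal_insert J f e d"
    by (rule ideal_insertI[of "j + j'" _ _ "b + b'"])
      (use p' q' hom_add ideal_add[OF J] in \<open>auto simp: algebra_simps\<close>)
next
  fix d e' p q assume p: "p \<in> hom e'" and "q \<in> ideal_insert J f e d"
  then obtain j b where q: "j \<in> J d" "b \<in> hom (d - e)" "q = j + f * b" by (elim ideal_insertE)
  show "p * q \<in> ideal_insert J f e (e' + d)"
    by (rule ideal_insertI[of "p * j" _ _ "p * b"])
      (use q p ideal_mult[OF J p q(1)] hom_mult[OF p q(2)] in \<open>auto simp: algebra_simps\<close>)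
qed

lemma graded_ideal_gen: "graded_ideal J \<Longrightarrow> hom_seq fs \<Longrightarrow> graded_ideal (ideal_gen J fs)"
  by (induction J fs rule: ideal_gen.induct) (auto simp: graded_ideal_insert)

lemma ideal_gen_append: "ideal_gen J (fs @ gs) = ideal_gen (ideal_gen J fs) gs"
  by (induction J fs rule: ideal_gen.induct) auto

lemma regular_append: "regular J (fs @ gs) \<longleftrightarrow> regular J fs \<and> regular (ideal_gen J fs) gs"
  by (induction J fs rule: ideal_gen.induct) auto

lemma ideal_gen_superset: "p \<in> J d \<Longrightarrow> p \<in> ideal_gen J fs d"
  by (induction J fs rule: ideal_gen.induct) (auto intro: ideal_insert_superset)

lemma ideal_gen_member:
  assumes "graded_ideal J" and "hom_seq fs" and "(f, e) \<in> set fs"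
  shows "f \<in> ideal_gen J fs e"
  using assms
proof (induction J fs rule: ideal_gen.induct)
  case (2 J g e' fs)
  show ?case
  proof (cases "(f, e) = (g, e')")
    case True
    have "f \<in> ideal_insert J f e e"
      using hom_1 by (intro ideal_insertI[of 0 _ _ 1] ideal_0 2) auto
    with True show ?thesis by (auto intro: ideal_gen_superset)
  next
    case False
    then show ?thesis using 2 graded_ideal_insert by auto
  qed
qed simp

lemma ideal_insert_commute:
  "ideal_insert (ideal_insert J f e) g e' = ideal_insert (ideal_insert J g e') f e"
proof -
  have "ideal_insert (ideal_insert J f e) g e' d \<subseteq> ideal_insert (ideal_insert J g e') f e d" for f e g e' d
  proof
    fix p assume "p \<in> ideal_insert (ideal_insert J f e) g e' d"
    then obtain j b c where "j \<in> J d" "b \<in> hom (d - e)" "c \<in> hom (d - e')" "p = (j + f * b) + g * c"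
      by (elim ideal_insertE) auto
    then show "p \<in> ideal_insert (ideal_insert J g e') f e d"
      by (intro ideal_insertI[of "j + g * c" _ _ b] ideal_insertI[of j _ _ c]) (auto simp: algebra_simps)
  qed
  then show ?thesis by (intro ext subset_antisym)
qed

text \<open>That \<open>g\<close> is a nonzerodivisor modulo \<open>J\<close> is where the grading enters.  If \<open>g a \<in> J\<close>, then
  \<open>a = j + f b\<close> since \<open>g\<close> is a nonzerodivisor modulo \<open>J + (f)\<close>, and cancelling \<open>f\<close> gives
  \<open>g b \<in> J\<close> with \<open>b\<close> of smaller degree.\<close>

lemma nonzerodivisor_swap:
  assumes J: "graded_ideal J" and f: "f \<in> hom e" "0 < e" and g: "g \<in> hom e'"
    and nf: "nonzerodivisor J f e" and ng: "nonzerodivisor (ideal_insert J f e) g e'"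
  shows "nonzerodivisor J g e'" and "nonzerodivisor (ideal_insert J g e') f e"
proof -
  have "a \<in> J d" if "a \<in> hom d" "g * a \<in> J (e' + d)" for a d
    using that
  proof (induction "nat (d + 1)" arbitrary: a d rule: less_induct)
    case less
    show ?case
    proof (cases "d < 0")
      case True
      then show ?thesis using hom_negative less.prems ideal_0[OF J] by auto
    next
      case False
      have "a \<in> ideal_insert J f e d"
        using ng less.prems ideal_insert_superset unfolding nonzerodivisor_def by blast
      then obtain j b where jb: "j \<in> J d" "b \<in> hom (d - e)" "a = j + f * b" by (rule ideal_insertE)
      have "f * (g * b) = g * a - g * j" using jb(3) by (simp add: algebra_simps)
      also have "\<dots> \<in> J (e' + d)"
        using less.prems ideal_mult[OF J g jb(1)] ideal_diff[OF J] by blast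
      finally have "f * (g * b) \<in> J (e + (e' + (d - e)))" by simp
      moreover have "g * b \<in> hom (e' + (d - e))" using hom_mult[OF g jb(2)] .
      ultimately have "g * b \<in> J (e' + (d - e))" using nf unfolding nonzerodivisor_def by blast
      then have "b \<in> J (d - e)" using less.hyps[of "d - e" b] jb(2) f(2) False by simp
      then have "f * b \<in> J d" by (rule ideal_mult'[OF J f(1)]) simp
      then show ?thesis using jb ideal_add[OF J] by blast
    qed
  qed
  then show "nonzerodivisor J g e'" unfolding nonzerodivisor_def by blast
  show "nonzerodivisor (ideal_insert J g e') f e"
    unfolding nonzerodivisor_def
  proof (intro allI ballI impI)
    fix d p assume p: "p \<in> hom d" and "f * p \<in> ideal_insert J g e' (e + d)"
    then obtain j b where jb: "j \<in> J (e + d)" "b \<in> hom (e + d - e')" "f * p = j + g * b"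
      by (elim ideal_insertE)
    have "g * b = - j + f * p" using jb(3) by simp
    then have "g * b \<in> ideal_insert J f e (e' + (e + d - e'))"
      using ideal_neg[OF J jb(1)] p by (intro ideal_insertI[of "- j" _ _ p]) auto
    then have "b \<in> ideal_insert J f e (e + d - e')"
      using ng jb(2) unfolding nonzerodivisor_def by blast
    then obtain j' b' where jb': "j' \<in> J (e + d - e')" "b' \<in> hom (e + d - e' - e)" "b = j' + f * b'"
      by (rule ideal_insertE)
    have "f * (p - g * b') = j + g * j'" using jb(3) jb'(3) by (simp add: algebra_simps)
    also have "\<dots> \<in> J (e + d)"
      by (intro ideal_add[OF J] ideal_mult'[OF J g jb'(1)] jb(1)) simp
    finally have fp: "f * (p - g * b') \<in> J (e + d)" .
    have "g * b' \<in> hom d" using hom_mult[OF g jb'(2)] by simp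
    then have "p - g * b' \<in> J d" using nf fp p hom_diff unfolding nonzerodivisor_def by blast
    then show "p \<in> ideal_insert J g e' d"
      using jb'(2) by (intro ideal_insertI[of "p - g * b'" _ _ b']) auto
  qed
qed

lemma regular_move:
  assumes "graded_ideal J" and "hom_seq (fe # gs @ hs)" and "regular J (fe # gs @ hs)"
  shows "regular J (gs @ fe # hs)"
  using assms
proof (induction gs arbitrary: J)
  case (Cons ge gs)
  obtain f e g e' where fe: "fe = (f, e)" and ge: "ge = (g, e')" by (cases fe, cases ge)
  have h: "f \<in> hom e" "0 < e" "g \<in> hom e'" "hom_seq (gs @ hs)" using Cons.prems fe ge by auto
  have r: "nonzerodivisor J f e" "nonzerodivisor (ideal_insert J f e) g e'"
    "regular (ideal_insert (ideal_insert J f e) g e') (gs @ hs)" using Cons.prems fe ge by auto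
  have "regular (ideal_insert J g e') (gs @ fe # hs)"
    using nonzerodivisor_swap(2)[OF Cons.prems(1) h(1,2,3) r(1,2)] r(3) h Cons.prems(1)
    by (intro Cons.IH graded_ideal_insert) (auto simp: fe ideal_insert_commute)
  then show ?case
    using nonzerodivisor_swap(1)[OF Cons.prems(1) h(1,2,3) r(1,2)] by (simp add: ge)
qed simp

lemma regular_rotate:
  assumes "graded_ideal J" and "hom_seq (fs @ gs)" and "regular J (fs @ gs)"
  shows "regular J (gs @ fs)"
  using assms
proof (induction fs arbitrary: J gs)
  case (Cons fe fs)
  obtain f e where fe: "fe = (f, e)" by (cases fe)
  have "regular (ideal_insert J f e) (gs @ fs)"
    using Cons.prems fe by (intro Cons.IH graded_ideal_insert) auto
  then have "regular J (fe # gs @ fs)" using Cons.prems fe by simp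
  then show ?case using Cons.prems fe by (intro regular_move) auto
qed simp

lemma ideal_insert_cong:
  assumes J: "graded_ideal J" and "f - g \<in> J e"
  shows "ideal_insert J f e = ideal_insert J g e"
proof -
  have "ideal_insert J f e d \<subseteq> ideal_insert J g e d" if "f - g \<in> J e" for f g d
  proof
    fix p assume "p \<in> ideal_insert J f e d"
    then obtain j b where jb: "j \<in> J d" "b \<in> hom (d - e)" "p = j + f * b" by (rule ideal_insertE)
    have "b * (f - g) \<in> J d" using ideal_mult'[OF J jb(2) that] by simp
    then have "j + b * (f - g) \<in> J d" using jb ideal_add[OF J] by blast
    then show "p \<in> ideal_insert J g e d"
      using jb by (intro ideal_insertI[of _ _ _ b]) (auto simp: algebra_simps)
  qed
  moreover have "g - f \<in> J e" using ideal_neg[OF J assms(2)] by simp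
  ultimately show ?thesis using assms(2) by (intro ext subset_antisym) auto
qed

lemma nonzerodivisor_cong:
  assumes J: "graded_ideal J" and "f - g \<in> J e" and "nonzerodivisor J g e"
  shows "nonzerodivisor J f e"
  unfolding nonzerodivisor_def
proof (intro allI ballI impI)
  fix d p assume p: "p \<in> hom d" "f * p \<in> J (e + d)"
  have "p * (f - g) \<in> J (e + d)" by (rule ideal_mult'[OF J p(1) assms(2)]) simp
  then have "f * p - p * (f - g) \<in> J (e + d)" using p ideal_diff[OF J] by blast
  then have "g * p \<in> J (e + d)" by (simp add: algebra_simps)
  then show "p \<in> J d" using assms(3) p unfolding nonzerodivisor_def by blast
qed

lemma nonzerodivisor_mult:
  assumes "nonzerodivisor J f e" and "nonzerodivisor J g e'" and g: "g \<in> hom e'"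
  shows "nonzerodivisor J (f * g) (e + e')"
  unfolding nonzerodivisor_def
proof (intro allI ballI impI)
  fix d p assume p: "p \<in> hom d" "f * g * p \<in> J (e + e' + d)"
  then have "f * (g * p) \<in> J (e + (e' + d))" by (simp add: algebra_simps)
  then have "g * p \<in> J (e' + d)"
    using assms(1) hom_mult[OF g p(1)] unfolding nonzerodivisor_def by blast
  then show "p \<in> J d" using assms(2) p unfolding nonzerodivisor_def by blast
qed

text \<open>The ideal generated by the variables in \<open>W\<close>: every monomial contains one of them.\<close>

definition var_ideal :: "var set \<Rightarrow> int \<Rightarrow> mvpoly set" where
  "var_ideal W d = {p \<in> hom d. \<forall>m\<in>keys p. keys m \<inter> W \<noteq> {}}"

lemma graded_ideal_var_ideal: "graded_ideal (var_ideal W)"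
  unfolding graded_ideal_def
proof (intro conjI allI impI poly.subspaceI subsetI)
  show "0 \<in> var_ideal W d" "p \<in> var_ideal W d \<Longrightarrow> p \<in> hom d" for p d
    by (auto simp: var_ideal_def)
  show "p + q \<in> var_ideal W d" if "p \<in> var_ideal W d" "q \<in> var_ideal W d" for p q d
    using that keys_add[of p q] hom_add by (auto simp: var_ideal_def)
  show "pscale c p \<in> var_ideal W d" if "p \<in> var_ideal W d" for c p d
    using that keys_pscale[of c p] poly.subspace_scale[OF subspace_hom]
    by (auto simp: var_ideal_def)
  show "p * q \<in> var_ideal W (e + d)" if "p \<in> hom e" "q \<in> var_ideal W d" for p q d e
    using that keys_mult[of p q] hom_mult[of p e q d] by (fastforce simp: var_ideal_def keys_plus_nat)
qed

lemma var_ideal_empty: "var_ideal {} d = {0}"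
  by (auto simp: var_ideal_def)

lemma pvar_in_var_ideal: "v \<in> W \<Longrightarrow> v \<in> V \<Longrightarrow> pvar v \<in> var_ideal W (int (var_deg v))"
  using hom_pvar[of v] by (auto simp: var_ideal_def pvar_def)

text \<open>In an element of the larger ideal, the monomials without a variable in \<open>W\<close> contain \<open>v\<close>, which
  is split off.\<close>

lemma ideal_insert_var_ideal:
  assumes v: "v \<in> V"
  shows "ideal_insert (var_ideal W) (pvar v) (int (var_deg v)) = var_ideal (insert v W)"
proof (intro ext subset_antisym subsetI)
  fix d p assume "p \<in> ideal_insert (var_ideal W) (pvar v) (int (var_deg v)) d"
  then obtain j b where jb: "j \<in> var_ideal W d" "b \<in> hom (d - int (var_deg v))" "p = j + pvar v * b"
    by (rule ideal_insertE)
  have "j \<in> var_ideal (insert v W) d" using jb(1) by (auto simp: var_ideal_def)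
  moreover have "b * pvar v \<in> var_ideal (insert v W) d"
    by (rule ideal_mult'[OF graded_ideal_var_ideal jb(2) pvar_in_var_ideal]) (use v in auto)
  ultimately show "p \<in> var_ideal (insert v W) d"
    using jb(3) ideal_add[OF graded_ideal_var_ideal] by (simp add: mult.commute)
next
  fix d p assume p: "p \<in> var_ideal (insert v W) d"
  let ?e = "single v (1::nat)"
  define K where "K = {m \<in> keys p. keys m \<inter> W \<noteq> {}}"
  define j where "j = (\<Sum>m\<in>K. single m (lookup p m))"
  define b where "b = (\<Sum>m\<in>keys p - K. single (m - ?e) (lookup p m))"
  have K: "finite K" "K \<subseteq> keys p" unfolding K_def by auto
  have ph: "p \<in> hom d" using p by (simp add: var_ideal_def)
  have e: "?e + (m - ?e) = m" if "m \<in> keys p - K" for m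
  proof -
    have "v \<in> keys m" using that p by (auto simp: K_def var_ideal_def)
    then show ?thesis
      by (intro poly_mapping_eqI) (auto simp: lookup_add lookup_minus lookup_single when_def in_keys_iff)
  qed
  have "pvar v * b = (\<Sum>m\<in>keys p - K. single m (lookup p m))"
    using e by (simp add: b_def pvar_def sum_distrib_left mult_single)
  then have "p = j + pvar v * b"
    using poly_eq_sum_monomials[of p] sum.subset_diff[OF K(2), of "\<lambda>m. single m (lookup p m)"]
    by (simp add: j_def add.commute)
  moreover have "j \<in> var_ideal W d"
    unfolding j_def
  proof (rule ideal_sum[OF graded_ideal_var_ideal])
    fix m assume "m \<in> K"
    then show "single m (lookup p m) \<in> var_ideal W d"
      using ph by (auto simp: var_ideal_def hom_iff K_def)
  qed
  moreover have "b \<in> hom (d - int (var_deg v))"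
    unfolding b_def
  proof (rule hom_sum)
    fix m assume m: "m \<in> keys p - K"
    have "keys (?e + (m - ?e)) \<subseteq> V" "int (monom_deg (?e + (m - ?e))) = d"
      unfolding e[OF m] using m ph by (auto simp: hom_iff)
    then show "single (m - ?e) (lookup p m) \<in> hom (d - int (var_deg v))"
      by (auto simp: hom_iff keys_plus_nat)
  qed
  ultimately show "p \<in> ideal_insert (var_ideal W) (pvar v) (int (var_deg v)) d"
    by (intro ideal_insertI)
qed

lemma nonzerodivisor_pvar:
  assumes "v \<notin> W"
  shows "nonzerodivisor (var_ideal W) (pvar v) e"
  unfolding nonzerodivisor_def
proof (intro allI ballI impI)
  fix d p assume p: "p \<in> hom d" and "pvar v * p \<in> var_ideal W (e + d)"
  then have "keys (single v 1 + m) \<inter> W \<noteq> {}" if "m \<in> keys p" for m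
    using that by (auto simp: var_ideal_def keys_monomial_times pvar_def)
  then show "p \<in> var_ideal W d"
    using assms p by (fastforce simp: var_ideal_def keys_plus_nat)
qed

definition var_list :: "var list \<Rightarrow> (mvpoly \<times> int) list" where
  "var_list vs = map (\<lambda>v. (pvar v, int (var_deg v))) vs"

lemma var_list_simps [simp]:
  "var_list [] = []" "var_list (v # vs) = (pvar v, int (var_deg v)) # var_list vs"
  by (simp_all add: var_list_def)

lemma ideal_gen_var_list:
  "set vs \<subseteq> V \<Longrightarrow> ideal_gen (var_ideal W) (var_list vs) = var_ideal (W \<union> set vs)"
  by (induction vs arbitrary: W) (auto simp: ideal_insert_var_ideal)

lemma regular_var_list:
  "set vs \<subseteq> V \<Longrightarrow> distinct vs \<Longrightarrow> set vs \<inter> W = {} \<Longrightarrow> regular (var_ideal W) (var_list vs)"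
  by (induction vs arbitrary: W) (auto simp: ideal_insert_var_ideal nonzerodivisor_pvar)

lemma hom_seq_var_list: "set vs \<subseteq> V \<Longrightarrow> hom_seq (var_list vs)"
  by (induction vs) (auto simp: hom_pvar var_deg_pos)

end

section \<open>Regularity of the relations\<close>

context graded_poly_ring
begin

lemma regular_map_cong:
  assumes "graded_ideal J" and "\<And>i. i \<in> set is \<Longrightarrow> f i - g i \<in> J (e i)"
    and "hom_seq (map (\<lambda>i. (g i, e i)) is)"
    and "regular J (map (\<lambda>i. (g i, e i)) is)"
  shows "regular J (map (\<lambda>i. (f i, e i)) is)"
    and "ideal_gen J (map (\<lambda>i. (f i, e i)) is) = ideal_gen J (map (\<lambda>i. (g i, e i)) is)"
proof -
  have "regular J (map (\<lambda>i. (f i, e i)) is) \<and>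
    ideal_gen J (map (\<lambda>i. (f i, e i)) is) = ideal_gen J (map (\<lambda>i. (g i, e i)) is)"
    using assms
  proof (induction "is" arbitrary: J)
    case (Cons i "is")
    have eq: "ideal_insert J (f i) (e i) = ideal_insert J (g i) (e i)"
      using Cons.prems by (intro ideal_insert_cong) auto
    have "nonzerodivisor J (f i) (e i)"
      using Cons.prems by (intro nonzerodivisor_cong[of J "f i" "g i"]) auto
    moreover have "regular (ideal_insert J (g i) (e i)) (map (\<lambda>i. (f i, e i)) is) \<and>
      ideal_gen (ideal_insert J (g i) (e i)) (map (\<lambda>i. (f i, e i)) is)
       = ideal_gen (ideal_insert J (g i) (e i)) (map (\<lambda>i. (g i, e i)) is)"
      using Cons.prems by (intro Cons.IH graded_ideal_insert) (auto intro: ideal_insert_superset)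
    ultimately show ?case by (simp add: eq)
  qed simp
  then show "regular J (map (\<lambda>i. (f i, e i)) is)"
    and "ideal_gen J (map (\<lambda>i. (f i, e i)) is) = ideal_gen J (map (\<lambda>i. (g i, e i)) is)"
    by auto
qed

text \<open>The exact sequence \<open>0 \<rightarrow> S/J \<rightarrow> S/J \<rightarrow> S/(J + (f)) \<rightarrow> 0\<close> given by multiplication by \<open>f\<close>.\<close>

lemma codim_ideal_insert:
  assumes J: "graded_ideal J" and f: "f \<in> hom e" and nzd: "nonzerodivisor J f e"
  shows "poly.codim (hom d) (J d)
    = poly.codim (hom d) (ideal_insert J f e d) + poly.codim (hom (d - e)) (J (d - e))"
proof -
  interpret pp: quotient_space_pair pscale pscale by unfold_locales
  note K = graded_ideal_insert[OF J f]
  have sub: "J d \<subseteq> ideal_insert J f e d" "ideal_insert J f e d \<subseteq> hom d" for d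
    using ideal_insert_superset ideal_hom[OF K] by auto
  have "poly.codim (ideal_insert J f e d) (J d) = poly.codim (hom (d - e)) (J (d - e))"
  proof (rule pp.codim_eqI[of "(*) f"])
    show "Vector_Spaces.linear pscale pscale ((*) f)"
      by unfold_locales (auto simp: algebra_simps)
    show "f * v \<in> ideal_insert J f e d" if "v \<in> hom (d - e)" for v
      using that ideal_0[OF J] by (intro ideal_insertI[of 0 _ _ v]) auto
    show "\<exists>v\<in>hom (d - e). u - f * v \<in> J d" if "u \<in> ideal_insert J f e d" for u
      using that by (elim ideal_insertE) (auto intro: rev_bexI)
    show "f * v \<in> J d \<longleftrightarrow> v \<in> J (d - e)" if "v \<in> hom (d - e)" for v
      using nzd that ideal_mult'[OF J f, of v "d - e" d] unfolding nonzerodivisor_def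
      by (metis add.commute diff_add_cancel)
    show "poly.finitely_spanned (ideal_insert J f e d)"
      by (rule poly.finitely_spanned_subset[OF finitely_spanned_hom sub(2)])
  qed (use J K subspace_ideal subspace_hom ideal_hom finitely_spanned_hom sub in auto)
  then show ?thesis
    using poly.codim_trans[OF finitely_spanned_hom sub, of d] by simp
qed

text \<open>The graded dimension after dividing by a regular sequence depends only on the degrees.\<close>

lemma codim_ideal_gen_cong:
  assumes "graded_ideal J" "graded_ideal J'" "hom_seq fs" "hom_seq gs"
    and "regular J fs" "regular J' gs" and "map snd fs = map snd gs"
    and "\<And>d. poly.codim (hom d) (J d) = poly.codim (hom d) (J' d)"
  shows "poly.codim (hom d) (ideal_gen J fs d) = poly.codim (hom d) (ideal_gen J' gs d)"
  using assms
proof (induction fs arbitrary: gs J J')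
  case (Cons fe fs)
  then obtain f e g gs' where fe: "fe = (f, e)" "gs = (g, e) # gs'" by (cases fe) auto
  have "poly.codim (hom d) (ideal_insert J f e d) = poly.codim (hom d) (ideal_insert J' g e d)" for d
    using codim_ideal_insert[of J f e d] codim_ideal_insert[of J' g e d] Cons.prems fe by simp
  then have "poly.codim (hom d) (ideal_gen (ideal_insert J f e) fs d)
      = poly.codim (hom d) (ideal_gen (ideal_insert J' g e) gs' d)"
    using Cons.prems fe by (intro Cons.IH graded_ideal_insert) auto
  then show ?case using fe by simp
qed auto

end

locale relation_ring =
  fixes k l :: nat
begin

sublocale graded_poly_ring "P_vars k l"
  by unfold_locales (auto simp: P_vars_def)

abbreviation "x \<equiv> var_seq VX k"
abbreviation "y \<equiv> var_seq VY l"
abbreviation "x' \<equiv> var_seq VX' k"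
abbreviation "y' \<equiv> var_seq VY' l"
abbreviation "r \<equiv> P_rel k l"

definition u :: "nat \<Rightarrow> mvpoly" where "u i = y i - y' i"

lemma var_seq_eq_pvar: "1 \<le> i \<Longrightarrow> i \<le> n \<Longrightarrow> var_seq v n i = pvar (v i)"
  by (simp add: var_seq_def pvar_def)

lemma var_seq_0 [simp]: "var_seq v n 0 = 1"
  by (simp add: var_seq_def)

lemma var_seq_hom:
  assumes "\<And>i. 1 \<le> i \<Longrightarrow> i \<le> n \<Longrightarrow> v i \<in> P_vars k l \<and> var_deg (v i) = 2 * i"
  shows "var_seq v n i \<in> hom (2 * int i)"
proof (cases "i = 0 \<or> i > n")
  case True
  then show ?thesis using hom_1 by (auto simp: var_seq_def)
next
  case False
  then show ?thesis using assms[of i] hom_pvar[of "v i"] by (simp add: var_seq_eq_pvar)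
qed

lemma x_hom: "x i \<in> hom (2 * int i)" and y_hom: "y i \<in> hom (2 * int i)"
  and x'_hom: "x' i \<in> hom (2 * int i)" and y'_hom: "y' i \<in> hom (2 * int i)"
  by (rule var_seq_hom; simp add: P_vars_def)+

lemma hom_mult_conv: "p \<in> hom (2 * int j) \<Longrightarrow> q \<in> hom (2 * int (i - j)) \<Longrightarrow> j \<le> i \<Longrightarrow> p * q \<in> hom (2 * int i)"
  using hom_mult[of p "2 * int j" q "2 * int (i - j)"] by (simp add: of_nat_diff algebra_simps)

lemma u_hom: "u i \<in> hom (2 * int i)"
  unfolding u_def by (intro hom_diff y_hom y'_hom)

lemma r_hom: "r i \<in> hom (2 * int i)"
  unfolding P_rel_def
  by (intro hom_diff hom_sum hom_mult_conv[OF x_hom y_hom] hom_mult_conv[OF x'_hom y'_hom]) auto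

definition rels :: "nat \<Rightarrow> nat \<Rightarrow> (mvpoly \<times> int) list" where
  "rels a b = map (\<lambda>i. (r i, 2 * int i)) [a..<b]"

definition us :: "nat \<Rightarrow> nat \<Rightarrow> (mvpoly \<times> int) list" where
  "us a b = map (\<lambda>i. (u i, 2 * int i)) [a..<b]"

lemma hom_seq_rels: "hom_seq (rels (Suc a) b)" and hom_seq_us: "hom_seq (us (Suc a) b)"
  using r_hom u_hom by (auto simp: hom_seq_def rels_def us_def)

lemma rels_snoc: "a \<le> b \<Longrightarrow> rels a (Suc b) = rels a b @ [(r b, 2 * int b)]"
  and us_snoc: "a \<le> b \<Longrightarrow> us a (Suc b) = us a b @ [(u b, 2 * int b)]"
  by (simp_all add: rels_def us_def)

text \<open>Dividing by these variables leaves \<open>x\<^sub>1, \<dots>, x\<^sub>a\<close> and \<open>y\<^sub>1, \<dots>, y\<^sub>b\<close>.  The relation \<open>r\<^sub>i\<close> becomes the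
  part of degree \<open>2i\<close> of the product of \<open>1 + x\<^sub>1 + \<dots> + x\<^sub>a\<close> and \<open>1 + y\<^sub>1 + \<dots> + y\<^sub>b\<close>.\<close>

definition killed :: "nat \<Rightarrow> nat \<Rightarrow> var set" where
  "killed a b = VX ` {a<..k} \<union> VY ` {b<..l} \<union> VX' ` {1..k} \<union> VY' ` {1..l}"

lemma insert_killed:
  shows "Suc a \<le> k \<Longrightarrow> insert (VX (Suc a)) (killed (Suc a) b) = killed a b"
    and "Suc b \<le> l \<Longrightarrow> insert (VY (Suc b)) (killed a (Suc b)) = killed a b"
proof -
  have *: "Suc c \<le> n \<Longrightarrow> {c<..n} = insert (Suc c) {Suc c<..n}" for c n by auto
  show "Suc a \<le> k \<Longrightarrow> insert (VX (Suc a)) (killed (Suc a) b) = killed a b"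
    by (auto simp: killed_def *)
  show "Suc b \<le> l \<Longrightarrow> insert (VY (Suc b)) (killed a (Suc b)) = killed a b"
    by (auto simp: killed_def *)
qed

lemma var_seq_in_var_ideal:
  assumes "0 < i" and "i \<le> n \<Longrightarrow> v i \<in> W \<and> v i \<in> P_vars k l \<and> var_deg (v i) = 2 * i"
  shows "var_seq v n i \<in> var_ideal W (2 * int i)"
proof (cases "i > n")
  case True
  then show ?thesis using assms(1) ideal_0[OF graded_ideal_var_ideal] by (simp add: var_seq_def)
next
  case False
  then show ?thesis using assms pvar_in_var_ideal[of "v i" W] by (simp add: var_seq_eq_pvar)
qed

lemma
  shows x_killed: "a < i \<Longrightarrow> x i \<in> var_ideal (killed a b) (2 * int i)"
    and y_killed: "b < i \<Longrightarrow> y i \<in> var_ideal (killed a b) (2 * int i)"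
    and x'_killed: "0 < i \<Longrightarrow> x' i \<in> var_ideal (killed a b) (2 * int i)"
    and y'_killed: "0 < i \<Longrightarrow> y' i \<in> var_ideal (killed a b) (2 * int i)"
  by (rule var_seq_in_var_ideal; auto simp: P_vars_def killed_def)+

lemma ideal_mult_conv1:
  assumes "graded_ideal J" and "p \<in> J (2 * int j)" "q \<in> hom (2 * int (i - j))" "j \<le> i"
  shows "p * q \<in> J (2 * int i)"
  using ideal_mult'[OF assms(1,3,2), of "2 * int i"] assms(4) by (simp add: of_nat_diff algebra_simps)

lemma ideal_mult_conv2:
  assumes "graded_ideal J" and "p \<in> hom (2 * int j)" "q \<in> J (2 * int (i - j))" "j \<le> i"
  shows "p * q \<in> J (2 * int i)"
  using ideal_mult'[OF assms(1,2,3), of "2 * int i"] assms(4) by (simp add: of_nat_diff algebra_simps)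

text \<open>If at most the summand with index \<open>c\<close> survives, it represents \<open>r\<^sub>i\<close>.\<close>

lemma r_mod_killed:
  assumes "0 < i" and "c \<le> i" and "\<And>j. j \<le> i \<Longrightarrow> j \<noteq> c \<Longrightarrow> a < j \<or> b < i - j"
  shows "r i - x c * y (i - c) \<in> var_ideal (killed a b) (2 * int i)"
proof -
  note J = graded_ideal_var_ideal
  have "(\<Sum>j=0..i. x j * y (i - j)) = x c * y (i - c) + (\<Sum>j\<in>{0..i} - {c}. x j * y (i - j))"
    using assms(2) by (intro sum.remove) auto
  then have "r i - x c * y (i - c) = (\<Sum>j\<in>{0..i} - {c}. x j * y (i - j)) - (\<Sum>j=0..i. x' j * y' (i - j))"
    by (simp add: P_rel_def)
  also have "\<dots> \<in> var_ideal (killed a b) (2 * int i)"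
  proof (intro ideal_diff[OF J] ideal_sum[OF J])
    fix j assume j: "j \<in> {0..i} - {c}"
    then consider "a < j" | "b < i - j" using assms(3)[of j] by auto
    then show "x j * y (i - j) \<in> var_ideal (killed a b) (2 * int i)"
      by cases (use j in \<open>auto intro: ideal_mult_conv1[OF J x_killed y_hom] ideal_mult_conv2[OF J x_hom y_killed]\<close>)
  next
    fix j assume j: "j \<in> {0..i}"
    then consider "0 < j" | "0 < i - j" using assms(1) by fastforce
    then show "x' j * y' (i - j) \<in> var_ideal (killed a b) (2 * int i)"
      by cases (use j in \<open>auto intro: ideal_mult_conv1[OF J x'_killed y'_hom] ideal_mult_conv2[OF J x'_hom y'_killed]\<close>)
  qed
  finally show ?thesis .
qed

lemma regular_pvars:
  assumes "\<And>i. i \<in> {1..n} \<Longrightarrow> f i - pvar (v i) \<in> var_ideal W (2 * int i) \<and> v i \<in> P_vars k l \<and> v i \<notin> W \<and> var_deg (v i) = 2 * i"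
    and "inj v"
  shows "regular (var_ideal W) (map (\<lambda>i. (f i, 2 * int i)) [1..<Suc n])"
    and "ideal_gen (var_ideal W) (map (\<lambda>i. (f i, 2 * int i)) [1..<Suc n]) = var_ideal (W \<union> v ` {1..n})"
proof -
  let ?vs = "map v [1..<Suc n]"
  have eq: "var_list ?vs = map (\<lambda>i. (pvar (v i), 2 * int i)) [1..<Suc n]"
    using assms(1) by (auto simp: var_list_def simp del: upt_Suc)
  have vs: "set ?vs \<subseteq> P_vars k l" "distinct ?vs" "set ?vs \<inter> W = {}" "set ?vs = v ` {1..n}"
    using assms(1) inj_on_subset[OF assms(2)]
    by (auto simp: distinct_map atLeastLessThanSuc_atLeastAtMost simp del: upt_Suc)
  have reg: "regular (var_ideal W) (map (\<lambda>i. (pvar (v i), 2 * int i)) [1..<Suc n])"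
    using regular_var_list[OF vs(1-3)] unfolding eq .
  have hs: "hom_seq (map (\<lambda>i. (pvar (v i), 2 * int i)) [1..<Suc n])"
    using hom_seq_var_list[OF vs(1)] unfolding eq .
  have d: "f i - pvar (v i) \<in> var_ideal W (2 * int i)" if "i \<in> set [1..<Suc n]" for i
    using that assms(1)[of i] by (simp del: upt_Suc)
  note cong = regular_map_cong[OF graded_ideal_var_ideal d hs reg]
  show "regular (var_ideal W) (map (\<lambda>i. (f i, 2 * int i)) [1..<Suc n])" by (rule cong(1))
  show "ideal_gen (var_ideal W) (map (\<lambda>i. (f i, 2 * int i)) [1..<Suc n]) = var_ideal (W \<union> v ` {1..n})"
    using cong(2) ideal_gen_var_list[OF vs(1), of W] unfolding eq vs(4) by (rule trans)
qed

text \<open>Induction on \<open>a + b\<close>.  If \<open>a\<close> or \<open>b\<close> is \<open>0\<close>, the relations are variables.  Otherwise the last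
  one is \<open>x\<^sub>a y\<^sub>b\<close>, and it suffices that the sequence is regular with \<open>x\<^sub>a\<close> or with \<open>y\<^sub>b\<close> in its place.
  Moving that variable to the front gives the statement for \<open>a - 1\<close> or for \<open>b - 1\<close>.\<close>

lemma regular_rels_killed:
  assumes "a \<le> k" and "b \<le> l"
  shows "regular (var_ideal (killed a b)) (rels 1 (Suc (a + b)))"
  using assms
proof (induction "a + b" arbitrary: a b)
  case 0
  then show ?case by (simp add: rels_def)
next
  case (Suc n)
  show ?case
  proof (cases "a = 0 \<or> b = 0")
    case True
    then show ?thesis
    proof
      assume a: "a = 0"
      have d: "r i - pvar (VY i) \<in> var_ideal (killed a b) (2 * int i)" if "1 \<le> i" "i \<le> b" for i
        using r_mod_killed[of i 0 a b] that Suc.prems a by (simp add: var_seq_eq_pvar)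
      show ?thesis
        unfolding rels_def using a d Suc.prems
        by (intro regular_pvars(1)[of "a + b" r VY]) (auto simp: P_vars_def killed_def inj_def)
    next
      assume b: "b = 0"
      have d: "r i - pvar (VX i) \<in> var_ideal (killed a b) (2 * int i)" if "1 \<le> i" "i \<le> a" for i
        using r_mod_killed[of i i a b] that Suc.prems b by (simp add: var_seq_eq_pvar)
      show ?thesis
        unfolding rels_def using b d Suc.prems
        by (intro regular_pvars(1)[of "a + b" r VX]) (auto simp: P_vars_def killed_def inj_def)
    qed
  next
    case False
    let ?J = "var_ideal (killed a b)"
    note J = graded_ideal_var_ideal
    \<comment> \<open>The case of a single variable \<open>v\<close> in last place; it is moved to the front.\<close>
    have rel: "regular ?J (rels 1 (Suc n) @ [(pvar v, int (var_deg v))])"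
      if "v \<in> P_vars k l" "v \<notin> killed a b" "insert v (killed a b) = killed a' b'"
        "a' + b' = n" "a' \<le> k" "b' \<le> l" for v a' b'
    proof -
      have "regular (var_ideal (killed a' b')) (rels 1 (Suc n))"
        using Suc.hyps(1)[of a' b'] that by simp
      then have reg: "regular ?J ([(pvar v, int (var_deg v))] @ rels 1 (Suc n))"
        using that nonzerodivisor_pvar ideal_insert_var_ideal by simp
      have "hom_seq ([(pvar v, int (var_deg v))] @ rels 1 (Suc n))"
        using that hom_seq_rels[of 0 "Suc n"] hom_pvar[of v] var_deg_pos[of v] by auto
      from regular_rotate[OF J this reg] show ?thesis .
    qed
    have 1: "regular ?J (rels 1 (Suc n) @ [(pvar (VX a), int (var_deg (VX a)))])"
    proof (rule rel)
      show "insert (VX a) (killed a b) = killed (a - 1) b"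
        using insert_killed(1)[of "a - 1" b] False Suc.prems by simp
    qed (use False Suc.prems Suc.hyps(2) in \<open>auto simp: P_vars_def killed_def\<close>)
    have 2: "regular ?J (rels 1 (Suc n) @ [(pvar (VY b), int (var_deg (VY b)))])"
    proof (rule rel)
      show "insert (VY b) (killed a b) = killed a (b - 1)"
        using insert_killed(2)[of "b - 1" a] False Suc.prems by simp
    qed (use False Suc.prems Suc.hyps(2) in \<open>auto simp: P_vars_def killed_def\<close>)
    let ?K = "ideal_gen ?J (rels 1 (Suc n))"
    have K: "graded_ideal ?K" using hom_seq_rels[of 0 "Suc n"] by (intro graded_ideal_gen J) simp
    have v: "VX a \<in> P_vars k l" "VY b \<in> P_vars k l"
      using False Suc.prems by (auto simp: P_vars_def)
    have "nonzerodivisor ?K (pvar (VX a)) (int (var_deg (VX a)))"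
      "nonzerodivisor ?K (pvar (VY b)) (int (var_deg (VY b)))"
      using 1 2 by (simp_all add: regular_append)
    then have "nonzerodivisor ?K (pvar (VX a) * pvar (VY b)) (int (var_deg (VX a)) + int (var_deg (VY b)))"
      using hom_pvar[OF v(2)] by (rule nonzerodivisor_mult)
    moreover have "r (a + b) - pvar (VX a) * pvar (VY b) \<in> ?J (2 * int (a + b))"
    proof -
      have "a < j \<or> b < a + b - j" if "j \<le> a + b" "j \<noteq> a" for j using that by linarith
      then show ?thesis
        using r_mod_killed[of "a + b" a a b] False Suc.prems by (simp add: var_seq_eq_pvar)
    qed
    then have "r (a + b) - pvar (VX a) * pvar (VY b) \<in> ?K (2 * int (a + b))"
      by (rule ideal_gen_superset)
    ultimately have "nonzerodivisor ?K (r (a + b)) (2 * int (a + b))"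
      using nonzerodivisor_cong[OF K, of "r (a + b)" "pvar (VX a) * pvar (VY b)"] by simp
    then have "regular ?J (rels 1 (Suc n) @ [(r (a + b), 2 * int (a + b))])"
      using 1 by (simp add: regular_append)
    moreover have "rels 1 (Suc (a + b)) = rels 1 (Suc n) @ [(r (a + b), 2 * int (a + b))]"
      using rels_snoc[of 1 "a + b"] False by (simp only: Suc.hyps(2)) linarith
    ultimately show ?thesis by (simp only:)
  qed
qed

definition primed_vars :: "(mvpoly \<times> int) list" where
  "primed_vars = var_list (map VX' [1..<Suc k] @ map VY' [1..<Suc l])"

lemma set_primed_vars:
  "set (map VX' [1..<Suc k] @ map VY' [1..<Suc l]) = killed k l"
  by (simp add: killed_def atLeastLessThanSuc_atLeastAtMost del: upt_Suc)

lemma killed_subset: "killed a b \<subseteq> P_vars k l"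
  by (auto simp: killed_def P_vars_def)

lemma hom_seq_primed_vars: "hom_seq primed_vars"
  unfolding primed_vars_def using killed_subset set_primed_vars by (intro hom_seq_var_list) simp

lemma ideal_gen_primed_vars: "ideal_gen (var_ideal {}) primed_vars = var_ideal (killed k l)"
  unfolding primed_vars_def using killed_subset set_primed_vars ideal_gen_var_list by simp

lemma regular_primed_vars: "regular (var_ideal {}) primed_vars"
  unfolding primed_vars_def
proof (rule regular_var_list)
  show "distinct (map VX' [1..<Suc k] @ map VY' [1..<Suc l])"
    by (auto simp: distinct_map inj_on_def simp del: upt_Suc)
qed (use killed_subset set_primed_vars in simp_all)

text \<open>The primed variables in front form a regular sequence with \<open>fs\<close>.  Move them to the end and drop
  them.\<close>

lemma regular_if_regular_mod_primed:
  assumes "hom_seq fs" and "regular (var_ideal (killed k l)) fs"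
  shows "regular (var_ideal {}) fs"
proof -
  have "regular (var_ideal {}) (primed_vars @ fs)"
    using assms regular_primed_vars ideal_gen_primed_vars by (simp add: regular_append)
  moreover have "hom_seq (primed_vars @ fs)"
    using assms hom_seq_primed_vars by simp
  ultimately have "regular (var_ideal {}) (fs @ primed_vars)"
    using regular_rotate[OF graded_ideal_var_ideal] by blast
  then show ?thesis by (simp add: regular_append)
qed

lemma regular_rels: "regular (var_ideal {}) (rels 1 (Suc (k + l)))"
  using regular_if_regular_mod_primed[OF _ regular_rels_killed[OF order_refl order_refl]] hom_seq_rels[of 0]
  by simp

text \<open>Put the \<open>u\<^sub>i\<close> first.  Modulo the primed variables \<open>u\<^sub>i\<close> is \<open>y\<^sub>i\<close>, and modulo these and the \<open>y\<^sub>j\<close>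
  the relations are those with \<open>b = 0\<close> in \<open>regular_rels_killed\<close>.\<close>

lemma regular_rels_us: "regular (var_ideal {}) (rels 1 (Suc k) @ us 1 (Suc l))"
proof -
  have d: "u i - pvar (VY i) \<in> var_ideal (killed k l) (2 * int i)" if "1 \<le> i" "i \<le> l" for i
    using that y'_killed[of i k l] ideal_neg[OF graded_ideal_var_ideal]
    by (simp add: u_def var_seq_eq_pvar)
  have W: "killed k l \<union> VY ` {1..l} = killed k 0"
    by (auto simp: killed_def)
  have "regular (var_ideal (killed k l)) (us 1 (Suc l))"
    unfolding us_def using d
    by (intro regular_pvars(1)[of l u VY]) (auto simp: P_vars_def killed_def inj_def)
  moreover have "ideal_gen (var_ideal (killed k l)) (us 1 (Suc l)) = var_ideal (killed k 0)"
    unfolding us_def W[symmetric] using d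
    by (intro regular_pvars(2)[of l u VY]) (auto simp: P_vars_def killed_def inj_def)
  ultimately have "regular (var_ideal (killed k l)) (us 1 (Suc l) @ rels 1 (Suc k))"
    using regular_rels_killed[of k 0] by (simp add: regular_append)
  moreover have hs: "hom_seq (us 1 (Suc l) @ rels 1 (Suc k))"
    using hom_seq_rels[of 0] hom_seq_us[of 0] by simp
  ultimately have "regular (var_ideal {}) (us 1 (Suc l) @ rels 1 (Suc k))"
    using regular_if_regular_mod_primed by blast
  from regular_rotate[OF graded_ideal_var_ideal hs this] show ?thesis .
qed

text \<open>With \<open>z\<^sub>j = x\<^sub>j - x'\<^sub>j\<close> one has \<open>r\<^sub>i = \<Sum>\<^sub>j z\<^sub>j y\<^sub>i\<^sub>-\<^sub>j + \<Sum>\<^sub>j x'\<^sub>j u\<^sub>i\<^sub>-\<^sub>j\<close>.  As \<open>y\<^sub>0 = 1\<close>, the first \<open>k\<close> of these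
  equations can be solved for \<open>z\<^sub>1, \<dots>, z\<^sub>k\<close>, and the other \<open>z\<^sub>j\<close> vanish.\<close>

lemma r_in_ideal:
  assumes Q: "graded_ideal Q" and r: "\<And>i. i \<in> {1..k} \<Longrightarrow> r i \<in> Q (2 * int i)"
    and u: "\<And>i. i \<in> {1..l} \<Longrightarrow> u i \<in> Q (2 * int i)"
  shows "r i \<in> Q (2 * int i)"
proof -
  define z where "z i = x i - x' i" for i
  have u: "u i \<in> Q (2 * int i)" for i
    using u[of i] ideal_0[OF Q] by (cases "i \<in> {1..l}") (auto simp: u_def var_seq_def)
  have r_eq: "r i = (\<Sum>j=0..i. z j * y (i - j)) + (\<Sum>j=0..i. x' j * u (i - j))" for i
    unfolding P_rel_def sum_subtractf[symmetric] sum.distrib[symmetric]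
    by (intro sum.cong) (auto simp: z_def u_def algebra_simps)
  have ux: "(\<Sum>j=0..i. x' j * u (i - j)) \<in> Q (2 * int i)" for i
    by (intro ideal_sum[OF Q] ideal_mult_conv2[OF Q x'_hom u]) auto
  have z: "z i \<in> Q (2 * int i)" for i
  proof (induction i rule: less_induct)
    case (less i)
    show ?case
    proof (cases "i \<in> {1..k}")
      case True
      have "{0..i} = insert i {0..<i}" by auto
      then have "r i = z i + (\<Sum>j\<in>{0..<i}. z j * y (i - j)) + (\<Sum>j=0..i. x' j * u (i - j))"
        by (subst r_eq) simp
      then have "z i = r i - (\<Sum>j\<in>{0..<i}. z j * y (i - j)) - (\<Sum>j=0..i. x' j * u (i - j))"
        by simp
      also have "\<dots> \<in> Q (2 * int i)"
        by (intro ideal_diff[OF Q] r True ideal_sum[OF Q] ux ideal_mult_conv1[OF Q less y_hom]) auto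
      finally show ?thesis .
    next
      case False
      then show ?thesis using ideal_0[OF Q] by (auto simp: z_def var_seq_def)
    qed
  qed
  show ?thesis
    unfolding r_eq by (intro ideal_add[OF Q] ux ideal_sum[OF Q] ideal_mult_conv1[OF Q z y_hom]) auto
qed

text \<open>Both ideals are generated by regular sequences of degrees \<open>2, 4, \<dots>, 2k, 2, 4, \<dots>, 2l\<close>.\<close>

lemma codim_rels_us:
  "poly.codim (hom d) (ideal_gen (var_ideal {}) (rels 1 (Suc k) @ us 1 (Suc l)) d)
    = poly.codim (hom d) (var_ideal (killed k l) d)"
proof -
  have "map snd (rels 1 (Suc k) @ us 1 (Suc l)) = map snd primed_vars"
    by (simp add: rels_def us_def primed_vars_def var_list_def comp_def del: upt_Suc)
  then show ?thesis
    unfolding ideal_gen_primed_vars[symmetric]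
    using hom_seq_rels[of 0] hom_seq_us[of 0] hom_seq_primed_vars regular_rels_us regular_primed_vars
    by (intro codim_ideal_gen_cong graded_ideal_var_ideal) auto
qed

lemma R'_subset: "R'_vars k l \<subseteq> P_vars k l" and R'_killed: "R'_vars k l = P_vars k l - killed k l"
  by (auto simp: R'_vars_def P_vars_def killed_def)

lemma graded_poly_ring_R': "graded_poly_ring (R'_vars k l)"
  by unfold_locales (auto simp: R'_vars_def)

lemma codim_R':
  "poly.codim (mvpoly_grading (R'_vars k l) d) {0} = poly.codim (hom d) (var_ideal (killed k l) d)"
proof -
  interpret pp: quotient_space_pair pscale pscale by unfold_locales
  interpret R': graded_poly_ring "R'_vars k l" by (rule graded_poly_ring_R')
  note J = graded_ideal_var_ideal
  have sub: "R'.hom d \<subseteq> hom d" using R'_subset unfolding hom_iff R'.hom_iff subset_iff by blast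
  show ?thesis
  proof (rule pp.codim_eqI[of id, symmetric])
    show "Vector_Spaces.linear pscale pscale id" by unfold_locales auto
    show "\<exists>v\<in>R'.hom d. p - id v \<in> var_ideal (killed k l) d" if p: "p \<in> hom d" for p
    proof -
      define K where "K = {m \<in> keys p. keys m \<inter> killed k l \<noteq> {}}"
      define v where "v = (\<Sum>m\<in>keys p - K. single m (lookup p m))"
      have K: "K \<subseteq> keys p" by (auto simp: K_def)
      have "v \<in> R'.hom d" unfolding v_def
      proof (rule R'.hom_sum)
        fix m assume "m \<in> keys p - K"
        then show "single m (lookup p m) \<in> R'.hom d"
          unfolding R'.hom_iff unfolding R'_killed using p by (auto simp: K_def hom_iff)
      qed
      moreover have "p - v = (\<Sum>m\<in>K. single m (lookup p m))"
        unfolding v_def diff_eq_eq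
        by (rule trans[OF poly_eq_sum_monomials trans[OF sum.subset_diff[OF K finite_keys] add.commute]])
      moreover have "(\<Sum>m\<in>K. single m (lookup p m)) \<in> var_ideal (killed k l) d"
      proof (rule ideal_sum[OF J])
        fix m assume "m \<in> K"
        then show "single m (lookup p m) \<in> var_ideal (killed k l) d"
          using p by (auto simp: var_ideal_def hom_iff K_def)
      qed
      ultimately show ?thesis by (intro bexI[of _ v]) simp_all
    qed
    show "id v \<in> var_ideal (killed k l) d \<longleftrightarrow> v \<in> {0}" if "v \<in> R'.hom d" for v
    proof
      assume "id v \<in> var_ideal (killed k l) d"
      then have J': "keys m \<inter> killed k l \<noteq> {}" if "m \<in> keys v" for m
        using that by (simp add: var_ideal_def)
      have "keys m \<subseteq> P_vars k l - killed k l" if "m \<in> keys v" for m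
        using \<open>v \<in> R'.hom d\<close> that unfolding R'.hom_iff R'_killed[symmetric] by simp
      with J' have "m \<notin> keys v" for m by blast
      then have "keys v = {}" by blast
      then show "v \<in> {0}" by simp
    qed (use ideal_0[OF J] in simp)
    show "var_ideal (killed k l) d \<subseteq> hom d" using ideal_hom[OF J] by blast
    show "{0} \<subseteq> R'.hom d" by simp
    show "id v \<in> hom d" if "v \<in> R'.hom d" for v using that sub by auto
  qed (rule R'.finitely_spanned_hom R'.subspace_hom finitely_spanned_hom subspace_hom
      poly.subspace_single_0 subspace_ideal[OF J])+
qed

end

section \<open>Koszul homology over a quotient ring\<close>

abbreviation cscale :: "complex \<Rightarrow> ('s \<Rightarrow> mvpoly) \<Rightarrow> ('s \<Rightarrow> mvpoly)" where
  "cscale c z \<equiv> (\<lambda>S. pscale c (z S))"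

global_interpretation chain: quotient_space cscale
  by unfold_locales
    (simp_all add: fun_eq_iff distrib_left distrib_right single_add mult_single mult.assoc[symmetric])

definition koszul_sign :: "nat \<Rightarrow> nat set \<Rightarrow> mvpoly" where
  "koszul_sign i T = (if even (card {j \<in> T. j < i}) then 1 else - 1)"

lemma koszul_sign_square [simp]: "koszul_sign i T * (koszul_sign i T * p) = p"
  by (simp add: koszul_sign_def)

lemma koszul_sign_insert:
  assumes "finite T" and "p \<notin> T"
  shows "koszul_sign i (insert p T) = (if p < i then - koszul_sign i T else koszul_sign i T)"
proof -
  have "{j \<in> insert p T. j < i} = (if p < i then insert p {j \<in> T. j < i} else {j \<in> T. j < i})"
    by auto
  then show ?thesis using assms by (simp add: koszul_sign_def)
qed

lemma koszul_sign_swap: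
  assumes "finite T" and "p \<notin> T" and "i \<notin> T" and "i \<noteq> p"
  shows "koszul_sign p (insert i T) * koszul_sign i (insert p T) = - (koszul_sign i T * koszul_sign p T)"
    and "koszul_sign p T * koszul_sign i (insert p T) = - (koszul_sign i T * koszul_sign p (insert i T))"
  using assms by (auto simp: koszul_sign_insert)

text \<open>\<open>w i\<close> is the degree of the basis element \<open>e\<^sub>i\<close>.  As \<open>a\<^sub>i\<close> has degree \<open>w i + 1\<close>, the differential
  raises the degree by one.\<close>

locale koszul = graded_poly_ring +
  fixes n :: nat and a :: "nat \<Rightarrow> mvpoly" and w :: "nat \<Rightarrow> int"
  assumes a_hom: "i \<in> {1..n} \<Longrightarrow> a i \<in> hom (w i + 1)"
begin

text \<open>Coefficients outside \<open>A\<close> are \<open>0\<close>, so that chains form a subspace of a type with pointwise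
  operations.\<close>

definition chains_on :: "(int \<Rightarrow> mvpoly set) \<Rightarrow> nat set set \<Rightarrow> int \<Rightarrow> (nat set \<Rightarrow> mvpoly) set" where
  "chains_on J A d = {z. \<forall>S. if S \<in> A then z S \<in> J (d - sum w S) else z S = 0}"

abbreviation chains :: "(int \<Rightarrow> mvpoly set) \<Rightarrow> int \<Rightarrow> int \<Rightarrow> (nat set \<Rightarrow> mvpoly) set" where
  "chains J c \<equiv> chains_on J (koszul_index n c)"

definition D :: "(nat set \<Rightarrow> mvpoly) \<Rightarrow> (nat set \<Rightarrow> mvpoly)" where
  "D z T = (if T \<subseteq> {1..n} then \<Sum>i\<in>{1..n} - T. koszul_sign i T * (a i * z (insert i T)) else 0)"

text \<open>Exterior multiplication by \<open>e\<^sub>i\<close> from the left.\<close>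

definition wedge :: "nat \<Rightarrow> (nat set \<Rightarrow> mvpoly) \<Rightarrow> (nat set \<Rightarrow> mvpoly)" where
  "wedge i z S = (if i \<in> S \<and> S \<subseteq> {1..n} then koszul_sign i (S - {i}) * z (S - {i}) else 0)"

definition wedge_sum :: "(nat \<Rightarrow> mvpoly) \<Rightarrow> (nat set \<Rightarrow> mvpoly) \<Rightarrow> (nat set \<Rightarrow> mvpoly)" where
  "wedge_sum b z S = (\<Sum>i\<in>{1..n}. b i * wedge i z S)"

text \<open>The chains over \<open>S\<close> that represent cycles over \<open>S/J\<close>.\<close>

definition cycles :: "(int \<Rightarrow> mvpoly set) \<Rightarrow> int \<Rightarrow> int \<Rightarrow> (nat set \<Rightarrow> mvpoly) set" where
  "cycles J c d = {z \<in> chains hom c d. D z \<in> chains J (c + 1) (d + 1)}"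

text \<open>The chains over \<open>S\<close> that represent boundaries over \<open>S/J\<close>; this includes the representatives of \<open>0\<close>.\<close>

definition boundaries :: "(int \<Rightarrow> mvpoly set) \<Rightarrow> int \<Rightarrow> int \<Rightarrow> (nat set \<Rightarrow> mvpoly) set" where
  "boundaries J c d = {D y + j | y j. y \<in> chains hom (c - 1) (d - 1) \<and> j \<in> chains J c d}"

definition hdim :: "(int \<Rightarrow> mvpoly set) \<Rightarrow> int \<Rightarrow> int \<Rightarrow> nat" where
  "hdim J c d = chain.codim (cycles J c d) (boundaries J c d)"

lemma graded_ideal_hom: "graded_ideal hom"
  unfolding graded_ideal_def using subspace_hom hom_mult by auto

lemma koszul_indexD: "S \<in> koszul_index n c \<Longrightarrow> S \<subseteq> {1..n} \<and> finite S"
  by (auto simp: koszul_index_def finite_subset)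

lemma insert_koszul_index:
  "T \<subseteq> {1..n} \<Longrightarrow> i \<in> {1..n} - T \<Longrightarrow> insert i T \<in> koszul_index n c \<longleftrightarrow> T \<in> koszul_index n (c + 1)"
  using finite_subset[of T "{1..n}"] by (auto simp: koszul_index_def)

lemma Diff_koszul_index:
  assumes "S \<subseteq> {1..n}" "i \<in> S"
  shows "S - {i} \<in> koszul_index n c \<longleftrightarrow> S \<in> koszul_index n (c - 1)"
proof -
  have "insert i (S - {i}) \<in> koszul_index n (c - 1) \<longleftrightarrow> S - {i} \<in> koszul_index n (c - 1 + 1)"
    using assms by (intro insert_koszul_index) auto
  then show ?thesis using assms by (simp add: insert_absorb)
qed

lemma D_add: "D (y + z) = D y + D z"
  by (auto simp: D_def fun_eq_iff algebra_simps sum.distrib)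

lemma D_mult: "D (\<lambda>S. p * z S) = (\<lambda>S. p * D z S)"
  by (auto simp: D_def fun_eq_iff sum_distrib_left algebra_simps intro!: sum.cong)

lemma D_diff: "D (y - z) = D y - D z"
  using D_add[of "y - z" z] by (simp add: algebra_simps)

lemma D_zero [simp]: "D 0 = 0"
  using D_diff[of 0 0] by simp

lemma wedge_sum_add: "wedge_sum b (y + z) = wedge_sum b y + wedge_sum b z"
  by (auto simp: wedge_sum_def wedge_def fun_eq_iff algebra_simps sum.distrib if_distrib intro!: sum.cong simp flip: sum.distrib)

lemma wedge_sum_mult: "wedge_sum b (\<lambda>S. p * z S) = (\<lambda>S. p * wedge_sum b z S)"
  by (auto simp: wedge_sum_def wedge_def fun_eq_iff sum_distrib_left algebra_simps intro!: sum.cong)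

lemma wedge_sum_diff: "wedge_sum b (y - z) = wedge_sum b y - wedge_sum b z"
  using wedge_sum_add[of b "y - z" z] by (simp add: algebra_simps)

lemma linear_wedge_sum: "Vector_Spaces.linear cscale cscale (wedge_sum b)"
  by unfold_locales (simp_all add: wedge_sum_add wedge_sum_mult)

text \<open>The differential is a derivation with \<open>D e\<^sub>i = a\<^sub>i\<close>.  The signs are checked by cases on whether \<open>e\<^sub>i\<close>
  divides \<open>e\<^sub>T\<close>.\<close>

lemma D_wedge:
  assumes T: "T \<subseteq> {1..n}" and i: "i \<in> {1..n}"
  shows "D (wedge i z) T + wedge i (D z) T = a i * z T"
proof (cases "i \<in> T")
  case False
  have "D (wedge i z) T = (\<Sum>p\<in>{1..n} - T. koszul_sign p T * (a p * wedge i z (insert p T)))"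
    using T by (simp add: D_def)
  also have "\<dots> = (\<Sum>p\<in>{i}. koszul_sign p T * (a p * wedge i z (insert p T)))"
    using False i by (intro sum.mono_neutral_right) (auto simp: wedge_def)
  also have "\<dots> = a i * z T"
    using False i T by (simp add: wedge_def mult.left_commute[of "a i"])
  finally show ?thesis using False by (simp add: wedge_def)
next
  case True
  define U where "U = T - {i}"
  have U: "T = insert i U" "i \<notin> U" "finite U" "U \<subseteq> {1..n}" "{1..n} - U = insert i ({1..n} - T)"
    using True T i finite_subset[OF T] by (auto simp: U_def)
  have "D (wedge i z) T = (\<Sum>p\<in>{1..n} - T. koszul_sign p T * (a p * (koszul_sign i (insert p U) * z (insert p U))))"
  proof -
    have "wedge i z (insert p T) = koszul_sign i (insert p U) * z (insert p U)" if p: "p \<in> {1..n} - T" for p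
    proof -
      have "insert p T - {i} = insert p U" using p True by (auto simp: U_def)
      then show ?thesis using p T True by (simp add: wedge_def)
    qed
    then show ?thesis using T by (simp add: D_def)
  qed
  also have "\<dots> = (\<Sum>p\<in>{1..n} - T. - (koszul_sign i U * (koszul_sign p U * (a p * z (insert p U)))))"
  proof (intro sum.cong refl)
    fix p assume "p \<in> {1..n} - T"
    then have "koszul_sign p T * koszul_sign i (insert p U) = - (koszul_sign i U * koszul_sign p U)"
      using U koszul_sign_swap(1)[of U p i] by auto
    then have "koszul_sign p T * koszul_sign i (insert p U) * (a p * z (insert p U))
      = - (koszul_sign i U * koszul_sign p U) * (a p * z (insert p U))" by simp
    then show "koszul_sign p T * (a p * (koszul_sign i (insert p U) * z (insert p U)))
      = - (koszul_sign i U * (koszul_sign p U * (a p * z (insert p U))))"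
      by (simp add: algebra_simps)
  qed
  also have "\<dots> = - (koszul_sign i U * (\<Sum>p\<in>{1..n} - T. koszul_sign p U * (a p * z (insert p U))))"
    by (simp add: sum_negf sum_distrib_left)
  finally have 1: "D (wedge i z) T = - (koszul_sign i U * (\<Sum>p\<in>{1..n} - T. koszul_sign p U * (a p * z (insert p U))))" .
  have "wedge i (D z) T = koszul_sign i U * (\<Sum>p\<in>insert i ({1..n} - T). koszul_sign p U * (a p * z (insert p U)))"
  proof -
    have "wedge i (D z) T = koszul_sign i U * D z U" using True T by (simp add: wedge_def U_def)
    moreover have "D z U = (\<Sum>p\<in>insert i ({1..n} - T). koszul_sign p U * (a p * z (insert p U)))"
      unfolding D_def using U(4) by (simp only: U(5) if_True)
    ultimately show ?thesis by simp
  qed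
  also have "\<dots> = koszul_sign i U * (koszul_sign i U * (a i * z T))
      + koszul_sign i U * (\<Sum>p\<in>{1..n} - T. koszul_sign p U * (a p * z (insert p U)))"
    using True by (simp add: distrib_left U(1)[symmetric])
  finally show ?thesis using 1 by simp
qed

text \<open>The terms for removing \<open>i\<close> and then \<open>j\<close> cancel against those for removing \<open>j\<close> and then \<open>i\<close>.\<close>

lemma D_D: "D (D z) = 0"
proof
  fix T
  show "D (D z) T = 0 T"
  proof (cases "T \<subseteq> {1..n}")
    case True
    have fin: "finite T" using True finite_subset by blast
    define X where "X = {1..n} - T"
    define g where "g i j = koszul_sign i T * koszul_sign j (insert i T) * (a i * a j * z (insert i (insert j T)))" for i j
    have "D (D z) T = (\<Sum>i\<in>X. \<Sum>j\<in>X - {i}. g i j)"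
      using True
      by (auto simp: D_def X_def g_def sum_distrib_left insert_commute algebra_simps intro!: sum.cong)
    also have "\<dots> = (\<Sum>(i, j)\<in>(SIGMA i:X. X - {i}). g i j)"
      by (rule sum.Sigma) (auto simp: X_def)
    also have "(SIGMA i:X. X - {i}) = {(i, j)\<in>X \<times> X. i < j} \<union> {(i, j)\<in>X \<times> X. j < i}"
      by auto
    also have "(\<Sum>(i, j)\<in>{(i, j)\<in>X \<times> X. i < j} \<union> {(i, j)\<in>X \<times> X. j < i}. g i j)
        = (\<Sum>(i, j)\<in>{(i, j)\<in>X \<times> X. i < j}. g i j) + (\<Sum>(i, j)\<in>{(i, j)\<in>X \<times> X. j < i}. g i j)"
    proof (rule sum.union_disjoint)
      have "finite (X \<times> X)" by (simp add: X_def)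
      then show "finite {(i, j)\<in>X \<times> X. i < j}" "finite {(i, j)\<in>X \<times> X. j < i}"
        by (auto elim: rev_finite_subset)
    qed auto
    also have "(\<Sum>(i, j)\<in>{(i, j)\<in>X \<times> X. j < i}. g i j) = (\<Sum>(i, j)\<in>{(i, j)\<in>X \<times> X. i < j}. g j i)"
      by (rule sum.reindex_bij_witness[of _ "\<lambda>(i, j). (j, i)" "\<lambda>(i, j). (j, i)"]) auto
    also have "\<dots> = (\<Sum>(i, j)\<in>{(i, j)\<in>X \<times> X. i < j}. - g i j)"
    proof (intro sum.cong refl, clarify)
      fix i j assume ij: "i \<in> X" "j \<in> X" "i < j"
      have "koszul_sign j T * koszul_sign i (insert j T) = - (koszul_sign i T * koszul_sign j (insert i T))"
        using ij fin koszul_sign_swap(2)[of T j i] by (auto simp: X_def)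
      then show "g j i = - g i j"
        by (simp add: g_def insert_commute mult.commute[of "a i"])
    qed
    finally show ?thesis by (simp add: case_prod_unfold sum_negf)
  qed (simp add: D_def)
qed

lemma chains_onI: "(\<And>S. S \<in> A \<Longrightarrow> z S \<in> J (d - sum w S)) \<Longrightarrow> (\<And>S. S \<notin> A \<Longrightarrow> z S = 0) \<Longrightarrow> z \<in> chains_on J A d"
  by (simp add: chains_on_def)

lemma chains_onD: "z \<in> chains_on J A d \<Longrightarrow> S \<in> A \<Longrightarrow> z S \<in> J (d - sum w S)"
  and chains_on_outside: "z \<in> chains_on J A d \<Longrightarrow> S \<notin> A \<Longrightarrow> z S = 0"
  by (auto simp: chains_on_def split: if_splits)

lemma subspace_chains_on: "graded_ideal J \<Longrightarrow> chain.subspace (chains_on J A d)"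
  unfolding chains_on_def
  by (rule chain.subspaceI)
    (auto simp: ideal_0 ideal_add poly.subspace_scale[OF subspace_ideal])

lemmas chains_0 = chain.subspace_0[OF subspace_chains_on]
  and chains_add = chain.subspace_add[OF subspace_chains_on]
  and chains_diff = chain.subspace_diff[OF subspace_chains_on]

lemma chains_on_mono: "(\<And>d. J d \<subseteq> K d) \<Longrightarrow> chains_on J A d \<subseteq> chains_on K A d"
  unfolding chains_on_def by (auto split: if_splits)

lemma chains_hom: "graded_ideal J \<Longrightarrow> z \<in> chains_on J A d \<Longrightarrow> z \<in> chains_on hom A d"
  using chains_on_mono[of J hom A d] ideal_hom by blast

lemma chains_mult:
  assumes "graded_ideal J" and "p \<in> hom e" and "z \<in> chains_on J A d" and "d' = d + e"
  shows "(\<lambda>S. p * z S) \<in> chains_on J A d'"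
proof (rule chains_onI)
  show "p * z S \<in> J (d' - sum w S)" if "S \<in> A" for S
    by (rule ideal_mult'[OF assms(1,2) chains_onD[OF assms(3) that]]) (use assms(4) in simp)
  show "p * z S = 0" if "S \<notin> A" for S
    using chains_on_outside[OF assms(3) that] by simp
qed

lemma sign_mult: "graded_ideal J \<Longrightarrow> p \<in> J d \<Longrightarrow> koszul_sign i T * p \<in> J d"
  using ideal_neg by (auto simp: koszul_sign_def)

lemma D_chains:
  assumes J: "graded_ideal J" and z: "z \<in> chains J c d"
  shows "D z \<in> chains J (c + 1) (d + 1)"
proof (rule chains_onI)
  fix T assume T: "T \<in> koszul_index n (c + 1)"
  then have T': "T \<subseteq> {1..n}" "finite T" using koszul_indexD by blast+
  have "koszul_sign i T * (a i * z (insert i T)) \<in> J (d + 1 - sum w T)" if i: "i \<in> {1..n} - T" for i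
  proof -
    have "insert i T \<in> koszul_index n c" using insert_koszul_index[OF T'(1) i] T by blast
    then have "z (insert i T) \<in> J (d - sum w (insert i T))" by (rule chains_onD[OF z])
    then have "a i * z (insert i T) \<in> J (d + 1 - sum w T)"
      using T' i a_hom[of i] by (intro ideal_mult'[OF J, of "a i" "w i + 1" _ "d - sum w (insert i T)"]) auto
    then show ?thesis by (rule sign_mult[OF J])
  qed
  then have "(\<Sum>i\<in>{1..n} - T. koszul_sign i T * (a i * z (insert i T))) \<in> J (d + 1 - sum w T)"
    by (rule ideal_sum[OF J])
  then show "D z T \<in> J (d + 1 - sum w T)" using T' by (simp add: D_def)
next
  fix T assume T: "T \<notin> koszul_index n (c + 1)"
  have "z (insert i T) = 0" if "T \<subseteq> {1..n}" "i \<in> {1..n} - T" for i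
    using chains_on_outside[OF z] insert_koszul_index[OF that] T by blast
  then show "D z T = 0" by (simp add: D_def)
qed

lemma wedge_chains:
  assumes J: "graded_ideal J" and z: "z \<in> chains J c d" and i: "i \<in> {1..n}"
  shows "wedge i z \<in> chains J (c - 1) (d + w i)"
proof (rule chains_onI)
  fix S assume S: "S \<in> koszul_index n (c - 1)"
  then have S': "S \<subseteq> {1..n}" "finite S" using koszul_indexD by blast+
  show "wedge i z S \<in> J (d + w i - sum w S)"
  proof (cases "i \<in> S")
    case True
    then have "S - {i} \<in> koszul_index n c" using Diff_koszul_index[OF S'(1)] S by blast
    then have "z (S - {i}) \<in> J (d - sum w (S - {i}))" by (rule chains_onD[OF z])
    also have "d - sum w (S - {i}) = d + w i - sum w S" using S' True by (simp add: sum_diff1)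
    finally show ?thesis using True S' by (simp add: wedge_def sign_mult[OF J])
  qed (simp add: wedge_def ideal_0[OF J])
next
  fix S assume S: "S \<notin> koszul_index n (c - 1)"
  have "z (S - {i}) = 0" if "i \<in> S" "S \<subseteq> {1..n}"
    using chains_on_outside[OF z] Diff_koszul_index[OF that(2,1)] S by blast
  then show "wedge i z S = 0" by (simp add: wedge_def)
qed

lemma wedge_sum_chains:
  assumes J: "graded_ideal J" and b: "\<And>i. i \<in> {1..n} \<Longrightarrow> b i \<in> hom (e - w i - 1)"
    and z: "z \<in> chains J c d" and d': "d' = d + e - 1"
  shows "wedge_sum b z \<in> chains J (c - 1) d'"
proof -
  have "(\<lambda>S. b i * wedge i z S) \<in> chains J (c - 1) d'" if "i \<in> {1..n}" for i
    by (rule chains_mult[OF J b[OF that] wedge_chains[OF J z that]]) (use d' in simp)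
  then have "(\<Sum>i\<in>{1..n}. (\<lambda>S. b i * wedge i z S)) \<in> chains J (c - 1) d'"
    by (rule chain.subspace_sum[OF subspace_chains_on[OF J]])
  moreover have "(\<Sum>i\<in>A. (\<lambda>S. b i * wedge i z S)) = (\<lambda>S. \<Sum>i\<in>A. b i * wedge i z S)" if "finite A" for A
    using that by (induction A rule: finite_induct) (auto simp: fun_eq_iff)
  ultimately show ?thesis by (simp add: wedge_sum_def[abs_def])
qed

text \<open>The null-homotopy: \<open>\<Sum>\<^sub>i b\<^sub>i e\<^sub>i\<close> contracts multiplication by \<open>\<Sum>\<^sub>i b\<^sub>i a\<^sub>i\<close>.\<close>

lemma D_wedge_sum:
  assumes z: "z \<in> chains J c d"
  shows "D (wedge_sum b z) = (\<lambda>S. (\<Sum>i\<in>{1..n}. b i * a i) * z S) - wedge_sum b (D z)"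
proof
  fix T
  show "D (wedge_sum b z) T = ((\<lambda>S. (\<Sum>i\<in>{1..n}. b i * a i) * z S) - wedge_sum b (D z)) T"
  proof (cases "T \<subseteq> {1..n}")
    case True
    have "D (wedge_sum b z) T = (\<Sum>p\<in>{1..n} - T. \<Sum>i\<in>{1..n}. b i * (koszul_sign p T * (a p * wedge i z (insert p T))))"
      using True by (simp add: D_def wedge_sum_def sum_distrib_left algebra_simps)
    also have "\<dots> = (\<Sum>i\<in>{1..n}. b i * D (wedge i z) T)"
      using True by (subst sum.swap) (simp add: D_def sum_distrib_left)
    also have "\<dots> = (\<Sum>i\<in>{1..n}. b i * a i * z T - b i * wedge i (D z) T)"
    proof (intro sum.cong refl)
      fix i assume "i \<in> {1..n}"
      then have "D (wedge i z) T = a i * z T - wedge i (D z) T"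
        using D_wedge[OF True, of i z] by (simp add: algebra_simps)
      then show "b i * D (wedge i z) T = b i * a i * z T - b i * wedge i (D z) T"
        by (simp only: right_diff_distrib mult.assoc)
    qed
    finally show ?thesis by (simp add: wedge_sum_def sum_subtractf sum_distrib_right)
  next
    case False
    then have "T \<notin> koszul_index n c" by (auto simp: koszul_index_def)
    then have "z T = 0" by (rule chains_on_outside[OF z])
    with False show ?thesis by (simp add: D_def wedge_sum_def wedge_def)
  qed
qed

lemma finitely_spanned_chains:
  assumes "finite A"
  shows "chain.finitely_spanned (chains_on hom A d)"
  unfolding chain.finitely_spanned_def
proof (intro exI conjI)
  define M where "M S = {m. keys m \<subseteq> V \<and> int (monom_deg m) = d - sum w S}" for S
  define B :: "(nat set \<Rightarrow> mvpoly) set" where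
    "B = (\<Union>S\<in>A. (\<lambda>m S'. if S' = S then single m 1 else 0) ` M S)"
  show "finite B" unfolding B_def M_def using assms finite_monomials by blast
  show "chains_on hom A d \<subseteq> chain.span B"
  proof
    fix z assume z: "z \<in> chains_on hom A d"
    have sum_apply: "(\<Sum>i\<in>I. f i) S = (\<Sum>i\<in>I. f i S)" for f :: "'i \<Rightarrow> nat set \<Rightarrow> mvpoly" and I S
      by (induction I rule: infinite_finite_induct) auto
    define v where "v S = (\<Sum>m\<in>keys (z S). cscale (lookup (z S) m)
        (\<lambda>S'. if S' = S then single m 1 else 0))" for S
    have "v S \<in> chain.span B" if "S \<in> A" for S
      unfolding v_def
    proof (intro chain.span_sum chain.span_scale chain.span_base)
      fix m assume "m \<in> keys (z S)"
      then have "m \<in> M S" using chains_onD[OF z that] by (auto simp: M_def hom_iff)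
      then show "(\<lambda>S'. if S' = S then single m 1 else 0) \<in> B"
        using that by (auto simp: B_def)
    qed
    then have "(\<Sum>S\<in>A. v S) \<in> chain.span B" by (rule chain.span_sum)
    moreover have "v S S' = (if S' = S then z S else 0)" for S S'
      unfolding v_def sum_apply
      using poly_eq_sum_monomials[of "z S"] by (auto simp: mult_single)
    then have "(\<Sum>S\<in>A. v S) = z"
      using assms chains_on_outside[OF z] by (auto simp: fun_eq_iff sum_apply sum.delta)
    ultimately show "z \<in> chain.span B" by simp
  qed
qed

lemma finite_koszul_index: "finite (koszul_index n c)"
  by (rule finite_subset[of _ "Pow {1..n}"]) (auto simp: koszul_index_def)

lemma subspace_cycles: "graded_ideal J \<Longrightarrow> chain.subspace (cycles J c d)"
  unfolding cycles_def
  by (rule chain.subspaceI)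
    (auto simp: D_add D_mult chains_0 chains_add graded_ideal_hom
      chain.subspace_scale[OF subspace_chains_on])

lemma boundariesI: "y \<in> chains hom (c - 1) (d - 1) \<Longrightarrow> j \<in> chains J c d \<Longrightarrow> z = D y + j \<Longrightarrow> z \<in> boundaries J c d"
  unfolding boundaries_def by blast

lemma boundariesE:
  assumes "z \<in> boundaries J c d"
  obtains y j where "y \<in> chains hom (c - 1) (d - 1)" "j \<in> chains J c d" "z = D y + j"
  using assms unfolding boundaries_def by blast

lemma subspace_boundaries:
  assumes J: "graded_ideal J"
  shows "chain.subspace (boundaries J c d)"
proof (rule chain.subspaceI)
  show "0 \<in> boundaries J c d"
    by (rule boundariesI[of 0 _ _ 0]) (simp_all add: chains_0 J graded_ideal_hom)
  fix z assume "z \<in> boundaries J c d"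
  then obtain y j where z: "y \<in> chains hom (c - 1) (d - 1)" "j \<in> chains J c d" "z = D y + j"
    by (rule boundariesE)
  show "cscale q z \<in> boundaries J c d" for q
    by (rule boundariesI[of "cscale q y" _ _ "cscale q j"])
      (use z chain.subspace_scale[OF subspace_chains_on] J graded_ideal_hom
        in \<open>auto simp: D_mult fun_eq_iff distrib_left\<close>)
  fix z' assume "z' \<in> boundaries J c d"
  then obtain y' j' where z': "y' \<in> chains hom (c - 1) (d - 1)" "j' \<in> chains J c d" "z' = D y' + j'"
    by (rule boundariesE)
  show "z + z' \<in> boundaries J c d"
    by (rule boundariesI[of "y + y'" _ _ "j + j'"])
      (use z z' chains_add J graded_ideal_hom in \<open>auto simp: D_add algebra_simps\<close>)
qed

lemma boundaries_subset_cycles: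
  assumes J: "graded_ideal J"
  shows "boundaries J c d \<subseteq> cycles J c d"
proof
  fix z assume "z \<in> boundaries J c d"
  then obtain y j where z: "y \<in> chains hom (c - 1) (d - 1)" "j \<in> chains J c d" "z = D y + j"
    by (rule boundariesE)
  have "D z = D j" using z D_D[of y] by (simp add: D_add)
  moreover have "D y \<in> chains hom c d" using D_chains[OF graded_ideal_hom z(1)] by simp
  ultimately show "z \<in> cycles J c d"
    using z D_chains[OF J z(2)] chains_hom[OF J z(2)] chains_add[OF graded_ideal_hom]
    by (simp add: cycles_def)
qed

lemma finitely_spanned_cycles: "chain.finitely_spanned (cycles J c d)"
  by (rule chain.finitely_spanned_subset[OF finitely_spanned_chains[OF finite_koszul_index[of c], of d]])
    (auto simp: cycles_def)

lemma chains_ideal_insertE: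
  assumes z: "z \<in> chains_on (ideal_insert J f e) A d"
  obtains j v where "j \<in> chains_on J A d" "v \<in> chains_on hom A (d - e)" "z = j + (\<lambda>S. f * v S)"
proof -
  have "\<exists>j v. j \<in> J (d - sum w S) \<and> v \<in> hom (d - e - sum w S) \<and> z S = j + f * v" if "S \<in> A" for S
    using chains_onD[OF z that] by (elim ideal_insertE) (auto simp: algebra_simps)
  then obtain j v where jv: "\<And>S. S \<in> A \<Longrightarrow> j S \<in> J (d - sum w S) \<and> v S \<in> hom (d - e - sum w S) \<and> z S = j S + f * v S"
    by metis
  show thesis
  proof (rule that[of "\<lambda>S. if S \<in> A then j S else 0" "\<lambda>S. if S \<in> A then v S else 0"])
    show "z = (\<lambda>S. if S \<in> A then j S else 0) + (\<lambda>S. f * (if S \<in> A then v S else 0))"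
      using jv chains_on_outside[OF z] by (auto simp: fun_eq_iff)
  qed (use jv in \<open>auto simp: chains_on_def\<close>)
qed

lemma chains_ideal_insertI:
  assumes "j \<in> chains_on J A d" "v \<in> chains_on hom A (d - e)" "z = j + (\<lambda>S. f * v S)"
  shows "z \<in> chains_on (ideal_insert J f e) A d"
proof (rule chains_onI)
  show "z S \<in> ideal_insert J f e (d - sum w S)" if "S \<in> A" for S
    using chains_onD[OF assms(1) that] chains_onD[OF assms(2) that] assms(3)
    by (intro ideal_insertI[of "j S" _ _ "v S"]) (auto simp: algebra_simps)
  show "z S = 0" if "S \<notin> A" for S
    using chains_on_outside[OF assms(1) that] chains_on_outside[OF assms(2) that] assms(3) by simp
qed

lemma chains_nonzerodivisor:
  assumes "nonzerodivisor J f e" and "z \<in> chains_on hom A d" and "(\<lambda>S. f * z S) \<in> chains_on J A (e + d)"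
  shows "z \<in> chains_on J A d"
proof (rule chains_onI)
  show "z S \<in> J (d - sum w S)" if "S \<in> A" for S
    using assms(1) chains_onD[OF assms(2) that] chains_onD[OF assms(3) that]
    unfolding nonzerodivisor_def by (simp add: add_diff_eq)
  show "z S = 0" if "S \<notin> A" for S by (rule chains_on_outside[OF assms(2) that])
qed

context
  fixes J :: "int \<Rightarrow> mvpoly set" and f :: mvpoly and e :: int and b :: "nat \<Rightarrow> mvpoly"
  assumes J: "graded_ideal J" and f: "f \<in> hom e" and nzd: "nonzerodivisor J f e"
    and b: "\<And>i. i \<in> {1..n} \<Longrightarrow> b i \<in> hom (e - w i - 1)"
    and f_eq: "f = (\<Sum>i\<in>{1..n}. b i * a i)"
begin

private abbreviation "K \<equiv> ideal_insert J f e"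
private abbreviation "h \<equiv> wedge_sum b"

private lemma K: "graded_ideal K" by (rule graded_ideal_insert[OF J f])

private lemma D_h: "z \<in> chains I c d \<Longrightarrow> D (h z) = (\<lambda>S. f * z S) - h (D z)"
  unfolding f_eq by (rule D_wedge_sum)

private lemma h_chains: "graded_ideal I \<Longrightarrow> z \<in> chains I c d \<Longrightarrow> d' = d + e - 1 \<Longrightarrow> c' = c - 1 \<Longrightarrow> h z \<in> chains I c' d'"
  using wedge_sum_chains[OF _ b] by blast

private lemma J_subset_K: "chains_on J A d \<subseteq> chains_on K A d"
  by (rule chains_on_mono) (auto intro: ideal_insert_superset)

private lemma boundaries_J_subset_K: "boundaries J c d \<subseteq> boundaries K c d"
  using J_subset_K unfolding boundaries_def by blast

private lemma cycles_J_subset_K: "cycles J c d \<subseteq> cycles K c d"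
  using J_subset_K unfolding cycles_def by blast

private lemma h_cycles:
  assumes v: "v \<in> cycles J (c + 1) (d + 1 - e)"
  shows "h v \<in> cycles K c d"
proof -
  have v': "v \<in> chains hom (c + 1) (d + 1 - e)" "D v \<in> chains J (c + 1 + 1) (d + 1 - e + 1)"
    using v by (auto simp: cycles_def)
  have "h (D v) \<in> chains J (c + 1) (d + 1)"
    by (rule h_chains[OF J v'(2)]) simp_all
  then have "0 - h (D v) \<in> chains J (c + 1) (d + 1)" by (intro chains_diff chains_0 J)
  then have "D (h v) \<in> chains K (c + 1) (d + 1)"
    by (rule chains_ideal_insertI[where v = v]) (use v' D_h[OF v'(1)] in auto)
  then show ?thesis
    using h_chains[OF graded_ideal_hom v'(1), of d c] by (simp add: cycles_def)
qed

text \<open>If \<open>D u = j + f v\<close> with \<open>j\<close> over \<open>J\<close>, then \<open>v\<close> is a cycle because \<open>f\<close> is a nonzerodivisor, and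
  \<open>u - h v\<close> is a cycle over \<open>J\<close> because \<open>D (h v)\<close> is \<open>f v\<close> up to \<open>J\<close>.\<close>

private lemma cycles_K:
  assumes u: "u \<in> cycles K c d"
  obtains v where "v \<in> cycles J (c + 1) (d + 1 - e)" "u - h v \<in> cycles J c d"
proof -
  have u': "u \<in> chains hom c d" "D u \<in> chains K (c + 1) (d + 1)" using u by (auto simp: cycles_def)
  obtain j v where jv: "j \<in> chains J (c + 1) (d + 1)" "v \<in> chains hom (c + 1) (d + 1 - e)"
    "D u = j + (\<lambda>S. f * v S)"
    using u'(2) by (rule chains_ideal_insertE)
  have "0 = D j + (\<lambda>S. f * D v S)"
    using arg_cong[OF jv(3), of D] D_D by (simp add: D_add D_mult)
  then have "(\<lambda>S. f * D v S) = 0 - D j" by (simp add: eq_neg_iff_add_eq_0 add.commute)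
  also have "\<dots> \<in> chains J (c + 1 + 1) (e + (d + 1 - e + 1))"
    using D_chains[OF J jv(1)] by (intro chains_diff chains_0 J) (simp add: algebra_simps)
  finally have "D v \<in> chains J (c + 1 + 1) (d + 1 - e + 1)"
    by (rule chains_nonzerodivisor[OF nzd D_chains[OF graded_ideal_hom jv(2)]])
  then have v: "v \<in> cycles J (c + 1) (d + 1 - e)" using jv by (simp add: cycles_def)
  have "h v \<in> chains hom c d" by (rule h_chains[OF graded_ideal_hom jv(2)]) simp_all
  moreover have "D (u - h v) = j + h (D v)"
    using D_h[OF jv(2)] jv(3) by (simp add: D_diff)
  moreover have "h (D v) \<in> chains J (c + 1) (d + 1)"
    using v unfolding cycles_def by (intro h_chains[OF J, of "D v" "c + 1 + 1" "d + 1 - e + 1"]) auto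
  ultimately have "u - h v \<in> cycles J c d"
    using u' jv chains_add[OF J] chains_diff[OF graded_ideal_hom] by (simp add: cycles_def)
  with v show thesis by (rule that)
qed

private lemma h_boundaries:
  assumes v: "v \<in> boundaries J (c + 1) (d + 1 - e)"
  shows "h v \<in> boundaries K c d"
proof -
  have shift: "c + 1 - 1 = c" "d + 1 - e - 1 = d - e" by simp_all
  obtain y j where yj: "y \<in> chains hom c (d - e)" "j \<in> chains J (c + 1) (d + 1 - e)" "v = D y + j"
    using v unfolding boundaries_def shift by blast
  have "h y \<in> chains hom (c - 1) (d - 1)" by (rule h_chains[OF graded_ideal_hom yj(1)]) simp_all
  then have "0 - h y \<in> chains hom (c - 1) (d - 1)" by (intro chains_diff chains_0 graded_ideal_hom)
  moreover have "h j \<in> chains J c d" by (rule h_chains[OF J yj(2)]) simp_all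
  then have "h j + (\<lambda>S. f * y S) \<in> chains K c d"
    using yj(1) by (intro chains_ideal_insertI) auto
  moreover have "h v = D (0 - h y) + (h j + (\<lambda>S. f * y S))"
    using D_h[OF yj(1)] yj(3) D_diff[of 0 "h y"] by (simp add: wedge_sum_add algebra_simps)
  ultimately show ?thesis by (rule boundariesI)
qed

text \<open>Injectivity: the class of \<open>z + h v\<close> over \<open>K\<close> determines the classes of \<open>z\<close> and \<open>v\<close> over \<open>J\<close>.\<close>

private lemma split_boundaries:
  assumes z: "z \<in> cycles J c d" and v: "v \<in> cycles J (c + 1) (d + 1 - e)"
    and zv: "z + h v \<in> boundaries K c d"
  shows "z \<in> boundaries J c d" and "v \<in> boundaries J (c + 1) (d + 1 - e)"
proof -
  obtain y k where yk: "y \<in> chains hom (c - 1) (d - 1)" "k \<in> chains K c d" "z + h v = D y + k"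
    using zv by (rule boundariesE)
  obtain j x where jx: "j \<in> chains J c d" "x \<in> chains hom c (d - e)" "k = j + (\<lambda>S. f * x S)"
    using yk(2) by (rule chains_ideal_insertE)
  have v': "v \<in> chains hom (c + 1) (d + 1 - e)" "D v \<in> chains J (c + 1 + 1) (d + 1 - e + 1)"
    using v by (auto simp: cycles_def)
  have "D z + ((\<lambda>S. f * v S) - h (D v)) = D j + (\<lambda>S. f * D x S)"
    using arg_cong[OF yk(3), of D] D_D D_h[OF v'(1)] jx(3) by (simp add: D_add D_mult)
  then have "(\<lambda>S. f * (v - D x) S) = D j - D z + h (D v)"
    by (auto simp: fun_eq_iff algebra_simps)
  also have "\<dots> \<in> chains J (c + 1) (e + (d + 1 - e))"
    using D_chains[OF J jx(1)] z h_chains[OF J v'(2), of "d + 1" "c + 1"]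
    by (intro chains_add chains_diff J) (auto simp: cycles_def)
  finally have "(\<lambda>S. f * (v - D x) S) \<in> chains J (c + 1) (e + (d + 1 - e))" .
  moreover have Dx: "D x \<in> chains hom (c + 1) (d + 1 - e)"
    using D_chains[OF graded_ideal_hom jx(2)] by (simp add: algebra_simps)
  ultimately have vx: "v - D x \<in> chains J (c + 1) (d + 1 - e)"
    using chains_nonzerodivisor[OF nzd chains_diff[OF graded_ideal_hom v'(1) Dx]] by blast
  then show "v \<in> boundaries J (c + 1) (d + 1 - e)"
    using jx(2) by (intro boundariesI[of x _ _ "v - D x"]) (auto simp: algebra_simps)
  have "h x \<in> chains hom (c - 1) (d - 1)" by (rule h_chains[OF graded_ideal_hom jx(2)]) simp_all
  then have "y + h x \<in> chains hom (c - 1) (d - 1)" using yk(1) by (intro chains_add graded_ideal_hom)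
  moreover have "h (v - D x) \<in> chains J c d" by (rule h_chains[OF J vx]) simp_all
  then have "j - h (v - D x) \<in> chains J c d" using jx(1) by (intro chains_diff J)
  moreover have "z = D (y + h x) + (j - h (v - D x))"
    using yk(3) jx(3) D_h[OF jx(2)] by (simp add: D_add wedge_sum_diff algebra_simps)
  ultimately show "z \<in> boundaries J c d" by (rule boundariesI)
qed

text \<open>The short exact sequence \<open>0 \<rightarrow> H\<^sub>c(J) \<rightarrow> H\<^sub>c(K) \<rightarrow> H\<^sub>c\<^sub>+\<^sub>1(J) \<rightarrow> 0\<close>, with \<open>h\<close> as a section of the second
  map.  The subspace \<open>X\<close> consists of the representatives of classes in the image of \<open>H\<^sub>c(J)\<close>.\<close>

lemma hdim_ideal_insert_combination: "hdim K c d = hdim J c d + hdim J (c + 1) (d + 1 - e)"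
proof -
  interpret cc: quotient_space_pair cscale cscale by unfold_locales
  define X where "X = {z + y | z y. z \<in> cycles J c d \<and> y \<in> boundaries K c d}"
  have BX: "boundaries K c d \<subseteq> X"
  proof
    fix y assume "y \<in> boundaries K c d"
    then show "y \<in> X"
      unfolding X_def using chain.subspace_0[OF subspace_cycles[OF J, of c d]] by (intro CollectI exI[of _ 0] exI[of _ y]) auto
  qed
  have XC: "X \<subseteq> cycles K c d"
    using cycles_J_subset_K boundaries_subset_cycles[OF K] chain.subspace_add[OF subspace_cycles[OF K]]
    unfolding X_def by blast
  have JX: "cycles J c d \<subseteq> X"
  proof
    fix z assume "z \<in> cycles J c d"
    then show "z \<in> X"
      unfolding X_def using chain.subspace_0[OF subspace_boundaries[OF K, of c d]]
      by (intro CollectI exI[of _ z] exI[of _ 0]) auto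
  qed
  have X: "chain.subspace X" unfolding X_def
    by (rule chain.subspace_sums[OF subspace_cycles[OF J] subspace_boundaries[OF K]])
  have finX: "chain.finitely_spanned X"
    by (rule chain.finitely_spanned_subset[OF finitely_spanned_cycles XC])
  have 1: "chain.codim X (boundaries K c d) = hdim J c d"
    unfolding hdim_def
  proof (rule cc.codim_eqI[of id])
    show "Vector_Spaces.linear cscale cscale id" by unfold_locales auto
    show "\<exists>v\<in>cycles J c d. x - id v \<in> boundaries K c d" if x: "x \<in> X" for x
    proof -
      obtain z y where "z \<in> cycles J c d" "y \<in> boundaries K c d" "x = z + y"
        using x by (auto simp: X_def)
      then show ?thesis by (intro bexI[of _ z]) auto
    qed
    show "id z \<in> boundaries K c d \<longleftrightarrow> z \<in> boundaries J c d" if z: "z \<in> cycles J c d" for z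
    proof
      assume "id z \<in> boundaries K c d"
      moreover have "h 0 = 0" using wedge_sum_diff[of b 0 0] by simp
      ultimately show "z \<in> boundaries J c d"
        using z chain.subspace_0[OF subspace_cycles[OF J]] by (intro split_boundaries(1)[of z c d 0]) auto
    qed (use boundaries_J_subset_K in auto)
    show "id z \<in> X" if "z \<in> cycles J c d" for z using that JX by auto
  qed (rule finitely_spanned_cycles subspace_cycles[OF J] subspace_boundaries[OF J]
      boundaries_subset_cycles[OF J] finX X subspace_boundaries[OF K] BX)+
  have 2: "chain.codim (cycles K c d) X = hdim J (c + 1) (d + 1 - e)"
    unfolding hdim_def
  proof (rule cc.codim_eqI[OF linear_wedge_sum[of b]])
    show "h v \<in> cycles K c d" if "v \<in> cycles J (c + 1) (d + 1 - e)" for v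
      using that by (rule h_cycles)
    show "\<exists>v\<in>cycles J (c + 1) (d + 1 - e). u - h v \<in> X" if u: "u \<in> cycles K c d" for u
    proof -
      obtain v where "v \<in> cycles J (c + 1) (d + 1 - e)" "u - h v \<in> cycles J c d"
        using u by (rule cycles_K)
      then show ?thesis using JX by blast
    qed
    show "h v \<in> X \<longleftrightarrow> v \<in> boundaries J (c + 1) (d + 1 - e)" if v: "v \<in> cycles J (c + 1) (d + 1 - e)" for v
    proof
      assume "h v \<in> X"
      then obtain z y where zy: "z \<in> cycles J c d" "y \<in> boundaries K c d" "h v = z + y"
        by (auto simp: X_def)
      have "- z \<in> cycles J c d" using zy(1) by (rule chain.subspace_neg[OF subspace_cycles[OF J]])
      moreover have "- z + h v \<in> boundaries K c d" using zy by simp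
      ultimately show "v \<in> boundaries J (c + 1) (d + 1 - e)" using split_boundaries(2) v by blast
    next
      assume "v \<in> boundaries J (c + 1) (d + 1 - e)"
      then show "h v \<in> X" using h_boundaries BX by blast
    qed
  qed (rule finitely_spanned_cycles subspace_cycles[OF J] subspace_boundaries[OF J]
      boundaries_subset_cycles[OF J] subspace_cycles[OF K] X XC)+
  show ?thesis
    using chain.codim_trans[OF finitely_spanned_cycles BX XC] 1 2 by (simp add: hdim_def)
qed

end

text \<open>Coefficients are independent of each other; split them off one at a time.\<close>

lemma codim_chains_on:
  assumes J: "graded_ideal J" and "finite A"
  shows "chain.codim (chains_on hom A d) (chains_on J A d)
    = (\<Sum>S\<in>A. poly.codim (hom (d - sum w S)) (J (d - sum w S)))"
  using assms(2)
proof (induction A rule: finite_induct)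
  case empty
  have "chains_on hom {} d = chains_on J {} d" by (auto simp: chains_on_def)
  then show ?case by simp
next
  case (insert S A)
  interpret pc: quotient_space_pair pscale cscale by unfold_locales
  interpret cc: quotient_space_pair cscale cscale by unfold_locales
  let ?U = "chains_on hom (insert S A) d"
  define X where "X = {z \<in> ?U. z S \<in> J (d - sum w S)}"
  have U: "chain.subspace ?U" "chain.finitely_spanned ?U"
    using insert.hyps by (auto intro: subspace_chains_on graded_ideal_hom finitely_spanned_chains)
  have X: "chain.subspace X" "X \<subseteq> ?U" unfolding X_def
    by (rule chain.subspaceI)
      (auto simp: ideal_0 ideal_add poly.subspace_scale[OF subspace_ideal] J
        chain.subspace_0[OF U(1)] chain.subspace_add[OF U(1)] chain.subspace_scale[OF U(1)])
  have JX: "chains_on J (insert S A) d \<subseteq> X"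
    using chains_hom[OF J] chains_onD unfolding X_def by blast
  have finX: "chain.finitely_spanned X" using chain.finitely_spanned_subset[OF U(2) X(2)] .
  have 1: "chain.codim ?U X = poly.codim (hom (d - sum w S)) (J (d - sum w S))"
  proof (rule pc.codim_eqI[of "\<lambda>p S'. if S' = S then p else 0"])
    show "Vector_Spaces.linear pscale cscale (\<lambda>p S'. if S' = S then p else 0)"
      by unfold_locales (auto simp: fun_eq_iff)
    show "(\<lambda>S'. if S' = S then p else 0) \<in> ?U" if "p \<in> hom (d - sum w S)" for p
      using that by (auto simp: chains_on_def)
    then show "\<exists>p\<in>hom (d - sum w S). z - (\<lambda>S'. if S' = S then p else 0) \<in> X" if "z \<in> ?U" for z
      using that chains_onD[OF that, of S] chain.subspace_diff[OF U(1)] ideal_0[OF J]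
      by (intro bexI[of _ "z S"]) (auto simp: X_def)
    show "(\<lambda>S'. if S' = S then p else 0) \<in> X \<longleftrightarrow> p \<in> J (d - sum w S)" if "p \<in> hom (d - sum w S)" for p
      using that by (auto simp: X_def chains_on_def)
    show "J (d - sum w S) \<subseteq> hom (d - sum w S)" using ideal_hom[OF J] by blast
  qed (rule finitely_spanned_hom subspace_hom subspace_ideal[OF J] U X)+
  have 2: "chain.codim X (chains_on J (insert S A) d) = chain.codim (chains_on hom A d) (chains_on J A d)"
  proof (rule cc.codim_eqI[of id])
    show "Vector_Spaces.linear cscale cscale id" by unfold_locales auto
    show "id z \<in> X" if "z \<in> chains_on hom A d" for z
      using that insert.hyps ideal_0[OF J] by (auto simp: X_def chains_on_def split: if_splits)
    show "\<exists>v\<in>chains_on hom A d. z - id v \<in> chains_on J (insert S A) d" if "z \<in> X" for z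
      using that insert.hyps ideal_0[OF J]
      by (intro bexI[of _ "\<lambda>S'. if S' = S then 0 else z S'"]) (auto simp: X_def chains_on_def split: if_splits)
    show "id z \<in> chains_on J (insert S A) d \<longleftrightarrow> z \<in> chains_on J A d" if "z \<in> chains_on hom A d" for z
      using that insert.hyps ideal_0[OF J] by (auto simp: chains_on_def split: if_splits)
    show "chains_on J A d \<subseteq> chains_on hom A d" using chains_hom[OF J] by blast
  qed (rule finitely_spanned_chains insert.hyps(1) subspace_chains_on[OF graded_ideal_hom]
      subspace_chains_on[OF J] finX X JX)+
  show ?case
    using chain.codim_trans[OF U(2) JX X(2)] 1 2 insert by simp
qed

text \<open>If all \<open>a\<^sub>i\<close> are zero in \<open>S/J\<close>, the differential vanishes and the homology is the whole complex.\<close>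

lemma hdim_trivial_differential:
  assumes J: "graded_ideal J" and a: "\<And>i. i \<in> {1..n} \<Longrightarrow> a i \<in> J (w i + 1)"
  shows "hdim J c d = (\<Sum>S\<in>koszul_index n c. poly.codim (hom (d - sum w S)) (J (d - sum w S)))"
proof -
  have D: "D z \<in> chains J (c + 1) (d + 1)" if z: "z \<in> chains hom c d" for z c d
  proof (rule chains_onI)
    fix T assume T: "T \<in> koszul_index n (c + 1)"
    then have T': "T \<subseteq> {1..n}" "finite T" using koszul_indexD by blast+
    have "koszul_sign i T * (a i * z (insert i T)) \<in> J (d + 1 - sum w T)" if i: "i \<in> {1..n} - T" for i
    proof -
      have "insert i T \<in> koszul_index n c" using insert_koszul_index[OF T'(1) i] T by blast
      then have "z (insert i T) \<in> hom (d - sum w (insert i T))" by (rule chains_onD[OF z])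
      then have "z (insert i T) * a i \<in> J (d + 1 - sum w T)"
        using T' i a[of i] by (intro ideal_mult'[OF J, of _ "d - sum w (insert i T)" _ "w i + 1"]) auto
      then have "a i * z (insert i T) \<in> J (d + 1 - sum w T)" by (simp add: mult.commute)
      then show ?thesis by (rule sign_mult[OF J])
    qed
    then have "(\<Sum>i\<in>{1..n} - T. koszul_sign i T * (a i * z (insert i T))) \<in> J (d + 1 - sum w T)"
      by (rule ideal_sum[OF J])
    then show "D z T \<in> J (d + 1 - sum w T)" using T' by (simp add: D_def)
  next
    show "D z T = 0" if "T \<notin> koszul_index n (c + 1)" for T
      using D_chains[OF graded_ideal_hom z] that by (rule chains_on_outside)
  qed
  have "cycles J c d = chains hom c d" using D by (auto simp: cycles_def)
  moreover have "boundaries J c d = chains J c d"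
  proof
    show "boundaries J c d \<subseteq> chains J c d"
    proof
      fix z assume "z \<in> boundaries J c d"
      then obtain y j where z: "y \<in> chains hom (c - 1) (d - 1)" "j \<in> chains J c d" "z = D y + j"
        by (rule boundariesE)
      then show "z \<in> chains J c d" using D[OF z(1)] chains_add[OF J] by simp
    qed
    show "chains J c d \<subseteq> boundaries J c d"
      using chains_0[OF graded_ideal_hom] by (auto intro!: boundariesI[of 0])
  qed
  ultimately show ?thesis
    using codim_chains_on[OF J finite_koszul_index] by (simp add: hdim_def)
qed

end

section \<open>The homology series\<close>

lemma fls_X_power_times_nth: "fls_nth (fls_X ^ m * F) d = fls_nth F (d - int m)"
  for F :: "int fls"
  by (simp add: fls_X_power_times_conv_shift)

lemma fls_const_sum: "fls_const (\<Sum>x\<in>A. f x) = (\<Sum>x\<in>A. fls_const (f x))"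
  by (induction A rule: infinite_finite_induct) (simp_all flip: fls_plus_const)

lemma fls_const_prod: "fls_const (\<Prod>x\<in>A. f x) = (\<Prod>x\<in>A. fls_const (f x :: 'b :: comm_ring_1))"
  by (induction A rule: infinite_finite_induct) (simp_all flip: fls_const_mult_const)

definition series :: "(int \<Rightarrow> nat) \<Rightarrow> int fls" where
  "series f = Abs_fls (\<lambda>d. int (f d))"

lemma series_nth: "(\<And>d. d < 0 \<Longrightarrow> f d = 0) \<Longrightarrow> fls_nth (series f) d = int (f d)"
  unfolding series_def by (rule nth_Abs_fls_lower_bound[of 0]) simp

abbreviation koszul_factor :: "nat \<Rightarrow> int fls fls" where
  "koszul_factor m \<equiv> 1 - fls_X_inv * fls_const (fls_X ^ m)"

lemma koszul_factor_nonzero: "koszul_factor m \<noteq> 0"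
proof
  assume "koszul_factor m = 0"
  moreover have "fls_nth (koszul_factor m) 0 = 1"
    by (simp add: fls_X_inv_times_conv_shift)
  ultimately show False by simp
qed

lemma sum_by_card:
  fixes g :: "nat \<Rightarrow> 'b::comm_ring_1"
  shows "(\<Sum>i=0..n. \<Sum>S | S \<subseteq> {1..n} \<and> card S = i. \<Prod>j\<in>S. g j) = (\<Prod>j=1..n. 1 + g j)"
proof -
  have "(\<Sum>i=0..n. \<Sum>S | S \<subseteq> {1..n} \<and> card S = i. \<Prod>j\<in>S. g j)
      = (\<Sum>i\<in>{0..n}. sum (\<lambda>S. \<Prod>j\<in>S. g j) {S. S \<in> Pow {1..n} \<and> card S = i})"
    by (simp add: Pow_def)
  also have "\<dots> = (\<Sum>S\<in>Pow {1..n}. \<Prod>j\<in>S. g j)"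
    by (rule sum.group) (use card_mono[of "{1..n}"] in \<open>auto simp: image_subset_iff\<close>)
  also have "\<dots> = (\<Prod>j\<in>{1..n}. g j + 1)"
    by (simp add: prod_add)
  finally show ?thesis by (simp add: add.commute)
qed

context koszul
begin

lemma hdim_eq_0:
  assumes J: "graded_ideal J" and zero: "chains hom c d = {0}"
  shows "hdim J c d = 0"
proof -
  have "boundaries J c d \<subseteq> cycles J c d" by (rule boundaries_subset_cycles[OF J])
  moreover have "cycles J c d \<subseteq> {0}" using zero by (auto simp: cycles_def)
  moreover have "0 \<in> boundaries J c d" by (rule chain.subspace_0[OF subspace_boundaries[OF J]])
  ultimately have "cycles J c d = boundaries J c d" by auto
  then show ?thesis by (simp add: hdim_def)
qed

lemma hdim_outside:
  assumes J: "graded_ideal J" and "c > 0 \<or> c < - int n"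
  shows "hdim J c d = 0"
proof (rule hdim_eq_0[OF J])
  have "S \<notin> koszul_index n c" for S
  proof
    assume "S \<in> koszul_index n c"
    then have S: "S \<subseteq> {1..n}" "int (card S) = - c" by (auto simp: koszul_index_def)
    have "card S \<le> n" using card_mono[OF _ S(1)] by simp
    then show False using S(2) assms(2) by auto
  qed
  then have "koszul_index n c = {}" by blast
  then show "chains hom c d = {0}" by (auto simp: chains_on_def)
qed

lemma hdim_negative:
  assumes J: "graded_ideal J" and w: "\<And>i. i \<in> {1..n} \<Longrightarrow> 0 \<le> w i" and d: "d < 0"
  shows "hdim J c d = 0"
proof (rule hdim_eq_0[OF J])
  have "z S = 0" if z: "z \<in> chains hom c d" for z S
  proof (cases "S \<in> koszul_index n c")
    case True
    then have "0 \<le> sum w S" using w koszul_indexD by (intro sum_nonneg) blast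
    then show ?thesis using chains_onD[OF z True] hom_negative d by auto
  next
    case False
    then show ?thesis using chains_on_outside[OF z] by blast
  qed
  then show "chains hom c d = {0}" using chains_0[OF graded_ideal_hom] by (auto simp: fun_eq_iff)
qed

definition homology_series :: "(int \<Rightarrow> mvpoly set) \<Rightarrow> int fls fls" where
  "homology_series J = (\<Sum>i=0..n. (-1) ^ i * fls_X_inv ^ i * fls_const (series (hdim J (- int i))))"

text \<open>The generating series of \<open>hdim_ideal_insert_combination\<close>.  The sum is finite, so the factor
  \<open>1 - t\<^sup>-\<^sup>1 q\<^sup>m\<close> produces one extra term from \<open>H\<^sub>-\<^sub>n(J)\<close>.  That group is zero, because it is a quotient
  of the homology over \<open>J + (f)\<close> in cohomological degree \<open>-n - 1\<close>.\<close>

lemma homology_series_ideal_insert: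
  assumes J: "graded_ideal J" and w: "\<And>i. i \<in> {1..n} \<Longrightarrow> 0 \<le> w i"
    and f: "f \<in> hom (int m + 1)" and nzd: "nonzerodivisor J f (int m + 1)"
    and b: "\<And>i. i \<in> {1..n} \<Longrightarrow> b i \<in> hom (int m - w i)"
    and f_eq: "f - (\<Sum>i\<in>{1..n}. b i * a i) \<in> J (int m + 1)"
  shows "homology_series (ideal_insert J f (int m + 1)) = homology_series J * koszul_factor m"
proof -
  let ?e = "int m + 1"
  define g where "g = (\<Sum>i\<in>{1..n}. b i * a i)"
  let ?K = "ideal_insert J g ?e"
  have g: "g \<in> hom ?e"
    unfolding g_def
  proof (rule hom_sum)
    fix i assume i: "i \<in> {1..n}"
    show "b i * a i \<in> hom ?e" using hom_mult[OF b[OF i] a_hom[OF i]] by simp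
  qed
  have fg: "f - g \<in> J ?e" using f_eq by (simp add: g_def)
  then have gf: "g - f \<in> J ?e" using ideal_neg[OF J] by fastforce
  have nzdg: "nonzerodivisor J g ?e" by (rule nonzerodivisor_cong[OF J gf nzd])
  have K: "graded_ideal ?K" by (rule graded_ideal_insert[OF J g])
  have eq: "ideal_insert J f ?e = ?K" by (rule ideal_insert_cong[OF J fg])
  have b': "b i \<in> hom (?e - w i - 1)" if "i \<in> {1..n}" for i using b[OF that] by simp
  have rec: "hdim ?K c d = hdim J c d + hdim J (c + 1) (d - int m)" for c d
    using hdim_ideal_insert_combination[OF J g nzdg b' g_def] by (simp add: algebra_simps)
  \<comment> \<open>There are no chains in cohomological degree \<open>- n - 1\<close>, so both summands vanish there.\<close>
  have top: "hdim J (- int n) d = 0" for d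
    using rec[of "- int n - 1" "d + int m"] hdim_outside[OF K, of "- int n - 1"] by simp
  define A where "A i = series (hdim J (- int i))" for i
  define B where "B i = series (hdim ?K (- int i))" for i
  note neg = hdim_negative[OF J w] hdim_negative[OF K w]
  have A_nth: "fls_nth (A i) d = int (hdim J (- int i) d)" and B_nth: "fls_nth (B i) d = int (hdim ?K (- int i) d)" for i d
    unfolding A_def B_def by (rule series_nth; use neg in blast)+
  have B0: "B 0 = A 0"
    using hdim_outside[OF J, of 1] by (simp add: fls_eq_iff A_nth B_nth rec)
  have BS: "B (Suc i) = A (Suc i) + fls_X ^ m * A i" for i
    by (simp add: fls_eq_iff A_nth B_nth rec fls_X_power_times_nth)
  have An: "A n = 0"
    by (simp add: fls_eq_iff A_nth top)
  let ?t = "fls_X_inv :: int fls fls" and ?q = "fls_const (fls_X ^ m) :: int fls fls"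
  \<comment> \<open>The last summand is what is left over when the sum is cut off at \<open>N\<close>.\<close>
  have *: "(\<Sum>i=0..N. (-1) ^ i * ?t ^ i * fls_const (B i))
    = (\<Sum>i=0..N. (-1) ^ i * ?t ^ i * fls_const (A i)) * koszul_factor m
      + (-1) ^ N * ?t ^ N * fls_const (A N) * (?t * ?q)" for N
  proof (induction N)
    case 0
    then show ?case by (simp add: B0 algebra_simps)
  next
    case (Suc N)
    have "fls_const (B (Suc N)) = fls_const (A (Suc N)) + ?q * fls_const (A N)"
      by (simp add: BS flip: fls_plus_const)
    then show ?case using Suc by (simp add: algebra_simps)
  qed
  show ?thesis
    unfolding eq homology_series_def A_def[symmetric] B_def[symmetric] using *[of n] An by simp
qed

text \<open>Expanding the product gives the sum over all basis elements \<open>e\<^sub>S\<close>.\<close>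

lemma homology_series_trivial:
  assumes J: "graded_ideal J" and a: "\<And>i. i \<in> {1..n} \<Longrightarrow> a i \<in> J (w i + 1)"
    and w: "\<And>i. i \<in> {1..n} \<Longrightarrow> w i = int (m i)"
  shows "homology_series J = fls_const (series (\<lambda>d. poly.codim (hom d) (J d))) * (\<Prod>i=1..n. koszul_factor (m i))"
proof -
  let ?\<rho> = "\<lambda>d. poly.codim (hom d) (J d)"
  let ?t = "fls_X_inv :: int fls fls"
  have \<rho>_neg: "?\<rho> d = 0" if "d < 0" for d
  proof -
    have "hom d = {0}" using hom_negative that by auto
    moreover have "J d = {0}" using calculation ideal_hom[OF J, of _ d] ideal_0[OF J, of d] by auto
    ultimately show ?thesis by simp
  qed
  have "fls_const (series (hdim J (- int i)))
      = fls_const (series ?\<rho>) * (\<Sum>S | S \<subseteq> {1..n} \<and> card S = i. \<Prod>j\<in>S. fls_const (fls_X ^ m j))" for i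
  proof -
    have idx: "koszul_index n (- int i) = {S. S \<subseteq> {1..n} \<and> card S = i}"
      by (auto simp: koszul_index_def)
    have sw: "sum w S = int (\<Sum>j\<in>S. m j)" if "S \<subseteq> {1..n}" for S
      unfolding of_nat_sum using that by (auto intro!: sum.cong w)
    have "series (hdim J (- int i)) = (\<Sum>S | S \<subseteq> {1..n} \<and> card S = i. fls_X ^ (\<Sum>j\<in>S. m j) * series ?\<rho>)"
    proof (rule fls_eqI)
      fix d
      have "fls_nth (series (hdim J (- int i))) d = int (hdim J (- int i) d)"
        using hdim_negative[OF J] w by (intro series_nth) simp
      also have "\<dots> = (\<Sum>S | S \<subseteq> {1..n} \<and> card S = i. int (?\<rho> (d - sum w S)))"
      proof -
        have "hdim J (- int i) d = (\<Sum>S\<in>koszul_index n (- int i). ?\<rho> (d - sum w S))"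
          by (rule hdim_trivial_differential[OF J]) (use a in blast)
        then show ?thesis unfolding idx by simp
      qed
      also have "\<dots> = (\<Sum>S | S \<subseteq> {1..n} \<and> card S = i. fls_nth (fls_X ^ (\<Sum>j\<in>S. m j) * series ?\<rho>) d)"
        using sw by (intro sum.cong) (auto simp: fls_X_power_times_nth series_nth[OF \<rho>_neg])
      finally show "fls_nth (series (hdim J (- int i))) d
        = fls_nth (\<Sum>S | S \<subseteq> {1..n} \<and> card S = i. fls_X ^ (\<Sum>j\<in>S. m j) * series ?\<rho>) d"
        by (simp add: fls_nth_sum)
    qed
    then show ?thesis
      by (simp add: fls_const_sum power_sum fls_const_prod sum_distrib_left mult.commute
          flip: fls_const_mult_const)
  qed
  then have "homology_series J = fls_const (series ?\<rho>)
      * (\<Sum>i=0..n. \<Sum>S | S \<subseteq> {1..n} \<and> card S = i. (-1) ^ i * ?t ^ i * (\<Prod>j\<in>S. fls_const (fls_X ^ m j)))"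
    by (simp add: homology_series_def sum_distrib_left algebra_simps)
  also have "(\<Sum>i=0..n. \<Sum>S | S \<subseteq> {1..n} \<and> card S = i. (-1) ^ i * ?t ^ i * (\<Prod>j\<in>S. fls_const (fls_X ^ m j)))
      = (\<Sum>i=0..n. \<Sum>S | S \<subseteq> {1..n} \<and> card S = i. \<Prod>j\<in>S. - (?t * fls_const (fls_X ^ m j)))"
    by (intro sum.cong refl) (auto simp: prod_uminus prod.distrib)
  also have "\<dots> = (\<Prod>i=1..n. koszul_factor (m i))"
    by (subst sum_by_card) simp
  finally show ?thesis .
qed

end

lemma upt_append_conv: "a \<le> b \<Longrightarrow> b \<le> c \<Longrightarrow> [a..<c] = [a..<b] @ [b..<c]"
  using upt_add_eq_append[of a b "c - b"] by simp

context relation_ring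
begin

sublocale koszul "P_vars k l" l u "\<lambda>i. 2 * int i - 1"
  by unfold_locales (use u_hom in simp)

definition rel_ideal :: "nat \<Rightarrow> int \<Rightarrow> mvpoly set" where
  "rel_ideal m = ideal_gen (var_ideal {}) (rels 1 (Suc m))"

lemma graded_ideal_rel_ideal: "graded_ideal (rel_ideal m)"
  unfolding rel_ideal_def using hom_seq_rels[of 0] by (intro graded_ideal_gen graded_ideal_var_ideal) simp

lemma graded_ideal_rel_ideal_us: "graded_ideal (ideal_gen (rel_ideal m) (us 1 (Suc j)))"
  using hom_seq_us[of 0] by (intro graded_ideal_gen graded_ideal_rel_ideal) simp

text \<open>Each \<open>u\<^sub>j\<close> is trivially in the ideal of all of them, so the comparison applies to adding one more.\<close>

lemma homology_series_us:
  assumes "j \<le> l"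
  shows "homology_series (ideal_gen (rel_ideal k) (us 1 (Suc j)))
    = homology_series (rel_ideal k) * (\<Prod>i=1..j. koszul_factor (2 * i - 1))"
  using assms
proof (induction j)
  case 0
  then show ?case by (simp add: us_def)
next
  case (Suc j)
  let ?J = "ideal_gen (rel_ideal k) (us 1 (Suc j))"
  have m: "int (2 * Suc j - 1) + 1 = 2 * int (Suc j)" by simp
  have snoc: "us 1 (Suc l) = us 1 (Suc j) @ us (Suc j) (Suc l)"
    using Suc.prems upt_append_conv[of 1 "Suc j" "Suc l"] unfolding us_def map_append[symmetric] by simp
  have cons: "us (Suc j) (Suc l) = (u (Suc j), 2 * int (Suc j)) # us (Suc (Suc j)) (Suc l)"
    using Suc.prems by (simp add: us_def upt_conv_Cons del: upt_Suc)
  have nzd: "nonzerodivisor ?J (u (Suc j)) (2 * int (Suc j))"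
  proof -
    have "regular (var_ideal {}) ((rels 1 (Suc k) @ us 1 (Suc j)) @ (u (Suc j), 2 * int (Suc j)) # us (Suc (Suc j)) (Suc l))"
      using regular_rels_us by (simp only: snoc cons append_assoc)
    then show ?thesis by (simp only: regular_append ideal_gen_append rel_ideal_def regular.simps)
  qed
  have eq: "ideal_gen (rel_ideal k) (us 1 (Suc (Suc j))) = ideal_insert ?J (u (Suc j)) (2 * int (Suc j))"
    by (simp add: us_snoc ideal_gen_append)
  have step: "homology_series (ideal_insert ?J (u (Suc j)) (2 * int (Suc j))) = homology_series ?J * koszul_factor (2 * Suc j - 1)"
    unfolding m[symmetric]
  proof (rule homology_series_ideal_insert[OF graded_ideal_rel_ideal_us])
    show "u (Suc j) - (\<Sum>i\<in>{1..l}. (if i = Suc j then 1 else 0) * u i) \<in> ?J (int (2 * Suc j - 1) + 1)"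
    proof -
      have "(\<Sum>i\<in>{1..l}. (if i = Suc j then 1 else 0) * u i) = (\<Sum>i\<in>{Suc j}. u i)"
        using Suc.prems by (intro sum.mono_neutral_cong_right) auto
      then show ?thesis using ideal_0[OF graded_ideal_rel_ideal_us] by simp
    qed
    show "(if i = Suc j then 1 else 0) \<in> hom (int (2 * Suc j - 1) - (2 * int i - 1))" for i
      using hom_1 by simp
  qed (use nzd u_hom[of "Suc j"] m in auto)
  show ?case unfolding eq step using Suc by (simp add: mult.assoc)
qed

text \<open>Compare \<open>homology_series_us\<close> for all \<open>u\<^sub>i\<close>, where the differential vanishes, and cancel the product.\<close>

lemma homology_series_rel_ideal_k:
  "homology_series (rel_ideal k) = fls_const (series (\<lambda>d. poly.codim (mvpoly_grading (R'_vars k l) d) {0}))"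
proof -
  let ?J = "ideal_gen (rel_ideal k) (us 1 (Suc l))"
  have J: "?J = ideal_gen (var_ideal {}) (rels 1 (Suc k) @ us 1 (Suc l))"
    by (simp add: rel_ideal_def ideal_gen_append)
  have u: "u i \<in> ?J (2 * int i - 1 + 1)" if "i \<in> {1..l}" for i
  proof -
    have "(u i, 2 * int i) \<in> set (us 1 (Suc l))"
      using that by (auto simp: us_def simp del: upt_Suc)
    then have "u i \<in> ?J (2 * int i)"
      using hom_seq_us[of 0] by (intro ideal_gen_member graded_ideal_rel_ideal) auto
    then show ?thesis by simp
  qed
  have "homology_series ?J = fls_const (series (\<lambda>d. poly.codim (hom d) (?J d))) * (\<Prod>i=1..l. koszul_factor (2 * i - 1))"
    by (rule homology_series_trivial[OF graded_ideal_rel_ideal_us u]) auto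
  also have "(\<lambda>d. poly.codim (hom d) (?J d)) = (\<lambda>d. poly.codim (mvpoly_grading (R'_vars k l) d) {0})"
    unfolding J codim_rels_us codim_R' ..
  finally have "homology_series ?J = fls_const (series (\<lambda>d. poly.codim (mvpoly_grading (R'_vars k l) d) {0})) * (\<Prod>i=1..l. koszul_factor (2 * i - 1))" .
  then have "homology_series (rel_ideal k) * (\<Prod>i=1..l. koszul_factor (2 * i - 1))
    = fls_const (series (\<lambda>d. poly.codim (mvpoly_grading (R'_vars k l) d) {0})) * (\<Prod>i=1..l. koszul_factor (2 * i - 1))"
    using homology_series_us[OF order_refl] by (simp only:)
  moreover have "(\<Prod>i=1..l. koszul_factor (2 * i - 1)) \<noteq> 0"
    unfolding prod_zero_iff[OF finite_atLeastAtMost] using koszul_factor_nonzero by blast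
  ultimately show ?thesis using mult_right_cancel by blast
qed

text \<open>Elements of \<open>J + (u\<^sub>1, \<dots>, u\<^sub>j)\<close> are combinations of the \<open>u\<^sub>i\<close> up to \<open>J\<close>, with homogeneous
  coefficients.\<close>

lemma us_combination:
  assumes J: "graded_ideal J" and "p \<in> ideal_gen J (us 1 (Suc j)) d"
  obtains b where "\<And>i. i \<in> {1..j} \<Longrightarrow> b i \<in> hom (d - 2 * int i)" "p - (\<Sum>i\<in>{1..j}. b i * u i) \<in> J d"
  using assms(2)
proof (induction j arbitrary: p thesis)
  case 0
  show ?case by (rule 0(1)) (use 0(2) in \<open>auto simp: us_def\<close>)
next
  case (Suc j)
  from Suc.prems(2) have "p \<in> ideal_insert (ideal_gen J (us 1 (Suc j))) (u (Suc j)) (2 * int (Suc j)) d"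
    by (simp add: us_snoc ideal_gen_append)
  then obtain p' c where p: "p' \<in> ideal_gen J (us 1 (Suc j)) d" "c \<in> hom (d - 2 * int (Suc j))" "p = p' + u (Suc j) * c"
    by (rule ideal_insertE)
  obtain b where b: "\<And>i. i \<in> {1..j} \<Longrightarrow> b i \<in> hom (d - 2 * int i)" "p' - (\<Sum>i\<in>{1..j}. b i * u i) \<in> J d"
    using Suc.IH[OF _ p(1)] by blast
  show ?case
  proof (rule Suc.prems(1)[of "b(Suc j := c)"])
    show "(b(Suc j := c)) i \<in> hom (d - 2 * int i)" if "i \<in> {1..Suc j}" for i
      using b(1)[of i] p(2) that by (cases "i = Suc j") auto
    have "(\<Sum>i\<in>{1..Suc j}. (b(Suc j := c)) i * u i) = c * u (Suc j) + (\<Sum>i\<in>{1..j}. b i * u i)"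
      by (simp add: add.commute)
    then show "p - (\<Sum>i\<in>{1..Suc j}. (b(Suc j := c)) i * u i) \<in> J d"
      using b(2) p(3) by (simp add: algebra_simps)
  qed
qed

text \<open>By \<open>r_in_ideal\<close> the next relation is a combination of the \<open>u\<^sub>i\<close> modulo the previous ones.\<close>

lemma homology_series_rel_ideal:
  assumes "j \<le> l"
  shows "homology_series (rel_ideal (k + j))
    = homology_series (rel_ideal k) * (\<Prod>i=1..j. koszul_factor (2 * k + 2 * i - 1))"
  using assms
proof (induction j)
  case 0
  then show ?case by simp
next
  case (Suc j)
  let ?J = "rel_ideal (k + j)" and ?s = "Suc (k + j)"
  let ?Q = "ideal_gen ?J (us 1 (Suc l))"
  have m: "int (2 * ?s - 1) + 1 = 2 * int ?s" by simp
  have snoc: "rels 1 (Suc (k + l)) = rels 1 ?s @ rels ?s (Suc (k + l))"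
    using Suc.prems upt_append_conv[of 1 ?s "Suc (k + l)"] unfolding rels_def map_append[symmetric] by simp
  have cons: "rels ?s (Suc (k + l)) = (r ?s, 2 * int ?s) # rels (Suc ?s) (Suc (k + l))"
    using Suc.prems by (simp add: rels_def upt_conv_Cons del: upt_Suc)
  have nzd: "nonzerodivisor ?J (r ?s) (2 * int ?s)"
  proof -
    have "regular (var_ideal {}) (rels 1 ?s @ (r ?s, 2 * int ?s) # rels (Suc ?s) (Suc (k + l)))"
      using regular_rels by (simp only: snoc cons)
    then show ?thesis by (simp only: regular_append rel_ideal_def regular.simps)
  qed
  have "r ?s \<in> ?Q (2 * int ?s)"
  proof (rule r_in_ideal[OF graded_ideal_rel_ideal_us])
    fix i assume i: "i \<in> {1..k}"
    have "r i \<in> ?J (2 * int i)"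
      unfolding rel_ideal_def using hom_seq_rels[of 0] i
      by (intro ideal_gen_member graded_ideal_var_ideal) (auto simp: rels_def simp del: upt_Suc)
    then show "r i \<in> ?Q (2 * int i)" by (rule ideal_gen_superset)
  next
    fix i assume i: "i \<in> {1..l}"
    show "u i \<in> ?Q (2 * int i)"
      using hom_seq_us[of 0] i
      by (intro ideal_gen_member graded_ideal_rel_ideal) (auto simp: us_def simp del: upt_Suc)
  qed
  then obtain b where b: "\<And>i. i \<in> {1..l} \<Longrightarrow> b i \<in> hom (2 * int ?s - 2 * int i)"
    "r ?s - (\<Sum>i\<in>{1..l}. b i * u i) \<in> ?J (2 * int ?s)"
    using us_combination[OF graded_ideal_rel_ideal] by blast
  have eq: "rel_ideal (k + Suc j) = ideal_insert ?J (r ?s) (2 * int ?s)"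
    by (simp add: rel_ideal_def rels_snoc ideal_gen_append)
  have step: "homology_series (ideal_insert ?J (r ?s) (2 * int ?s)) = homology_series ?J * koszul_factor (2 * ?s - 1)"
    unfolding m[symmetric]
  proof (rule homology_series_ideal_insert[OF graded_ideal_rel_ideal])
    show "b i \<in> hom (int (2 * ?s - 1) - (2 * int i - 1))" if "i \<in> {1..l}" for i
      using b(1)[OF that] by (simp add: algebra_simps)
  qed (use nzd r_hom[of ?s] m b(2) in auto)
  show ?case unfolding eq step using Suc by (simp add: mult.assoc)
qed

theorem homology_series_P:
  "homology_series (rel_ideal (k + l))
    = fls_const (series (\<lambda>d. poly.codim (mvpoly_grading (R'_vars k l) d) {0}))
      * (\<Prod>i=1..l. koszul_factor (2 * k + 2 * i - 1))"
  using homology_series_rel_ideal[of l] homology_series_rel_ideal_k by simp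

end

section \<open>The homology of the complex over P\<close>

definition hom_part :: "int \<Rightarrow> mvpoly \<Rightarrow> mvpoly" where
  "hom_part d p = (\<Sum>m\<in>{m \<in> keys p. int (monom_deg m) = d}. single m (lookup p m))"

lemma lookup_hom_part:
  "lookup (hom_part d p) m = (if int (monom_deg m) = d then lookup p m else 0)"
  unfolding hom_part_def
  by (auto simp: lookup_sum lookup_single when_def sum.delta in_keys_iff)

lemma hom_part_add: "hom_part d (p + q) = hom_part d p + hom_part d q"
  by (rule poly_mapping_eqI) (simp add: lookup_hom_part lookup_add)

lemma hom_part_0 [simp]: "hom_part d 0 = 0"
  by (rule poly_mapping_eqI) (simp add: lookup_hom_part)

lemma hom_part_diff: "hom_part d (p - q) = hom_part d p - hom_part d q"
  by (rule poly_mapping_eqI) (simp add: lookup_hom_part lookup_minus)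

lemma hom_part_sum: "hom_part d (\<Sum>i\<in>A. f i) = (\<Sum>i\<in>A. hom_part d (f i))"
  by (induction A rule: infinite_finite_induct) (simp_all add: hom_part_add)

lemma hom_part_eq_self: "(\<And>m. m \<in> keys p \<Longrightarrow> int (monom_deg m) = d) \<Longrightarrow> hom_part d p = p"
  by (rule poly_mapping_eqI) (auto simp: lookup_hom_part in_keys_iff)

lemma hom_part_eq_0: "(\<And>m. m \<in> keys p \<Longrightarrow> int (monom_deg m) \<noteq> d) \<Longrightarrow> hom_part d p = 0"
  by (rule poly_mapping_eqI) (auto simp: lookup_hom_part in_keys_iff)

lemma keys_hom_part: "keys (hom_part d p) = {m \<in> keys p. int (monom_deg m) = d}"
  by (auto simp: in_keys_iff lookup_hom_part split: if_splits)

lemma hom_part_mult: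
  assumes "\<And>m. m \<in> keys f \<Longrightarrow> int (monom_deg m) = e"
  shows "hom_part d (f * p) = f * hom_part (d - e) p"
proof -
  let ?p = "hom_part (d - e) p"
  have "hom_part d (f * ?p) = f * ?p"
    using keys_mult[of f ?p] assms by (intro hom_part_eq_self) (fastforce simp: keys_hom_part)
  moreover have "hom_part d (f * (p - ?p)) = 0"
  proof (rule hom_part_eq_0)
    fix m assume "m \<in> keys (f * (p - ?p))"
    then obtain a c where m: "m = a + c" "a \<in> keys f" "c \<in> keys (p - ?p)"
      using keys_mult[of f "p - ?p"] by auto
    have "int (monom_deg c) \<noteq> d - e"
      using m(3) by (auto simp: in_keys_iff lookup_minus lookup_hom_part)
    then show "int (monom_deg m) \<noteq> d" using assms[OF m(2)] m(1) by auto
  qed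
  ultimately show ?thesis
    using hom_part_add[of d "f * ?p" "f * (p - ?p)"] by (simp add: algebra_simps)
qed

lemma cring_mvpoly_ring: "cring (mvpoly_ring V)"
proof (rule cringI)
  have [simp]: "p + q \<in> carrier (mvpoly_ring V)" if "p \<in> carrier (mvpoly_ring V)" "q \<in> carrier (mvpoly_ring V)" for p q
    using that keys_add[of p q] by (auto simp: mvpoly_ring_def)
  have [simp]: "p * q \<in> carrier (mvpoly_ring V)" if "p \<in> carrier (mvpoly_ring V)" "q \<in> carrier (mvpoly_ring V)" for p q
    using that keys_mult[of p q] by (fastforce simp: mvpoly_ring_def keys_plus_nat)
  have neg: "- p \<in> carrier (mvpoly_ring V)" if "p \<in> carrier (mvpoly_ring V)" for p
    using that by (auto simp: mvpoly_ring_def in_keys_iff)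
  show "abelian_group (mvpoly_ring V)"
  proof (rule abelian_groupI)
    show "\<exists>q\<in>carrier (mvpoly_ring V). q \<oplus>\<^bsub>mvpoly_ring V\<^esub> p = \<zero>\<^bsub>mvpoly_ring V\<^esub>" if "p \<in> carrier (mvpoly_ring V)" for p
      using neg[OF that] by (intro bexI[of _ "- p"]) (simp add: mvpoly_ring_def)
    fix p q assume "p \<in> carrier (mvpoly_ring V)" "q \<in> carrier (mvpoly_ring V)"
    then have "p + q \<in> carrier (mvpoly_ring V)" by simp
    then show "p \<oplus>\<^bsub>mvpoly_ring V\<^esub> q \<in> carrier (mvpoly_ring V)" by (simp add: mvpoly_ring_def)
  qed (simp_all add: mvpoly_ring_def algebra_simps)
  show "Group.comm_monoid (mvpoly_ring V)"
  proof (rule comm_monoidI)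
    fix p q assume "p \<in> carrier (mvpoly_ring V)" "q \<in> carrier (mvpoly_ring V)"
    then have "p * q \<in> carrier (mvpoly_ring V)" by simp
    then show "p \<otimes>\<^bsub>mvpoly_ring V\<^esub> q \<in> carrier (mvpoly_ring V)" by (simp add: mvpoly_ring_def)
  qed (simp_all add: mvpoly_ring_def algebra_simps)
qed (simp add: mvpoly_ring_def algebra_simps)

context relation_ring
begin

abbreviation "S \<equiv> mvpoly_ring (P_vars k l)"
abbreviation "I \<equiv> P_ideal k l"
abbreviation "J \<equiv> rel_ideal (k + l)"

sublocale S: cring S by (rule cring_mvpoly_ring)

lemma S_simps [simp]:
  "p \<oplus>\<^bsub>S\<^esub> q = p + q" "p \<otimes>\<^bsub>S\<^esub> q = p * q" "\<zero>\<^bsub>S\<^esub> = 0" "c \<odot>\<^bsub>S\<^esub> p = pscale c p"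
  by (simp_all add: mvpoly_ring_def)

lemma S_minus: "p \<in> carrier S \<Longrightarrow> \<ominus>\<^bsub>S\<^esub> p = - p"
  using S.l_neg[of p] by (simp add: eq_neg_iff_add_eq_0)

lemma S_iff: "p \<in> carrier S \<longleftrightarrow> (\<forall>m\<in>keys p. keys m \<subseteq> P_vars k l)"
  by (simp add: mvpoly_ring_def)

lemma hom_S: "p \<in> hom d \<Longrightarrow> p \<in> carrier S"
  by (simp add: hom_iff S_iff)

lemma hom_part_hom: "p \<in> carrier S \<Longrightarrow> hom_part d p \<in> hom d"
  by (auto simp: hom_iff S_iff keys_hom_part)

lemma hom_part_of_hom: "p \<in> hom d \<Longrightarrow> hom_part d p = p"
  by (rule hom_part_eq_self) (auto simp: hom_iff)

lemma hom_part_mult_hom: "f \<in> hom e \<Longrightarrow> hom_part d (f * p) = f * hom_part (d - e) p"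
  by (rule hom_part_mult) (auto simp: hom_iff)

lemma subspace_S: "poly.subspace (carrier S)"
proof (rule poly.subspaceI)
  show "0 \<in> carrier S" using S.zero_closed by simp
  show "p + q \<in> carrier S" if "p \<in> carrier S" "q \<in> carrier S" for p q
    using S.a_closed[OF that] by simp
  show "pscale c p \<in> carrier S" if "p \<in> carrier S" for c p
    using that keys_pscale[of c p] by (auto simp: S_iff)
qed

lemma S_mult: "p \<in> carrier S \<Longrightarrow> q \<in> carrier S \<Longrightarrow> p * q \<in> carrier S"
  using S.m_closed[of p q] by simp

lemma rels_carrier: "r ` {1..k + l} \<subseteq> carrier S"
  using hom_S[OF r_hom] by auto

sublocale I: ideal I S
  unfolding P_ideal_def by (rule S.genideal_ideal[OF rels_carrier])

lemma I_add: "p \<in> I \<Longrightarrow> q \<in> I \<Longrightarrow> p + q \<in> I"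
  using I.a_closed[of p q] by simp

lemma I_mult: "p \<in> I \<Longrightarrow> q \<in> carrier S \<Longrightarrow> q * p \<in> I"
  using I.I_l_closed[of p q] by simp

lemma rel_ideal_subset_I: "m \<le> k + l \<Longrightarrow> p \<in> rel_ideal m d \<Longrightarrow> p \<in> I"
proof (induction m arbitrary: p)
  case 0
  then show ?case using I.zero_closed by (simp add: rel_ideal_def rels_def var_ideal_empty)
next
  case (Suc m)
  from Suc.prems(2) have "p \<in> ideal_insert (rel_ideal m) (r (Suc m)) (2 * int (Suc m)) d"
    by (simp add: rel_ideal_def rels_snoc ideal_gen_append)
  then obtain j b where p: "j \<in> rel_ideal m d" "b \<in> hom (d - 2 * int (Suc m))" "p = j + r (Suc m) * b"
    by (rule ideal_insertE)
  have "r (Suc m) \<in> I"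
    unfolding P_ideal_def using S.genideal_self[OF rels_carrier] Suc.prems(1) by auto
  then have "b * r (Suc m) \<in> I" using hom_S[OF p(2)] by (rule I_mult)
  then show ?case using Suc p I_add[of j "b * r (Suc m)"] by (simp add: mult.commute)
qed

text \<open>The polynomials all of whose homogeneous parts lie in \<open>J\<close> form an ideal containing the relations,
  so they contain \<open>I\<close>.\<close>

lemma hom_part_I:
  assumes "p \<in> I"
  shows "hom_part d p \<in> J d"
proof -
  define Q where "Q = {p \<in> carrier S. \<forall>d. hom_part d p \<in> J d}"
  note J = graded_ideal_rel_ideal[of "k + l"]
  have single: "single m c * p \<in> Q"
    if p: "p \<in> Q" and m: "keys m \<subseteq> P_vars k l" for m c p
  proof -
    have h: "single m c \<in> hom (int (monom_deg m))" using m by (simp add: hom_iff)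
    have "single m c * p \<in> carrier S" using S_mult[OF hom_S[OF h]] p by (simp add: Q_def)
    moreover have "hom_part d (single m c * p) \<in> J d" for d
      unfolding hom_part_mult_hom[OF h]
      by (rule ideal_mult'[OF J h]) (use p in \<open>auto simp: Q_def\<close>)
    ultimately show ?thesis by (simp add: Q_def)
  qed
  have zero: "0 \<in> Q" using S.zero_closed ideal_0[OF J] by (simp add: Q_def)
  have add: "p + q \<in> Q" if "p \<in> Q" "q \<in> Q" for p q
    using that ideal_add[OF J] poly.subspace_add[OF subspace_S] by (simp add: Q_def hom_part_add)
  have sum: "(\<Sum>i\<in>A. f i) \<in> Q" if "\<And>i. i \<in> A \<Longrightarrow> f i \<in> Q" for A :: "(var \<Rightarrow>\<^sub>0 nat) set" and f
    using that by (induction A rule: infinite_finite_induct) (auto simp: zero add)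
  have mult: "x * p \<in> Q" if "p \<in> Q" "x \<in> carrier S" for x p
  proof -
    have "x * p = (\<Sum>m\<in>keys x. single m (lookup x m) * p)"
      by (subst poly_eq_sum_monomials[of x]) (simp add: sum_distrib_right)
    also have "\<dots> \<in> Q" using that by (intro sum single) (auto simp: S_iff)
    finally show ?thesis .
  qed
  have "ideal Q S"
  proof (rule idealI)
    show "ring S" by (rule S.ring_axioms)
    show "subgroup Q (add_monoid S)"
    proof (rule S.add.subgroupI)
      show "Q \<subseteq> carrier S" "Q \<noteq> {}" using zero by (auto simp: Q_def)
      fix p assume p: "p \<in> Q"
      have "(- 1) * p \<in> Q" using p poly.subspace_neg[OF subspace_S S.one_closed]
        by (intro mult) (simp_all add: mvpoly_ring_def)
      then show "\<ominus>\<^bsub>S\<^esub> p \<in> Q" using p by (simp add: S_minus Q_def)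
      show "p \<oplus>\<^bsub>S\<^esub> q \<in> Q" if "q \<in> Q" for q using add[OF p that] by simp
    qed
    show "x \<otimes>\<^bsub>S\<^esub> p \<in> Q" "p \<otimes>\<^bsub>S\<^esub> x \<in> Q" if "p \<in> Q" "x \<in> carrier S" for p x
      using mult[OF that] by (simp_all add: mult.commute)
  qed
  moreover have "r ` {1..k + l} \<subseteq> Q"
  proof (clarify)
    fix i assume i: "i \<in> {1..k + l}"
    have "r i \<in> J (2 * int i)"
      unfolding rel_ideal_def using hom_seq_rels[of 0] i
      by (intro ideal_gen_member graded_ideal_var_ideal) (auto simp: rels_def simp del: upt_Suc)
    moreover have "hom_part d (r i) = (if d = 2 * int i then r i else 0)" for d
    proof (cases "d = 2 * int i")
      case True
      then show ?thesis using hom_part_of_hom[OF r_hom] by simp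
    next
      case False
      then show ?thesis using r_hom[of i] by (auto intro!: hom_part_eq_0 simp: hom_iff)
    qed
    ultimately show "r i \<in> Q" using hom_S[OF r_hom] ideal_0[OF J] by (auto simp: Q_def)
  qed
  ultimately have "I \<subseteq> Q" unfolding P_ideal_def by (rule S.genideal_minimal)
  with assms show ?thesis by (auto simp: Q_def)
qed

lemma I_iff_J: "p \<in> hom d \<Longrightarrow> p \<in> I \<longleftrightarrow> p \<in> J d"
  using hom_part_I[of p d] hom_part_of_hom[of p d] rel_ideal_subset_I[of "k + l" p d] by auto

definition cls :: "mvpoly \<Rightarrow> mvpoly set" where
  "cls p = I +>\<^bsub>S\<^esub> p"

lemma cls_eq_I: "p \<in> carrier S \<Longrightarrow> cls p = I \<longleftrightarrow> p \<in> I"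
  unfolding cls_def using I.a_rcos_const I.rcos_const_imp_mem by blast

lemma cls_eq: "p \<in> carrier S \<Longrightarrow> q \<in> carrier S \<Longrightarrow> p - q \<in> I \<Longrightarrow> cls p = cls q"
  unfolding cls_def
  by (intro I.a_repr_independence'[symmetric])
    (auto simp: a_r_coset_def' intro!: bexI[of _ "p - q"])

lemma P_alg_simps:
  "carrier (P_alg k l) = cls ` carrier S"
  "\<zero>\<^bsub>P_alg k l\<^esub> = I"
  "p \<in> carrier S \<Longrightarrow> q \<in> carrier S \<Longrightarrow> cls p \<oplus>\<^bsub>P_alg k l\<^esub> cls q = cls (p + q)"
  "p \<in> carrier S \<Longrightarrow> q \<in> carrier S \<Longrightarrow> cls p \<otimes>\<^bsub>P_alg k l\<^esub> cls q = cls (p * q)"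
proof -
  show "carrier (P_alg k l) = cls ` carrier S"
    by (auto simp: P_alg_def quot_module_simps A_RCOSETS_def' cls_def)
  show "\<zero>\<^bsub>P_alg k l\<^esub> = I"
    by (simp add: P_alg_def quot_module_simps)
  assume pq: "p \<in> carrier S" "q \<in> carrier S"
  show "cls p \<oplus>\<^bsub>P_alg k l\<^esub> cls q = cls (p + q)"
    using I.a_rcos_sum[OF pq] by (simp add: P_alg_def quot_module_simps cls_def)
  show "cls p \<otimes>\<^bsub>P_alg k l\<^esub> cls q = cls (p * q)"
    using I.rcoset_mult_add[OF pq] by (simp add: P_alg_def quot_module_simps cls_def)
qed

lemma module_S: "Module.module (class_ring :: complex ring) S"
  by (rule module_linear_image[OF poly.quotient_space_axioms subspace_S, of _ "\<lambda>p. p"])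
    simp_all

lemma P_alg_smult: "p \<in> carrier S \<Longrightarrow> c \<odot>\<^bsub>P_alg k l\<^esub> cls p = cls (pscale c p)"
proof -
  assume p: "p \<in> carrier S"
  have "c \<odot>\<^bsub>S\<^esub> a \<in> I" if "a \<in> I" for c a
    using I_mult[OF that, of "single 0 c"] by (simp add: S_iff)
  from smult_coset[OF module_S I.abelian_subgroup_axioms this p]
  show ?thesis by (simp add: P_alg_def quot_module_simps cls_def)
qed

lemma cls_0: "cls 0 = I"
  using cls_eq_I[of 0] I.zero_closed poly.subspace_0[OF subspace_S] by simp

lemma module_P_alg: "Module.module (class_ring :: complex ring) (P_alg k l)"
  by (rule module_linear_image[OF poly.quotient_space_axioms subspace_S, of _ cls])
    (simp_all add: P_alg_simps P_alg_smult cls_0)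

sublocale P: Module.module "class_ring :: complex ring" "P_alg k l"
  by (rule module_P_alg)

lemma P_alg_minus:
  assumes "p \<in> carrier S"
  shows "\<ominus>\<^bsub>P_alg k l\<^esub> cls p = cls (- p)"
proof -
  have n: "- p \<in> carrier S" using poly.subspace_neg[OF subspace_S assms] .
  have "cls (- p) \<oplus>\<^bsub>P_alg k l\<^esub> cls p = \<zero>\<^bsub>P_alg k l\<^esub>"
    using assms n by (simp add: P_alg_simps cls_0)
  then show ?thesis using assms n by (intro P.minus_equality) (auto simp: P_alg_simps)
qed

lemma P_alg_sum:
  assumes "finite A" and "\<And>i. i \<in> A \<Longrightarrow> f i \<in> carrier S"
  shows "(\<Oplus>\<^bsub>P_alg k l\<^esub>i\<in>A. cls (f i)) = cls (\<Sum>i\<in>A. f i)"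
  using assms
proof (induction A rule: finite_induct)
  case empty
  then show ?case by (simp add: P_alg_simps cls_0)
next
  case (insert i A)
  have "(\<Sum>i\<in>A. f i) \<in> carrier S" using insert by (intro poly.subspace_sum[OF subspace_S]) auto
  then show ?case
    using insert by (subst P.finsum_insert) (auto simp: P_alg_simps)
qed

abbreviation "idx \<equiv> koszul_index l"

abbreviation "shift T \<equiv> \<Sum>i\<in>T. 2 * int i - 1"

text \<open>Chains with arbitrary, possibly inhomogeneous, coefficients: the homology modules are formed from
  these before the grading is considered.\<close>

definition poly_chains :: "int \<Rightarrow> (nat set \<Rightarrow> mvpoly) set" where
  "poly_chains c = {z. \<forall>T. if T \<in> idx c then z T \<in> carrier S else z T = 0}"

definition chain_cls :: "int \<Rightarrow> (nat set \<Rightarrow> mvpoly) \<Rightarrow> nat set \<Rightarrow> mvpoly set" where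
  "chain_cls c z = (\<lambda>T\<in>idx c. cls (z T))"

lemma poly_chainsD: "z \<in> poly_chains c \<Longrightarrow> T \<in> idx c \<Longrightarrow> z T \<in> carrier S"
  and poly_chains_outside: "z \<in> poly_chains c \<Longrightarrow> T \<notin> idx c \<Longrightarrow> z T = 0"
  by (auto simp: poly_chains_def split: if_splits)

lemma subspace_poly_chains: "chain.subspace (poly_chains c)"
  unfolding poly_chains_def
  by (rule chain.subspaceI)
    (auto simp: poly.subspace_0[OF subspace_S] poly.subspace_add[OF subspace_S]
      poly.subspace_scale[OF subspace_S])

lemma chains_poly_chains: "z \<in> chains hom c d \<Longrightarrow> z \<in> poly_chains c"
  using hom_S by (auto simp: poly_chains_def chains_on_def split: if_splits)

lemma D_poly_chains:
  assumes z: "z \<in> poly_chains c"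
  shows "D z \<in> poly_chains (c + 1)"
  unfolding poly_chains_def
proof (intro CollectI allI)
  fix T
  show "if T \<in> idx (c + 1) then D z T \<in> carrier S else D z T = 0"
  proof (cases "T \<in> idx (c + 1)")
    case True
    then have T: "T \<subseteq> {1..l}" using koszul_indexD by blast
    have "koszul_sign i T * (u i * z (insert i T)) \<in> carrier S" if "i \<in> {1..l} - T" for i
    proof -
      have "z (insert i T) \<in> carrier S"
        using insert_koszul_index[OF T that] True by (intro poly_chainsD[OF z]) blast
      then have "u i * z (insert i T) \<in> carrier S" using S_mult hom_S[OF u_hom] by blast
      then show ?thesis using poly.subspace_neg[OF subspace_S] by (simp add: koszul_sign_def)
    qed
    then have "(\<Sum>i\<in>{1..l} - T. koszul_sign i T * (u i * z (insert i T))) \<in> carrier S"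
      by (rule poly.subspace_sum[OF subspace_S])
    then show ?thesis using True T by (simp add: D_def)
  next
    case False
    have "z (insert i T) = 0" if "T \<subseteq> {1..l}" "i \<in> {1..l} - T" for i
      using insert_koszul_index[OF that] False by (intro poly_chains_outside[OF z]) blast
    then show ?thesis using False by (simp add: D_def)
  qed
qed

lemma carrier_P_koszul: "carrier (P_koszul k l c) = chain_cls c ` poly_chains c"
proof
  show "chain_cls c ` poly_chains c \<subseteq> carrier (P_koszul k l c)"
    using poly_chainsD by (auto simp: P_koszul_def koszul_module_def chain_cls_def P_alg_simps)
  show "carrier (P_koszul k l c) \<subseteq> chain_cls c ` poly_chains c"
  proof
    fix f assume "f \<in> carrier (P_koszul k l c)"
    then have f: "f \<in> idx c \<rightarrow>\<^sub>E cls ` carrier S"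
      by (simp add: P_koszul_def koszul_module_def P_alg_simps)
    then have "\<forall>T\<in>idx c. \<exists>p. p \<in> carrier S \<and> f T = cls p" by (auto simp: PiE_iff)
    then obtain p where p: "\<And>T. T \<in> idx c \<Longrightarrow> p T \<in> carrier S \<and> f T = cls (p T)" by metis
    have "f = chain_cls c (\<lambda>T. if T \<in> idx c then p T else 0)"
      using f p by (auto simp: chain_cls_def PiE_iff extensional_def restrict_def fun_eq_iff)
    moreover have "(\<lambda>T. if T \<in> idx c then p T else 0) \<in> poly_chains c"
      using p by (auto simp: poly_chains_def)
    ultimately show "f \<in> chain_cls c ` poly_chains c" by blast
  qed
qed

lemma P_koszul_add:
  "z \<in> poly_chains c \<Longrightarrow> z' \<in> poly_chains c \<Longrightarrow> chain_cls c (z + z') = chain_cls c z \<oplus>\<^bsub>P_koszul k l c\<^esub> chain_cls c z'"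
  using poly_chainsD
  by (auto simp: P_koszul_def koszul_module_def chain_cls_def P_alg_simps fun_eq_iff restrict_def)

lemma P_koszul_smult:
  "z \<in> poly_chains c \<Longrightarrow> chain_cls c (cscale q z) = q \<odot>\<^bsub>P_koszul k l c\<^esub> chain_cls c z"
  using poly_chainsD
  by (auto simp: P_koszul_def koszul_module_def chain_cls_def P_alg_smult fun_eq_iff restrict_def)

lemma P_koszul_zero: "\<zero>\<^bsub>P_koszul k l c\<^esub> = chain_cls c 0"
  by (simp add: P_koszul_def koszul_module_def chain_cls_def P_alg_simps cls_0)

lemma chain_cls_eq_zero:
  "z \<in> poly_chains c \<Longrightarrow> chain_cls c z = \<zero>\<^bsub>P_koszul k l c\<^esub> \<longleftrightarrow> (\<forall>T\<in>idx c. z T \<in> I)"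
  using poly_chainsD cls_eq_I
  by (auto simp: P_koszul_def koszul_module_def chain_cls_def P_alg_simps fun_eq_iff restrict_def)

lemma P_diff_chain_cls:
  assumes z: "z \<in> poly_chains c"
  shows "P_diff k l c (chain_cls c z) = chain_cls (c + 1) (D z)"
proof
  fix T
  show "P_diff k l c (chain_cls c z) T = chain_cls (c + 1) (D z) T"
  proof (cases "T \<in> idx (c + 1)")
    case True
    then have T: "T \<subseteq> {1..l}" "finite T" using koszul_indexD by blast+
    define g where "g i = koszul_sign i T * (u i * z (insert i T))" for i
    have g: "g i \<in> carrier S \<and> (if even (card {j \<in> T. j < i})
        then P_elt k l i \<otimes>\<^bsub>P_alg k l\<^esub> chain_cls c z (insert i T)
        else \<ominus>\<^bsub>P_alg k l\<^esub> (P_elt k l i \<otimes>\<^bsub>P_alg k l\<^esub> chain_cls c z (insert i T))) = cls (g i)"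
      if i: "i \<in> {1..l} - T" for i
    proof -
      have ins: "insert i T \<in> idx c" using insert_koszul_index[OF T(1) i] True by blast
      have zS: "z (insert i T) \<in> carrier S" by (rule poly_chainsD[OF z ins])
      have uS: "u i \<in> carrier S" by (rule hom_S[OF u_hom])
      have P: "P_elt k l i = cls (u i)" by (simp add: P_elt_def cls_def u_def)
      have uz: "u i * z (insert i T) \<in> carrier S" using S_mult[OF uS zS] .
      have "P_elt k l i \<otimes>\<^bsub>P_alg k l\<^esub> chain_cls c z (insert i T) = cls (u i * z (insert i T))"
        using ins zS uS by (simp add: P chain_cls_def P_alg_simps)
      then show ?thesis
        using uz poly.subspace_neg[OF subspace_S uz] P_alg_minus[OF uz]
        by (simp add: g_def koszul_sign_def)
    qed
    have "P_diff k l c (chain_cls c z) T = (\<Oplus>\<^bsub>P_alg k l\<^esub>i\<in>{1..l} - T.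
        (if even (card {j \<in> T. j < i}) then P_elt k l i \<otimes>\<^bsub>P_alg k l\<^esub> chain_cls c z (insert i T)
         else \<ominus>\<^bsub>P_alg k l\<^esub> (P_elt k l i \<otimes>\<^bsub>P_alg k l\<^esub> chain_cls c z (insert i T))))"
      using True by (simp add: P_diff_def koszul_diff_def)
    also have "\<dots> = (\<Oplus>\<^bsub>P_alg k l\<^esub>i\<in>{1..l} - T. cls (g i))"
    proof (rule P.finsum_cong'[OF refl])
      show "(\<lambda>i. cls (g i)) \<in> {1..l} - T \<rightarrow> carrier (P_alg k l)"
        using g by (auto simp: P_alg_simps)
    qed (use g in blast)
    also have "\<dots> = cls (\<Sum>i\<in>{1..l} - T. g i)" using g by (intro P_alg_sum) auto
    also have "\<dots> = chain_cls (c + 1) (D z) T"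
      using True T by (simp add: chain_cls_def D_def g_def)
    finally show ?thesis .
  next
    case False
    then show ?thesis by (simp add: P_diff_def koszul_diff_def chain_cls_def)
  qed
qed

definition poly_cycles :: "int \<Rightarrow> (nat set \<Rightarrow> mvpoly) set" where
  "poly_cycles c = {z \<in> poly_chains c. \<forall>T\<in>idx (c + 1). D z T \<in> I}"

lemma cocycle_iff:
  "z \<in> poly_chains c \<Longrightarrow> chain_cls c z \<in> cocycles (P_koszul k l) (P_diff k l) c \<longleftrightarrow> z \<in> poly_cycles c"
  using chain_cls_eq_zero[OF D_poly_chains, of z c]
  by (auto simp: cocycles_def a_kernel_def' carrier_P_koszul P_diff_chain_cls poly_cycles_def)

lemma cocycles_eq: "cocycles (P_koszul k l) (P_diff k l) c = chain_cls c ` poly_cycles c"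
proof -
  have "cocycles (P_koszul k l) (P_diff k l) c \<subseteq> chain_cls c ` poly_chains c"
    by (auto simp: cocycles_def a_kernel_def' carrier_P_koszul)
  then show ?thesis using cocycle_iff by (force simp: poly_cycles_def)
qed

lemma coboundaries_eq: "coboundaries (P_koszul k l) (P_diff k l) c = chain_cls c ` D ` poly_chains (c - 1)"
  using P_diff_chain_cls[of _ "c - 1"]
  by (auto simp: coboundaries_def carrier_P_koszul image_image)

lemma subspace_poly_cycles: "chain.subspace (poly_cycles c)"
proof (rule chain.subspaceI)
  have I0: "0 \<in> I" using I.zero_closed by simp
  have sc: "pscale q p \<in> I" if "p \<in> I" for q p
    using I_mult[OF that, of "single 0 q"] by (simp add: S_iff)
  show "0 \<in> poly_cycles c"
    using I0 chain.subspace_0[OF subspace_poly_chains] by (simp add: poly_cycles_def)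
  show "z + z' \<in> poly_cycles c" if "z \<in> poly_cycles c" "z' \<in> poly_cycles c" for z z'
    using that I_add chain.subspace_add[OF subspace_poly_chains] by (simp add: poly_cycles_def D_add)
  show "cscale q z \<in> poly_cycles c" if "z \<in> poly_cycles c" for q z
    using that sc chain.subspace_scale[OF subspace_poly_chains] by (simp add: poly_cycles_def D_mult)
qed

lemma subspace_D_poly_chains: "chain.subspace (D ` poly_chains c)"
proof (rule chain.subspaceI)
  note sub = subspace_poly_chains[of c]
  show "0 \<in> D ` poly_chains c" using chain.subspace_0[OF sub] D_zero by (metis imageI)
  fix a assume "a \<in> D ` poly_chains c"
  then obtain y where y: "y \<in> poly_chains c" "a = D y" by blast
  show "cscale q a \<in> D ` poly_chains c" for q
    using chain.subspace_scale[OF sub y(1), of q] y(2) D_mult[of "single 0 q" y] by (metis imageI)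
  fix b assume "b \<in> D ` poly_chains c"
  then obtain x where "x \<in> poly_chains c" "b = D x" by blast
  then show "a + b \<in> D ` poly_chains c"
    using y chain.subspace_add[OF sub] D_add[of y x] by (metis imageI)
qed

lemma cycles_eq: "cycles J c d = chains hom c d \<inter> poly_cycles c"
proof -
  have "D z \<in> chains J (c + 1) (d + 1) \<longleftrightarrow> (\<forall>T\<in>idx (c + 1). D z T \<in> I)" if z: "z \<in> chains hom c d" for z
  proof -
    have Dz: "D z \<in> chains hom (c + 1) (d + 1)" by (rule D_chains[OF graded_ideal_hom z])
    have "D z T \<in> I \<longleftrightarrow> D z T \<in> J (d + 1 - shift T)" if "T \<in> idx (c + 1)" for T
      using I_iff_J[OF chains_onD[OF Dz that]] .
    then show ?thesis using chains_on_outside[OF Dz] by (auto simp: chains_on_def)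
  qed
  then show ?thesis using chains_poly_chains by (auto simp: cycles_def poly_cycles_def)
qed

definition chain_part :: "int \<Rightarrow> (nat set \<Rightarrow> mvpoly) \<Rightarrow> (nat set \<Rightarrow> mvpoly)" where
  "chain_part d z T = hom_part (d - shift T) (z T)"

lemma D_chain_part: "chain_part (d + 1) (D z) = D (chain_part d z)"
proof
  fix T
  show "chain_part (d + 1) (D z) T = D (chain_part d z) T"
  proof (cases "T \<subseteq> {1..l}")
    case True
    then have fin: "finite T" using finite_subset by blast
    have "hom_part (d + 1 - shift T) (koszul_sign i T * (u i * p))
      = koszul_sign i T * (u i * hom_part (d - shift (insert i T)) p)"
      if "i \<notin> T" for i p
    proof -
      have "hom_part (d + 1 - shift T) (u i * p)
          = u i * hom_part (d - shift (insert i T)) p"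
        using that fin hom_part_mult_hom[OF u_hom, of "d + 1 - shift T" i p]
        by (simp add: algebra_simps)
      then show ?thesis using hom_part_diff[of _ 0 "u i * p"] by (simp add: koszul_sign_def)
    qed
    then show ?thesis
      using True by (simp add: chain_part_def D_def hom_part_sum)
  qed (simp add: chain_part_def D_def)
qed

lemma chain_part_hom:
  assumes "z \<in> poly_chains c"
  shows "chain_part d z \<in> chains hom c d"
proof (rule chains_onI)
  show "chain_part d z T \<in> hom (d - shift T)" if "T \<in> idx c" for T
    unfolding chain_part_def by (rule hom_part_hom[OF poly_chainsD[OF assms that]])
  show "chain_part d z T = 0" if "T \<notin> idx c" for T
    using poly_chains_outside[OF assms that] by (simp add: chain_part_def)
qed

lemma chain_part_of_hom:
  assumes "z \<in> chains hom c d"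
  shows "chain_part d z = z"
proof
  show "chain_part d z T = z T" for T
    using chains_onD[OF assms] chains_on_outside[OF assms] hom_part_of_hom
    by (cases "T \<in> idx c") (auto simp: chain_part_def)
qed

text \<open>A homogeneous cycle that is a boundary over \<open>P\<close> bounds a possibly inhomogeneous chain \<open>y\<close>.
  The part of \<open>y\<close> of the right degree bounds it as well.\<close>

lemma boundaries_iff:
  assumes z: "z \<in> chains hom c d"
  shows "z \<in> boundaries J c d \<longleftrightarrow> chain_cls c z \<in> chain_cls c ` D ` poly_chains (c - 1)"
proof
  assume "z \<in> boundaries J c d"
  then obtain y j where yj: "y \<in> chains hom (c - 1) (d - 1)" "j \<in> chains J c d" "z = D y + j"
    by (rule boundariesE)
  have y: "y \<in> poly_chains (c - 1)" by (rule chains_poly_chains[OF yj(1)])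
  have "chain_cls c z = chain_cls c (D y)"
    unfolding chain_cls_def
  proof (rule restrict_ext)
    fix T assume T: "T \<in> idx c"
    have "D y \<in> poly_chains c" using D_poly_chains[OF y] by simp
    moreover have "j T \<in> I" using rel_ideal_subset_I[OF order_refl chains_onD[OF yj(2) T]] .
    moreover have "z T - D y T = j T" using yj(3) by simp
    ultimately show "cls (z T) = cls (D y T)"
      using poly_chainsD[OF _ T] chains_poly_chains[OF z] by (intro cls_eq) simp_all
  qed
  then show "chain_cls c z \<in> chain_cls c ` D ` poly_chains (c - 1)" using y by blast
next
  assume "chain_cls c z \<in> chain_cls c ` D ` poly_chains (c - 1)"
  then obtain y where y: "y \<in> poly_chains (c - 1)" "chain_cls c z = chain_cls c (D y)" by auto
  have Dy: "D y \<in> poly_chains c" using D_poly_chains[OF y(1)] by simp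
  have zc: "z \<in> poly_chains c" by (rule chains_poly_chains[OF z])
  have zDy: "z T - D y T \<in> I" if T: "T \<in> idx c" for T
  proof -
    have zT: "z T \<in> carrier S" "D y T \<in> carrier S" using poly_chainsD zc Dy T by auto
    have "I +>\<^bsub>S\<^esub> z T = I +>\<^bsub>S\<^esub> D y T"
      using fun_cong[OF y(2), of T] T by (simp add: chain_cls_def cls_def)
    then have "z T \<in> I +>\<^bsub>S\<^esub> D y T" using I.a_rcos_self[OF zT(1)] by simp
    then show ?thesis by (auto simp: a_r_coset_def')
  qed
  let ?y = "chain_part (d - 1) y"
  have "z - D ?y = chain_part d (z - D y)"
    using chain_part_of_hom[OF z] D_chain_part[of "d - 1" y]
    by (auto simp: fun_eq_iff chain_part_def hom_part_diff)
  moreover have "chain_part d (z - D y) \<in> chains J c d"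
  proof (rule chains_onI)
    show "chain_part d (z - D y) T \<in> J (d - shift T)" if "T \<in> idx c" for T
      unfolding chain_part_def by (rule hom_part_I) (use zDy[OF that] in simp)
    show "chain_part d (z - D y) T = 0" if "T \<notin> idx c" for T
      using poly_chains_outside[OF zc that] poly_chains_outside[OF Dy that] by (simp add: chain_part_def)
  qed
  ultimately have "z - D ?y \<in> chains J c d" by (simp only:)
  then show "z \<in> boundaries J c d"
    by (rule boundariesI[OF chain_part_hom[OF y(1)]]) simp
qed

lemma P_koszul_grading_eq: "P_koszul_grading k l c d = chain_cls c ` chains hom c d"
proof -
  have G: "shift_grading s (P_grading k l) d = cls ` hom (d - s)" for s
    by (auto simp: shift_grading_def P_grading_def quot_grading_def cls_def)
  show ?thesis
  proof
    show "chain_cls c ` chains hom c d \<subseteq> P_koszul_grading k l c d"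
      using chains_onD by (fastforce simp: P_koszul_grading_def koszul_grading_def G chain_cls_def)
    show "P_koszul_grading k l c d \<subseteq> chain_cls c ` chains hom c d"
    proof
      fix f assume "f \<in> P_koszul_grading k l c d"
      then have f: "f \<in> (\<Pi>\<^sub>E T\<in>idx c. cls ` hom (d - shift T))"
        by (simp add: P_koszul_grading_def koszul_grading_def G)
      then have "\<forall>T\<in>idx c. \<exists>p. p \<in> hom (d - shift T) \<and> f T = cls p"
        by (auto simp: PiE_iff)
      then obtain p where p: "\<And>T. T \<in> idx c \<Longrightarrow> p T \<in> hom (d - shift T) \<and> f T = cls (p T)"
        by metis
      have "f = chain_cls c (\<lambda>T. if T \<in> idx c then p T else 0)"
        using f p by (auto simp: chain_cls_def PiE_iff extensional_def restrict_def fun_eq_iff)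
      moreover have "(\<lambda>T. if T \<in> idx c then p T else 0) \<in> chains hom c d"
        using p by (auto simp: chains_on_def)
      ultimately show "f \<in> chain_cls c ` chains hom c d" by blast
    qed
  qed
qed

lemma dim_P_homology:
  "vectorspace.dim (class_ring :: complex ring)
      ((P_homology k l c)\<lparr>carrier := P_homology_grading k l c d\<rparr>) = hdim J c d"
proof -
  let ?Z = "cocycles (P_koszul k l) (P_diff k l) c"
  let ?M = "(P_koszul k l c)\<lparr>carrier := ?Z\<rparr>"
  note J = graded_ideal_rel_ideal[of "k + l"]
  have grading: "?Z \<inter> P_koszul_grading k l c d = chain_cls c ` cycles J c d"
    unfolding P_koszul_grading_eq cycles_eq using cocycle_iff chains_poly_chains by blast
  have sub: "D ` poly_chains (c - 1) \<subseteq> poly_cycles c"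
  proof
    fix a assume "a \<in> D ` poly_chains (c - 1)"
    then obtain y where y: "y \<in> poly_chains (c - 1)" "a = D y" by blast
    have "0 \<in> I" using I.zero_closed by simp
    then show "a \<in> poly_cycles c"
      using D_poly_chains[OF y(1)] y(2) D_D by (simp add: poly_cycles_def)
  qed
  have "vectorspace.dim (class_ring :: complex ring)
      (quot_module ?M (chain_cls c ` D ` poly_chains (c - 1))
        \<lparr>carrier := (\<lambda>a. chain_cls c ` D ` poly_chains (c - 1) +>\<^bsub>?M\<^esub> a) ` chain_cls c ` cycles J c d\<rparr>)
    = chain.codim (cycles J c d) {z \<in> cycles J c d. chain_cls c z \<in> chain_cls c ` D ` poly_chains (c - 1)}"
  proof (rule dim_quot_module[OF chain.quotient_space_axioms subspace_poly_cycles])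
    show "carrier ?M = chain_cls c ` poly_cycles c" by (simp add: cocycles_eq)
    show "cycles J c d \<subseteq> poly_cycles c" by (simp add: cycles_eq)
  qed (use sub subspace_D_poly_chains subspace_cycles[OF J] finitely_spanned_cycles
      in \<open>auto simp: P_koszul_add P_koszul_smult P_koszul_zero poly_cycles_def\<close>)
  also have "{z \<in> cycles J c d. chain_cls c z \<in> chain_cls c ` D ` poly_chains (c - 1)} = boundaries J c d"
  proof -
    have "z \<in> chains hom c d" if "z \<in> cycles J c d" for z using that by (simp add: cycles_def)
    then show ?thesis using boundaries_iff boundaries_subset_cycles[OF J, of c d] by blast
  qed
  finally show ?thesis
    unfolding P_homology_def P_homology_grading_def homology_def homology_grading_def quot_grading_def
      coboundaries_eq grading hdim_def .
qed

lemma qdim_P_homology: "qdim (P_homology k l c) (P_homology_grading k l c) = series (hdim J c)"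
  by (simp add: qdim_def series_def dim_P_homology)

lemma qdim_R':
  "qdim (mvpoly_ring (R'_vars k l)) (mvpoly_grading (R'_vars k l))
    = series (\<lambda>d. poly.codim (mvpoly_grading (R'_vars k l) d) {0})"
proof -
  interpret R': graded_poly_ring "R'_vars k l" by (rule graded_poly_ring_R')
  have "vectorspace.dim (class_ring :: complex ring) (mvpoly_ring (R'_vars k l)\<lparr>carrier := R'.hom d\<rparr>)
      = poly.codim (R'.hom d) {0}" for d
    by (rule vectorspace_dim_eq_codim[OF poly.quotient_space_axioms R'.finitely_spanned_hom R'.subspace_hom,
          where \<phi> = "\<lambda>p. p"])
      (auto simp: mvpoly_ring_def poly.subspace_single_0)
  then show ?thesis by (simp add: qdim_def series_def)
qed

end

theorem corollary3:
  fixes k l :: nat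
  assumes "k \<ge> 1" and "l \<ge> 1"
  shows "(\<Sum>i=0..l. (-1) ^ i * fls_X_inv ^ i
            * fls_const (qdim (P_homology k l (- int i)) (P_homology_grading k l (- int i))))
       = (fls_const (qdim (mvpoly_ring (R'_vars k l)) (mvpoly_grading (R'_vars k l)))
            * (\<Prod>i=1..l. 1 - fls_X_inv * fls_const (fls_X ^ (2 * k + 2 * i - 1))) :: int fls fls)"
proof -
  interpret relation_ring k l .
  show ?thesis
    using homology_series_P by (simp add: homology_series_def qdim_P_homology qdim_R')
qed

end
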